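(* Let $\mathcal G$ be a basic simple finite dimensional complex Lie superalgebra whose even part is $\mathcal G_0\oplus H$, where $H$ is the center of the even part and the semisimple part $\mathcal G_0$ is a simple Lie algebra. Assume the non-degenerate invariant form on $\mathcal G$ restricted to $\mathcal G_0$ is positive definite (normalized so that the highest root of $\mathcal G_0$ has square length $2$). Let $\widehat{\mathcal G}$ be the corresponding untwisted affine Lie superalgebra with central element $K$. Let $V$ be an irreducible integrable highest weight module for $\widehat{\mathcal G}$ with finite dimensional weight spaces on which $K$ acts by a positive integer. Then $V$ is completely reducible as a module for the even part $\widehat{\mathcal G_0\oplus H}=(\mathcal G_0\oplus H)\otimes\mathbb C[t,t^{-1}]\oplus\mathbb C K\oplus\mathbb C d$ of $\widehat{\mathcal G}$.
   Context: All algebras are over $\mathbb C$. A simple finite dimensional Lie superalgebra $\mathcal G$ is called basic if its even part is reductive and $\mathcal G$ carries a non-degenerate invariant even (super)symmetric bilinear form $(\cdot,\cdot)$. Let $h$ be a Cartan subalgebra of $\mathcal G$ contained in the even part. Positive definiteness of the form on the simple Lie algebra $\mathcal G_0$ means that the induced form on the real span of its roots is positive definite. The affine Lie superalgebra is $\widehat{\mathcal G}=\mathcal G\otimes\mathbb C[t,t^{-1}]\oplus\mathbb C K\oplus\mathbb C d$ with, writing $x(n)=x\otimes t^n$, $[x(n),y(m)]=[x,y](m+n)+n(x,y)\delta_{m+n,0}K$, $[d,x(n)]=n\,x(n)$, and $K$ central. Put $\widehat h=h\oplus\mathbb C K\oplus\mathbb C d$. A $\widehat{\mathcal G}$-module $V$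 is called integrable if: (1) $V=\bigoplus_{\lambda\in\widehat h^*}V_\lambda$, where $V_\lambda=\{v\in V: xv=\lambda(x)v\ \forall x\in\widehat h\}$; (2) the Chevalley generators of the affine Lie algebra $\mathcal G_0\otimes\mathbb C[t,t^{-1}]\oplus\mathbb C K\oplus\mathbb C d$ act locally nilpotently on $V$; (3) for every $v\in V$, $U(\mathcal G)v$ is finite dimensional, where $U(\mathcal G)$ is the universal enveloping algebra of $\mathcal G=\mathcal G\otimes 1$. Finite dimensional weight spaces means $\dim V_\lambda<\infty$ for all $\lambda$. Highest weight module: fix a system of simple roots of $\mathcal G$ with triangular decomposition $\mathcal G=n^-\oplus h\oplus n^+$, and let $\widehat n^+=n^+\oplus(\mathcal G\otimes t\,\mathbb C[t])$. A $\widehat{\mathcal G}$-module is a highest weight module if it is generated by a non-zero weight vector $v$ with $\widehat n^+v=0$. Completely reducible means a direct sum of irreducible submodules. *)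

theory Defs
  imports Complex_Main "HOL-Library.Poly_Mapping" "HOL-Library.Z2" "HOL-Library.Product_Plus"
begin

section \<open>Linear algebra\<close>

text \<open>Vector spaces are whole types with an explicit scalar multiplication \<open>sc\<close>.\<close>

definition fin_dim :: "(complex \<Rightarrow> 'a \<Rightarrow> 'a) \<Rightarrow> 'a::ab_group_add set \<Rightarrow> bool" where
  "fin_dim sc W \<longleftrightarrow> (\<exists>S. finite S \<and> W \<subseteq> module.span sc S)"

definition direct_sum_decomp ::
    "(complex \<Rightarrow> 'a \<Rightarrow> 'a) \<Rightarrow> 'i set \<Rightarrow> ('i \<Rightarrow> 'a::ab_group_add set) \<Rightarrow> bool" where
  "direct_sum_decomp sc I W \<longleftrightarrow>
     (\<forall>i\<in>I. module.subspace sc (W i)) \<and>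
     (\<forall>v. \<exists>!f. (\<forall>i. i \<notin> I \<longrightarrow> f i = 0) \<and> (\<forall>i\<in>I. f i \<in> W i) \<and>
              finite {i. f i \<noteq> 0} \<and> v = (\<Sum>i | f i \<noteq> 0. f i))"

text \<open>The dual of a subspace \<open>S\<close>; functionals are set to 0 outside \<open>S\<close>, so that each one is
  represented by exactly one function.\<close>

definition dual_space :: "(complex \<Rightarrow> 'a \<Rightarrow> 'a) \<Rightarrow> 'a::ab_group_add set \<Rightarrow> ('a \<Rightarrow> complex) set" where
  "dual_space sc S = {f. (\<forall>x\<in>S. \<forall>y\<in>S. f (x + y) = f x + f y) \<and>
                         (\<forall>c. \<forall>x\<in>S. f (sc c x) = c * f x) \<and> (\<forall>x. x \<notin> S \<longrightarrow> f x = 0)}"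

section \<open>Lie superalgebras\<close>

text \<open>The degrees are the elements of \<^typ>\<open>bit\<close>, the integers modulo 2.\<close>

definition ssign :: "bit \<Rightarrow> bit \<Rightarrow> complex" where
  "ssign a b = (if a = 1 \<and> b = 1 then - 1 else 1)"

locale lie_superalgebra =
  fixes sc :: "complex \<Rightarrow> 'g::ab_group_add \<Rightarrow> 'g"
    and gr :: "bit \<Rightarrow> 'g set"
    and br :: "'g \<Rightarrow> 'g \<Rightarrow> 'g"
  assumes vector_space: "vector_space sc"
    and grading: "direct_sum_decomp sc UNIV gr"
    and bracket_linear_right: "Vector_Spaces.linear sc sc (br x)"
    and bracket_linear_left: "Vector_Spaces.linear sc sc (\<lambda>x. br x y)"
    and bracket_graded: "x \<in> gr a \<Longrightarrow> y \<in> gr b \<Longrightarrow> br x y \<in> gr (a + b)"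
    and super_skew: "x \<in> gr a \<Longrightarrow> y \<in> gr b \<Longrightarrow> br x y = - sc (ssign a b) (br y x)"
    and super_jacobi: "x \<in> gr a \<Longrightarrow> y \<in> gr b \<Longrightarrow>
          br x (br y z) = br (br x y) z + sc (ssign a b) (br y (br x z))"

definition graded_subspace ::
    "(complex \<Rightarrow> 'a \<Rightarrow> 'a) \<Rightarrow> (bit \<Rightarrow> 'a set) \<Rightarrow> 'a::ab_group_add set \<Rightarrow> bool" where
  "graded_subspace sc gr W \<longleftrightarrow> module.subspace sc W \<and>
     (\<forall>w\<in>W. \<exists>x\<in>W \<inter> gr 0. \<exists>y\<in>W \<inter> gr 1. w = x + y)"

definition simple_superalgebra ::
    "(complex \<Rightarrow> 'g \<Rightarrow> 'g) \<Rightarrow> (bit \<Rightarrow> 'g set) \<Rightarrow> ('g \<Rightarrow> 'g \<Rightarrow> 'g::ab_group_add) \<Rightarrow> bool" where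
  "simple_superalgebra sc gr br \<longleftrightarrow> (\<exists>x y. br x y \<noteq> 0) \<and>
     (\<forall>I. graded_subspace sc gr I \<and> (\<forall>x. \<forall>y\<in>I. br x y \<in> I) \<longrightarrow> I = {0} \<or> I = UNIV)"

subsection \<open>Lie algebras inside the even part\<close>

definition lie_prod ::
    "(complex \<Rightarrow> 'g \<Rightarrow> 'g) \<Rightarrow> ('g \<Rightarrow> 'g \<Rightarrow> 'g::ab_group_add) \<Rightarrow> 'g set \<Rightarrow> 'g set \<Rightarrow> 'g set" where
  "lie_prod sc br A C = module.span sc {br x y | x y. x \<in> A \<and> y \<in> C}"

definition lie_subalgebra ::
    "(complex \<Rightarrow> 'g \<Rightarrow> 'g) \<Rightarrow> ('g \<Rightarrow> 'g \<Rightarrow> 'g::ab_group_add) \<Rightarrow> 'g set \<Rightarrow> bool" where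
  "lie_subalgebra sc br L \<longleftrightarrow> module.subspace sc L \<and> (\<forall>x\<in>L. \<forall>y\<in>L. br x y \<in> L)"

definition lie_ideal ::
    "(complex \<Rightarrow> 'g \<Rightarrow> 'g) \<Rightarrow> ('g \<Rightarrow> 'g \<Rightarrow> 'g::ab_group_add) \<Rightarrow> 'g set \<Rightarrow> 'g set \<Rightarrow> bool" where
  "lie_ideal sc br L I \<longleftrightarrow> module.subspace sc I \<and> I \<subseteq> L \<and> (\<forall>x\<in>L. \<forall>y\<in>I. br x y \<in> I)"

definition lie_center :: "('g \<Rightarrow> 'g \<Rightarrow> 'g::ab_group_add) \<Rightarrow> 'g set \<Rightarrow> 'g set" where
  "lie_center br L = {x\<in>L. \<forall>y\<in>L. br x y = 0}"

definition lie_solvable ::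
    "(complex \<Rightarrow> 'g \<Rightarrow> 'g) \<Rightarrow> ('g \<Rightarrow> 'g \<Rightarrow> 'g::ab_group_add) \<Rightarrow> 'g set \<Rightarrow> bool" where
  "lie_solvable sc br L \<longleftrightarrow> (\<exists>n. ((\<lambda>A. lie_prod sc br A A) ^^ n) L = {0})"

definition lie_nilpotent ::
    "(complex \<Rightarrow> 'g \<Rightarrow> 'g) \<Rightarrow> ('g \<Rightarrow> 'g \<Rightarrow> 'g::ab_group_add) \<Rightarrow> 'g set \<Rightarrow> bool" where
  "lie_nilpotent sc br L \<longleftrightarrow> (\<exists>n. ((\<lambda>A. lie_prod sc br L A) ^^ n) L = {0})"

definition lie_radical ::
    "(complex \<Rightarrow> 'g \<Rightarrow> 'g) \<Rightarrow> ('g \<Rightarrow> 'g \<Rightarrow> 'g::ab_group_add) \<Rightarrow> 'g set \<Rightarrow> 'g set" where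
  "lie_radical sc br L =
     module.span sc (\<Union>{I. lie_ideal sc br L I \<and> lie_solvable sc br I})"

definition lie_reductive ::
    "(complex \<Rightarrow> 'g \<Rightarrow> 'g) \<Rightarrow> ('g \<Rightarrow> 'g \<Rightarrow> 'g::ab_group_add) \<Rightarrow> 'g set \<Rightarrow> bool" where
  "lie_reductive sc br L \<longleftrightarrow> lie_radical sc br L = lie_center br L"

definition simple_lie_algebra ::
    "(complex \<Rightarrow> 'g \<Rightarrow> 'g) \<Rightarrow> ('g \<Rightarrow> 'g \<Rightarrow> 'g::ab_group_add) \<Rightarrow> 'g set \<Rightarrow> bool" where
  "simple_lie_algebra sc br L \<longleftrightarrow> lie_subalgebra sc br L \<and> (\<exists>x\<in>L. \<exists>y\<in>L. br x y \<noteq> 0) \<and>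
     (\<forall>I. lie_ideal sc br L I \<longrightarrow> I = {0} \<or> I = L)"

text \<open>Nilpotent and equal to its own normalizer in the whole superalgebra.\<close>

definition cartan_subalgebra ::
    "(complex \<Rightarrow> 'g \<Rightarrow> 'g) \<Rightarrow> ('g \<Rightarrow> 'g \<Rightarrow> 'g::ab_group_add) \<Rightarrow> 'g set \<Rightarrow> bool" where
  "cartan_subalgebra sc br h \<longleftrightarrow> lie_subalgebra sc br h \<and> lie_nilpotent sc br h \<and>
     {x. \<forall>y\<in>h. br x y \<in> h} = h"

subsection \<open>Basic Lie superalgebras\<close>

locale basic_lie_superalgebra = lie_superalgebra sc gr br
  for sc :: "complex \<Rightarrow> 'g::ab_group_add \<Rightarrow> 'g"
    and gr :: "bit \<Rightarrow> 'g set"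
    and br :: "'g \<Rightarrow> 'g \<Rightarrow> 'g" +
  fixes B :: "'g \<Rightarrow> 'g \<Rightarrow> complex"
  assumes finite_dimensional: "fin_dim sc (UNIV :: 'g set)"
    and simple: "simple_superalgebra sc gr br"
    and even_reductive: "lie_reductive sc br (gr 0)"
    and form_linear_right: "Vector_Spaces.linear sc (*) (B x)"
    and form_linear_left: "Vector_Spaces.linear sc (*) (\<lambda>x. B x y)"
    and form_even: "x \<in> gr a \<Longrightarrow> y \<in> gr b \<Longrightarrow> a \<noteq> b \<Longrightarrow> B x y = 0"
    and form_supersymmetric: "x \<in> gr a \<Longrightarrow> y \<in> gr b \<Longrightarrow> B x y = ssign a b * B y x"
    and form_invariant: "B (br x y) z = B x (br y z)"
    and form_nondegenerate: "(\<And>y. B x y = 0) \<Longrightarrow> x = 0"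

section \<open>Roots\<close>

definition root_space ::
    "(complex \<Rightarrow> 'g \<Rightarrow> 'g) \<Rightarrow> ('g \<Rightarrow> 'g \<Rightarrow> 'g::ab_group_add) \<Rightarrow> 'g set \<Rightarrow> 'g set
       \<Rightarrow> ('g \<Rightarrow> complex) \<Rightarrow> 'g set" where
  "root_space sc br h L \<alpha> = {x\<in>L. \<forall>y\<in>h. br y x = sc (\<alpha> y) x}"

definition roots ::
    "(complex \<Rightarrow> 'g \<Rightarrow> 'g) \<Rightarrow> ('g \<Rightarrow> 'g \<Rightarrow> 'g::ab_group_add) \<Rightarrow> 'g set \<Rightarrow> 'g set
       \<Rightarrow> ('g \<Rightarrow> complex) set" where
  "roots sc br h L = {\<alpha> \<in> dual_space sc h. \<alpha> \<noteq> (\<lambda>y. 0) \<and> root_space sc br h L \<alpha> \<noteq> {0}}"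

definition nat_comb :: "('g \<Rightarrow> complex) set \<Rightarrow> (('g \<Rightarrow> complex) \<Rightarrow> nat) \<Rightarrow> 'g \<Rightarrow> complex" where
  "nat_comb \<Pi> c = (\<lambda>y. \<Sum>\<beta>\<in>\<Pi>. of_nat (c \<beta>) * \<beta> y)"

text \<open>Linear independence is the usual requirement except for \<open>psl(n|n)\<close>, whose simple roots are
  dependent; there the even part has two simple factors.\<close>

definition simple_root_system :: "('g \<Rightarrow> complex) set \<Rightarrow> ('g \<Rightarrow> complex) set \<Rightarrow> bool" where
  "simple_root_system \<Delta> \<Pi> \<longleftrightarrow> \<Pi> \<subseteq> \<Delta> \<and> finite \<Pi> \<and>
     (\<forall>c :: ('g \<Rightarrow> complex) \<Rightarrow> complex. (\<forall>y. (\<Sum>\<beta>\<in>\<Pi>. c \<beta> * \<beta> y) = 0) \<longrightarrow> (\<forall>\<beta>\<in>\<Pi>. c \<beta> = 0)) \<and>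
     (\<forall>\<alpha>\<in>\<Delta>. \<exists>c. \<alpha> = nat_comb \<Pi> c \<or> \<alpha> = (\<lambda>y. - nat_comb \<Pi> c y))"

definition positive_roots ::
    "('g \<Rightarrow> complex) set \<Rightarrow> ('g \<Rightarrow> complex) set \<Rightarrow> ('g \<Rightarrow> complex) set" where
  "positive_roots \<Delta> \<Pi> = {\<alpha>\<in>\<Delta>. \<exists>c. \<alpha> = nat_comb \<Pi> c}"

definition highest_root ::
    "('g \<Rightarrow> complex) set \<Rightarrow> ('g \<Rightarrow> complex) set \<Rightarrow> ('g \<Rightarrow> complex) \<Rightarrow> bool" where
  "highest_root \<Delta> \<Pi> \<theta> \<longleftrightarrow> \<theta> \<in> \<Delta> \<and> (\<forall>\<alpha>\<in>\<Delta>. \<exists>c. \<theta> = (\<lambda>y. \<alpha> y + nat_comb \<Pi> c y))"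

text \<open>The form on the dual of \<open>h\<close> transported from \<open>h\<close>: a functional \<open>\<alpha>\<close> corresponds to the
  element \<open>t\<close> of \<open>h\<close> with \<open>(t, y) = \<alpha>(y)\<close> on \<open>h\<close> (\<open>B\<close> is nondegenerate on \<open>h\<close>).\<close>

definition dual_vector ::
    "('g \<Rightarrow> 'g \<Rightarrow> complex) \<Rightarrow> 'g set \<Rightarrow> ('g \<Rightarrow> complex) \<Rightarrow> 'g" where
  "dual_vector B h \<alpha> = (THE t. t \<in> h \<and> (\<forall>y\<in>h. B t y = \<alpha> y))"

definition dual_form ::
    "('g \<Rightarrow> 'g \<Rightarrow> complex) \<Rightarrow> 'g set \<Rightarrow> ('g \<Rightarrow> complex) \<Rightarrow> ('g \<Rightarrow> complex) \<Rightarrow> complex" where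
  "dual_form B h \<alpha> \<beta> = B (dual_vector B h \<alpha>) (dual_vector B h \<beta>)"

definition real_root_span :: "('g \<Rightarrow> complex) set \<Rightarrow> ('g \<Rightarrow> complex) set" where
  "real_root_span \<Delta> = {(\<lambda>y. \<Sum>\<alpha>\<in>\<Delta>. complex_of_real (r \<alpha>) * \<alpha> y) | r. True}"

definition positive_definite_on_roots ::
    "('g \<Rightarrow> 'g \<Rightarrow> complex) \<Rightarrow> 'g set \<Rightarrow> ('g \<Rightarrow> complex) set \<Rightarrow> bool" where
  "positive_definite_on_roots B h \<Delta> \<longleftrightarrow>
     (\<forall>\<mu>\<in>real_root_span \<Delta>. \<mu> \<noteq> (\<lambda>y. 0) \<longrightarrow>
        dual_form B h \<mu> \<mu> \<in> \<real> \<and> 0 < Re (dual_form B h \<mu> \<mu>))"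

section \<open>The affine Lie superalgebra\<close>

text \<open>The triple \<open>(f, a, b)\<close> stands for the sum of all \<open>f\<^sub>n \<otimes> t\<^sup>n\<close> plus \<open>a K + b d\<close>.\<close>

type_synonym 'g affine = "(int \<Rightarrow>\<^sub>0 'g) \<times> complex \<times> complex"

abbreviation "lookup \<equiv> Poly_Mapping.lookup"
abbreviation "keys \<equiv> Poly_Mapping.keys"

definition loop :: "'g::ab_group_add \<Rightarrow> int \<Rightarrow> 'g affine" where
  "loop x n = (Poly_Mapping.single n x, 0, 0)"

definition aff_K :: "'g::ab_group_add affine" where "aff_K = (0, 1, 0)"

definition aff_d :: "'g::ab_group_add affine" where "aff_d = (0, 0, 1)"

definition aff_scale ::
    "(complex \<Rightarrow> 'g \<Rightarrow> 'g) \<Rightarrow> complex \<Rightarrow> 'g::ab_group_add affine \<Rightarrow> 'g affine" where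
  "aff_scale sc c = (\<lambda>(f, a, b). (Poly_Mapping.map (sc c) f, c * a, c * b))"

definition aff_bracket ::
    "(complex \<Rightarrow> 'g \<Rightarrow> 'g) \<Rightarrow> ('g \<Rightarrow> 'g \<Rightarrow> 'g) \<Rightarrow> ('g \<Rightarrow> 'g \<Rightarrow> complex)
       \<Rightarrow> 'g::ab_group_add affine \<Rightarrow> 'g affine \<Rightarrow> 'g affine" where
  "aff_bracket sc br B = (\<lambda>(f, a, b) (g, a', b').
     ((\<Sum>n\<in>keys f. \<Sum>m\<in>keys g. Poly_Mapping.single (n + m) (br (lookup f n) (lookup g m)))
        + (\<Sum>m\<in>keys g. Poly_Mapping.single m (sc (b * of_int m) (lookup g m)))
        - (\<Sum>n\<in>keys f. Poly_Mapping.single n (sc (b' * of_int n) (lookup f n))),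
      (\<Sum>n\<in>keys f. \<Sum>m\<in>keys g.
         if n + m = 0 then of_int n * B (lookup f n) (lookup g m) else 0),
      0))"

definition aff_grading :: "(bit \<Rightarrow> 'g set) \<Rightarrow> bit \<Rightarrow> 'g::ab_group_add affine set" where
  "aff_grading gr p = {(f, a, b). (\<forall>n. lookup f n \<in> gr p) \<and> (p = 1 \<longrightarrow> a = 0 \<and> b = 0)}"

text \<open>\<open>S \<otimes> \<complex>[t, t\<^sup>-\<^sup>1] \<oplus> \<complex>K \<oplus> \<complex>d\<close>, for a subalgebra \<open>S\<close>.\<close>

definition aff_sub :: "'g set \<Rightarrow> 'g::ab_group_add affine set" where
  "aff_sub S = {(f, a, b). \<forall>n. lookup f n \<in> S}"

definition aff_cartan :: "'g set \<Rightarrow> 'g::ab_group_add affine set" where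
  "aff_cartan h = {(Poly_Mapping.single 0 x, a, b) | x a b. x \<in> h}"

definition n_plus ::
    "(complex \<Rightarrow> 'g \<Rightarrow> 'g) \<Rightarrow> ('g \<Rightarrow> 'g \<Rightarrow> 'g::ab_group_add) \<Rightarrow> 'g set
       \<Rightarrow> ('g \<Rightarrow> complex) set \<Rightarrow> 'g set" where
  "n_plus sc br h \<Pi> = module.span sc
     (\<Union>\<alpha>\<in>positive_roots (roots sc br h UNIV) \<Pi>. root_space sc br h UNIV \<alpha>)"

definition aff_n_plus ::
    "(complex \<Rightarrow> 'g \<Rightarrow> 'g) \<Rightarrow> ('g \<Rightarrow> 'g \<Rightarrow> 'g::ab_group_add) \<Rightarrow> 'g set
       \<Rightarrow> ('g \<Rightarrow> complex) set \<Rightarrow> 'g affine set" where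
  "aff_n_plus sc br h \<Pi> =
     {(f, 0, 0) | f. lookup f 0 \<in> n_plus sc br h \<Pi> \<and> (\<forall>n<0. lookup f n = 0)}"

text \<open>Pairs \<open>(e, f)\<close> with \<open>e\<close> in the \<open>\<alpha>\<close> root space, \<open>f\<close> in the \<open>-\<alpha>\<close> root space and
  \<open>[e, f]\<close> the coroot of \<open>\<alpha>\<close>, which is what \<open>[[e, f], e] = 2 e\<close> with \<open>e \<noteq> 0\<close> expresses
  because the root spaces are one-dimensional.\<close>

definition chevalley_pairs ::
    "(complex \<Rightarrow> 'g \<Rightarrow> 'g) \<Rightarrow> ('g \<Rightarrow> 'g \<Rightarrow> 'g::ab_group_add) \<Rightarrow> 'g set \<Rightarrow> 'g set
       \<Rightarrow> ('g \<Rightarrow> complex) \<Rightarrow> ('g \<times> 'g) set" where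
  "chevalley_pairs sc br h L \<alpha> =
     {(e, f). e \<in> root_space sc br h L \<alpha> \<and> f \<in> root_space sc br h L (\<lambda>y. - \<alpha> y) \<and>
              e \<noteq> 0 \<and> br (br e f) e = sc 2 e}"

text \<open>Besides the \<open>e\<^sub>i, f\<^sub>i\<close> of the simple Lie algebra \<open>L\<close>, the affine generators are
  \<open>e\<^sub>0 = f\<^sub>\<theta> \<otimes> t\<close> and \<open>f\<^sub>0 = e\<^sub>\<theta> \<otimes> t\<^sup>-\<^sup>1\<close>. All normalized choices (which differ by
  scalars) are collected.\<close>

definition affine_chevalley_generators ::
    "(complex \<Rightarrow> 'g \<Rightarrow> 'g) \<Rightarrow> ('g \<Rightarrow> 'g \<Rightarrow> 'g::ab_group_add) \<Rightarrow> 'g set \<Rightarrow> 'g set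
       \<Rightarrow> ('g \<Rightarrow> complex) set \<Rightarrow> ('g \<Rightarrow> complex) \<Rightarrow> 'g affine set" where
  "affine_chevalley_generators sc br h L \<Pi> \<theta> =
     (\<Union>\<alpha>\<in>\<Pi>. \<Union>(e, f)\<in>chevalley_pairs sc br h L \<alpha>. {loop e 0, loop f 0}) \<union>
     (\<Union>(e, f)\<in>chevalley_pairs sc br h L \<theta>. {loop f 1, loop e (- 1)})"

section \<open>Modules\<close>

text \<open>Modules of a Lie superalgebra \<open>(scA, grA, brA)\<close>; as usual these are graded.\<close>

locale super_module =
  fixes scA :: "complex \<Rightarrow> 'a::ab_group_add \<Rightarrow> 'a"
    and grA :: "bit \<Rightarrow> 'a set"
    and brA :: "'a \<Rightarrow> 'a \<Rightarrow> 'a"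
    and scV :: "complex \<Rightarrow> 'v::ab_group_add \<Rightarrow> 'v"
    and grV :: "bit \<Rightarrow> 'v set"
    and act :: "'a \<Rightarrow> 'v \<Rightarrow> 'v"
  assumes module_vector_space: "vector_space scV"
    and module_grading: "direct_sum_decomp scV UNIV grV"
    and act_linear_right: "Vector_Spaces.linear scV scV (act x)"
    and act_linear_left: "Vector_Spaces.linear scA scV (\<lambda>x. act x v)"
    and act_graded: "x \<in> grA a \<Longrightarrow> v \<in> grV b \<Longrightarrow> act x v \<in> grV (a + b)"
    and act_bracket: "x \<in> grA a \<Longrightarrow> y \<in> grA b \<Longrightarrow>
          act (brA x y) v = act x (act y v) - scV (ssign a b) (act y (act x v))"

text \<open>\<open>U(A) v\<close>: the enveloping algebra is spanned by the monomials in elements of \<open>A\<close>.\<close>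

definition enveloping_orbit ::
    "(complex \<Rightarrow> 'v \<Rightarrow> 'v) \<Rightarrow> ('a \<Rightarrow> 'v \<Rightarrow> 'v::ab_group_add) \<Rightarrow> 'a set \<Rightarrow> 'v \<Rightarrow> 'v set" where
  "enveloping_orbit scV act A v = module.span scV {foldr act xs v | xs. set xs \<subseteq> A}"

definition submodule ::
    "(complex \<Rightarrow> 'v \<Rightarrow> 'v) \<Rightarrow> ('a \<Rightarrow> 'v \<Rightarrow> 'v::ab_group_add) \<Rightarrow> 'a set \<Rightarrow> 'v set \<Rightarrow> bool" where
  "submodule scV act A W \<longleftrightarrow> module.subspace scV W \<and> (\<forall>x\<in>A. \<forall>w\<in>W. act x w \<in> W)"

definition irreducible_super_module ::
    "(complex \<Rightarrow> 'v \<Rightarrow> 'v) \<Rightarrow> (bit \<Rightarrow> 'v set) \<Rightarrow> ('a \<Rightarrow> 'v \<Rightarrow> 'v::ab_group_add) \<Rightarrow> bool" where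
  "irreducible_super_module scV grV act \<longleftrightarrow> (\<exists>v::'v. v \<noteq> 0) \<and>
     (\<forall>W. graded_subspace scV grV W \<and> submodule scV act UNIV W \<longrightarrow> W = {0} \<or> W = UNIV)"

definition irreducible_submodule ::
    "(complex \<Rightarrow> 'v \<Rightarrow> 'v) \<Rightarrow> ('a \<Rightarrow> 'v \<Rightarrow> 'v::ab_group_add) \<Rightarrow> 'a set \<Rightarrow> 'v set \<Rightarrow> bool" where
  "irreducible_submodule scV act A W \<longleftrightarrow> submodule scV act A W \<and> W \<noteq> {0} \<and>
     (\<forall>W'. submodule scV act A W' \<and> W' \<subseteq> W \<longrightarrow> W' = {0} \<or> W' = W)"

text \<open>Here \<open>A\<close> is a purely even subalgebra, so its modules are ordinary ungraded ones.\<close>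

definition completely_reducible ::
    "(complex \<Rightarrow> 'v \<Rightarrow> 'v) \<Rightarrow> ('a \<Rightarrow> 'v \<Rightarrow> 'v::ab_group_add) \<Rightarrow> 'a set \<Rightarrow> bool" where
  "completely_reducible scV act A \<longleftrightarrow>
     (\<exists>\<W>. (\<forall>W\<in>\<W>. irreducible_submodule scV act A W) \<and> direct_sum_decomp scV \<W> (\<lambda>W. W))"

definition weight_space ::
    "(complex \<Rightarrow> 'v \<Rightarrow> 'v) \<Rightarrow> ('a \<Rightarrow> 'v \<Rightarrow> 'v) \<Rightarrow> 'a set \<Rightarrow> ('a \<Rightarrow> complex) \<Rightarrow> 'v set" where
  "weight_space scV act t \<mu> = {v. \<forall>x\<in>t. act x v = scV (\<mu> x) v}"

definition locally_nilpotent :: "('v \<Rightarrow> 'v::zero) \<Rightarrow> bool" where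
  "locally_nilpotent T \<longleftrightarrow> (\<forall>v. \<exists>n. (T ^^ n) v = 0)"

text \<open>\<open>L\<close> is the simple Lie algebra, with simple roots \<open>\<Pi>\<^sub>0\<close> and highest root \<open>\<theta>\<close> relative to
  its Cartan subalgebra \<open>h \<inter> L\<close>.\<close>

definition integrable_module ::
    "(complex \<Rightarrow> 'g \<Rightarrow> 'g) \<Rightarrow> ('g \<Rightarrow> 'g \<Rightarrow> 'g::ab_group_add) \<Rightarrow> 'g set \<Rightarrow> 'g set
       \<Rightarrow> ('g \<Rightarrow> complex) set \<Rightarrow> ('g \<Rightarrow> complex)
       \<Rightarrow> (complex \<Rightarrow> 'v \<Rightarrow> 'v) \<Rightarrow> ('g affine \<Rightarrow> 'v \<Rightarrow> 'v::ab_group_add) \<Rightarrow> bool" where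
  "integrable_module sc br h L \<Pi>\<^sub>0 \<theta> scV act \<longleftrightarrow>
     direct_sum_decomp scV (dual_space (aff_scale sc) (aff_cartan h))
       (weight_space scV act (aff_cartan h)) \<and>
     (\<forall>x\<in>affine_chevalley_generators sc br (h \<inter> L) L \<Pi>\<^sub>0 \<theta>. locally_nilpotent (act x)) \<and>
     (\<forall>v. fin_dim scV (enveloping_orbit scV act (range (\<lambda>x. loop x 0)) v))"

definition finite_dim_weight_spaces ::
    "(complex \<Rightarrow> 'g \<Rightarrow> 'g) \<Rightarrow> 'g::ab_group_add set
       \<Rightarrow> (complex \<Rightarrow> 'v \<Rightarrow> 'v) \<Rightarrow> ('g affine \<Rightarrow> 'v \<Rightarrow> 'v::ab_group_add) \<Rightarrow> bool" where
  "finite_dim_weight_spaces sc h scV act \<longleftrightarrow>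
     (\<forall>\<mu>\<in>dual_space (aff_scale sc) (aff_cartan h).
        fin_dim scV (weight_space scV act (aff_cartan h) \<mu>))"

definition highest_weight_module ::
    "(complex \<Rightarrow> 'g \<Rightarrow> 'g) \<Rightarrow> ('g \<Rightarrow> 'g \<Rightarrow> 'g::ab_group_add) \<Rightarrow> 'g set \<Rightarrow> ('g \<Rightarrow> complex) set
       \<Rightarrow> (complex \<Rightarrow> 'v \<Rightarrow> 'v) \<Rightarrow> ('g affine \<Rightarrow> 'v \<Rightarrow> 'v::ab_group_add) \<Rightarrow> bool" where
  "highest_weight_module sc br h \<Pi> scV act \<longleftrightarrow>
     (\<exists>v. v \<noteq> 0 \<and>
        (\<exists>\<mu>\<in>dual_space (aff_scale sc) (aff_cartan h). v \<in> weight_space scV act (aff_cartan h) \<mu>) \<and>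
        (\<forall>x\<in>aff_n_plus sc br h \<Pi>. act x v = 0) \<and>
        enveloping_orbit scV act UNIV v = UNIV)"

section \<open>The defining relations of the affine bracket\<close>

lemma map_zero_poly_mapping [simp]: "Poly_Mapping.map g 0 = 0"
  by (rule poly_mapping_eqI) (simp add: Poly_Mapping.map.rep_eq)

lemma map_single_poly_mapping:
  "g 0 = 0 \<Longrightarrow> Poly_Mapping.map g (Poly_Mapping.single n x) = Poly_Mapping.single n (g x)"
  by (rule poly_mapping_eqI) (auto simp: Poly_Mapping.map.rep_eq lookup_single when_def)

lemma (in basic_lie_superalgebra) aff_bracket_loop:
  "aff_bracket sc br B (loop x n) (loop y m) =
     loop (br x y) (n + m) + aff_scale sc (if n + m = 0 then of_int n * B x y else 0) aff_K"
proof -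
  interpret R: Vector_Spaces.linear sc sc "br x" by (rule bracket_linear_right)
  interpret L: Vector_Spaces.linear sc sc "\<lambda>x. br x y" by (rule bracket_linear_left)
  interpret FR: Vector_Spaces.linear sc "(*)" "B x" by (rule form_linear_right)
  interpret FL: Vector_Spaces.linear sc "(*)" "\<lambda>x. B x y" by (rule form_linear_left)
  show ?thesis
    using L.zero R.zero FL.zero FR.zero
    by (auto simp: aff_bracket_def loop_def aff_scale_def aff_K_def when_def)
qed

lemma (in basic_lie_superalgebra) aff_bracket_d:
  "aff_bracket sc br B aff_d (loop x n) = aff_scale sc (of_int n) (loop x n)"
proof -
  interpret vector_space sc by (rule vector_space)
  show ?thesis
    by (auto simp: aff_bracket_def loop_def aff_scale_def aff_d_def map_single_poly_mapping)
qed

lemma aff_bracket_K: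
  assumes "vector_space sc"
  shows "aff_bracket sc br B aff_K x = 0" and "aff_bracket sc br B x aff_K = 0"
proof -
  interpret vector_space sc by (rule assms)
  show "aff_bracket sc br B aff_K x = 0" and "aff_bracket sc br B x aff_K = 0"
    by (cases x; simp add: aff_bracket_def aff_K_def zero_prod_def)+
qed

end

theory Submission
  imports Defs "HOL-Library.Complex_Order"
begin

text \<open>Adding to the degree operator \<open>d\<close> the Sugawara operators of \<open>G\<^sub>0\<close> and of the center \<open>H\<close>, scaled by
  \<open>1 / (2k + 2h\<^sup>\<or>)\<close> and \<open>1 / (2k)\<close>, gives an operator commuting with the whole even affine algebra. On a
  vector of weight \<open>\<lambda>\<close> that is singular modulo some submodule, it is a scalar modulo that submodule, and
  this scalar is strictly monotone along dominant weights: if \<open>\<lambda> - \<mu>\<close> is a nonzero sum of positive affine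
  roots, the scalars of \<open>\<lambda>\<close> and \<open>\<mu>\<close> differ. Integrability makes all singular weights dominant, also in
  subquotients. Hence a singular vector generates an irreducible submodule, and a vector that is
  singular modulo the socle can be moved, within a generalized eigenspace of the operator, to a singular
  vector, so that the socle is everything.

  The superalgebra enters only through the boundedness of \<open>d\<close> and through the level: since \<open>k \<noteq> 0\<close>, the
  simple algebra \<open>G\<^sub>0\<close> acts faithfully on the weight module \<open>V\<close>, and therefore \<open>h\<close> acts diagonally on
  \<open>G\<^sub>0\<close>. The root space decomposition and the triples \<open>e, f, [e, f]\<close> then come from the positive form.\<close>

section \<open>Linear algebra\<close>

text \<open>Two computations drive everything. The commutator of \<open>x(n)\<close> with a Sugawara
  operator is \<open>n x(n)\<close> times twice the level plus the Casimir eigenvalue of the adjoint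
  representation, so the scaled operators cancel the commutator with \<open>d\<close>, on
  \<open>G0\<close> and on \<open>H\<close> separately. And if two dominant weights differ by
  \<gamma>, the difference of their scalars is, up to a positive factor, the pairing of \<gamma>
  with the sum of both weights and 2\<rho>. Dominance makes the weights nonnegative on positive
  affine roots, and 2\<rho> supplies the strictness.

  The obstacle is a vector singular only modulo the socle, on which the operator is a scalar only up
  to an error in the socle. Finite dimensional weight spaces allow a Fitting argument: a correction
  inside the socle makes the error nilpotent, and then nothing strictly above the corrected vector
  can have a compatible scalar. Hence statements on singular vectors are relative to a submodule,
  and scalars are compared across two different submodules.

  Sums over roots run over a basis of weight vectors, so multiplicities never enter, and positivity
  of 2\<rho> on simple roots comes from a trace instead of reflections.\<close>

context vector_space
begin

lemma subspace_sum_scale: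
  "subspace W \<Longrightarrow> (\<And>x. x \<in> A \<Longrightarrow> f x \<in> W) \<Longrightarrow> (\<Sum>x\<in>A. scale (c x) (f x)) \<in> W"
  by (intro subspace_sum subspace_scale) auto

lemma linear_on_span_in:
  assumes L: "Vector_Spaces.linear scale scale2 L"
    and S: "module.subspace scale2 W" and x: "x \<in> span A" and *: "\<And>a. a \<in> A \<Longrightarrow> L a \<in> W"
  shows "L x \<in> W"
proof -
  interpret L: Vector_Spaces.linear scale scale2 L by (rule L)
  have "subspace {x. L x \<in> W}"
    using L.subspace_vimage[OF S] by (simp add: vimage_def)
  with x * show ?thesis
    using span_minimal[of A "{x. L x \<in> W}"] by auto
qed

text \<open>If no term lay in the span of the later ones, every window of consecutive terms would be
  independent, adding its terms from the last to the first; a window of more than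
  \<open>card T\<close> terms is too long. Dependence on later terms is the form in which a power of
  an operator is compared with higher powers.\<close>

lemma seq_dependent:
  fixes f :: "nat \<Rightarrow> 'b"
  assumes "finite T" "range f \<subseteq> span T"
  shows "\<exists>j. f j \<in> span (f ` {j<..})"
proof (rule ccontr)
  assume H: "\<not> ?thesis"
  have *: "independent (f ` {j..<j+n}) \<and> card (f ` {j..<j+n}) = n" for j n
  proof (induction n arbitrary: j)
    case 0
    show ?case by (simp add: independent_empty)
  next
    case (Suc n)
    have eq: "{j..<j + Suc n} = insert j {Suc j..<Suc j + n}" by auto
    have "f ` {Suc j..<Suc j + n} \<subseteq> f ` {j<..}" by (intro image_mono) auto
    then have "f j \<notin> span (f ` {Suc j..<Suc j + n})"
      using H span_mono by blast
    moreover from this have "f j \<notin> f ` {Suc j..<Suc j + n}" using span_base by blast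
    ultimately show ?case
      unfolding eq using Suc.IH[of "Suc j"] by (simp add: independent_insertI)
  qed
  have "card (f ` {0..<0 + Suc (card T)}) \<le> card T"
    using independent_span_bound[OF assms(1) conjunct1[OF *]] assms(2) by (meson image_subset_iff rangeI subset_iff)
  then show False using *[of 0 "Suc (card T)"] by simp
qed

lemma linear_funpow:
  assumes "Vector_Spaces.linear scale scale R" shows "Vector_Spaces.linear scale scale (R ^^ m)"
proof (induction m)
  case 0
  then show ?case by (simp add: linear_id id_def[symmetric] del: id_apply)
next
  case (Suc m)
  then show ?case using Vector_Spaces.linear_compose[OF Suc assms] by (simp only: funpow.simps)
qed

text \<open>Fitting's argument for a single vector. The powers of \<open>R\<close> on
  \<open>R v\<close> become dependent inside \<open>W\<close>, so \<open>R^j (R v)\<close> equals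
  \<open>R^(j+1) z\<close> for some \<open>z\<close> in \<open>W\<close>, and subtracting this
  \<open>z\<close> leaves a vector killed by \<open>R^(j+1)\<close>. Only \<open>R v\<close> has to
  lie in \<open>W\<close>; in the application \<open>v\<close> lies outside.\<close>

lemma fitting_shift:
  assumes R: "Vector_Spaces.linear scale scale R" and W: "subspace W" "R ` W \<subseteq> W"
    and T: "finite T" "W \<subseteq> span T" and v: "R v \<in> W"
  shows "\<exists>z\<in>W. \<exists>m. (R ^^ m) (v - z) = 0"
proof -
  interpret R: Vector_Spaces.linear scale scale R by (rule R)
  note lin = linear_funpow[OF R]
  define s where "s = R v"
  have in_W: "(R ^^ i) w \<in> W" if "w \<in> W" for i w
    by (induction i) (use that W(2) in auto)
  obtain j where j: "(R ^^ j) s \<in> span ((\<lambda>i. (R ^^ i) s) ` {j<..})"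
    using seq_dependent[OF T(1), of "\<lambda>i. (R ^^ i) s"] T(2) in_W v s_def by blast
  interpret Rj: Vector_Spaces.linear scale scale "R ^^ Suc j" by (rule lin)
  have "(\<lambda>i. (R ^^ i) s) ` {j<..} \<subseteq> (R ^^ Suc j) ` W"
  proof clarify
    fix i assume "i > j"
    then have "(R ^^ i) s = (R ^^ Suc j) ((R ^^ (i - Suc j)) s)"
      by (metis Suc_leI funpow_add le_add_diff_inverse o_apply)
    then show "(R ^^ i) s \<in> (R ^^ Suc j) ` W" using in_W v s_def by blast
  qed
  with j have "(R ^^ j) s \<in> (R ^^ Suc j) ` W"
    using span_minimal[OF _ Rj.subspace_image[OF W(1)]] by blast
  then obtain z where z: "z \<in> W" "(R ^^ j) s = (R ^^ Suc j) z" by blast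
  have "(R ^^ Suc j) (v - z) = 0"
    using z(2) unfolding Rj.diff s_def by (simp add: funpow_swap1)
  with z(1) show ?thesis by blast
qed

lemma span_UN_subspaces:
  assumes W: "\<And>i. i \<in> I \<Longrightarrow> subspace (W i)" and v: "v \<in> span (\<Union>i\<in>I. W i)"
  shows "\<exists>J f. finite J \<and> J \<subseteq> I \<and> (\<forall>i\<in>J. f i \<in> W i) \<and> v = (\<Sum>i\<in>J. f i)"
  using v
proof (induction rule: span_induct_alt)
  case base
  then show ?case by (intro exI[of _ "{}"]) auto
next
  case (step c x y)
  then obtain J f i where *: "finite J" "J \<subseteq> I" "\<forall>i\<in>J. f i \<in> W i" "y = (\<Sum>i\<in>J. f i)"
    "i \<in> I" "x \<in> W i" by blast
  let ?g = "\<lambda>k. (if k = i then scale c x else 0) + (if k \<in> J then f k else 0)"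
  have "(\<Sum>k\<in>insert i J. ?g k) = scale c x + y"
    using *(1,4) by (simp add: sum.distrib sum.delta sum.inter_restrict[symmetric] Int_absorb1 subset_insertI)
  moreover have "\<forall>k\<in>insert i J. ?g k \<in> W k"
    using * W by (auto intro!: subspace_add subspace_scale simp: subspace_0 subset_iff)
  ultimately show ?case using * by (intro exI[of _ "insert i J"] exI[of _ ?g]) auto
qed

text \<open>Applying \<open>L - c j\<close> deletes the component at \<open>j\<close> and multiplies
  the one at \<open>i\<close> by the nonzero number \<open>c i - c j\<close>; induction on the
  number of components isolates \<open>f i\<close>. Each pair of indices may have its own separating
  operator, because no single element need separate all weights.\<close>

lemma eigen_component_in:
  assumes "finite J" "J \<subseteq> I"
    and N: "subspace N"
    and sep: "\<And>i j. i \<in> I \<Longrightarrow> j \<in> I \<Longrightarrow> i \<noteq> j \<Longrightarrow>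
       \<exists>L c. Vector_Spaces.linear scale scale L \<and> L ` N \<subseteq> N \<and> (\<forall>k\<in>I. \<forall>w\<in>W k. L w = scale (c k) w) \<and> c i \<noteq> c j"
    and W: "\<And>i. i \<in> I \<Longrightarrow> subspace (W i)"
    and "\<And>i. i \<in> J \<Longrightarrow> f i \<in> W i" "(\<Sum>i\<in>J. f i) \<in> N" "i \<in> J"
  shows "f i \<in> N"
  using assms(1,2,6-)
proof (induction "card J" arbitrary: J f)
  case 0
  then show ?case by simp
next
  case (Suc n)
  show ?case
  proof (cases "J = {i}")
    case True
    then show ?thesis using Suc by simp
  next
    case False
    then obtain j where j: "j \<in> J" "j \<noteq> i" using Suc.prems by blast
    then obtain L c where L: "Vector_Spaces.linear scale scale L" "L ` N \<subseteq> N"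
      "\<forall>k\<in>I. \<forall>w\<in>W k. L w = scale (c k) w" "c i \<noteq> c j"
      using sep[of i j] Suc.prems by blast
    interpret L: Vector_Spaces.linear scale scale L by (rule L(1))
    let ?g = "\<lambda>k. scale (c k - c j) (f k)"
    let ?s = "\<Sum>k\<in>J. f k"
    have "L ?s - scale (c j) ?s \<in> N" using Suc.prems L(2) N by (auto intro!: subspace_diff subspace_scale)
    also have "L ?s - scale (c j) ?s = (\<Sum>k\<in>J. ?g k)"
      unfolding L.sum scale_sum_right sum_subtractf[symmetric]
      using L(3) Suc.prems by (intro sum.cong) (auto simp: scale_left_diff_distrib subset_iff)
    also have "\<dots> = (\<Sum>k\<in>J - {j}. ?g k)"
      using Suc.prems j by (subst sum.remove[of J j]) auto
    finally have "?g i \<in> N"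
      using Suc.prems Suc.hyps(2) j W by (intro Suc.hyps(1)[of "J - {j}" ?g]) (auto intro!: subspace_scale)
    then have "scale (inverse (c i - c j)) (?g i) \<in> N" using N by (rule subspace_scale[rotated])
    then show ?thesis using L(4) by simp
  qed
qed

lemma eigen_independent:
  assumes sep: "\<And>i j. i \<in> I \<Longrightarrow> j \<in> I \<Longrightarrow> i \<noteq> j \<Longrightarrow>
       \<exists>L c. Vector_Spaces.linear scale scale L \<and> (\<forall>k\<in>I. \<forall>w\<in>W k. L w = scale (c k) w) \<and> c i \<noteq> c j"
    and W: "\<And>i. i \<in> I \<Longrightarrow> subspace (W i)"
    and i: "i \<in> I" and w: "w \<in> W i" "w \<in> span (\<Union>j\<in>I - {i}. W j)"
  shows "w = 0"
proof -
  obtain J f where J: "finite J" "J \<subseteq> I - {i}" "\<forall>i\<in>J. f i \<in> W i" "w = (\<Sum>i\<in>J. f i)"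
    using span_UN_subspaces[of "I - {i}" W w] W w by blast
  \<comment> \<open>With \<open>- w\<close> as the component at \<open>i\<close> the relation
    becomes a zero sum, and the previous lemma applies with the submodule
    \<open>{0}\<close>.\<close>
  define g where "g = f(i := - w)"
  have "(\<Sum>k\<in>insert i J. g k) = - w + (\<Sum>k\<in>J. g k)"
    using J by (subst sum.insert) (auto simp: g_def)
  also have "(\<Sum>k\<in>J. g k) = (\<Sum>k\<in>J. f k)" using J by (intro sum.cong) (auto simp: g_def)
  finally have s: "(\<Sum>k\<in>insert i J. g k) = 0" using J by simp
  have "g i \<in> {0}"
  proof (rule eigen_component_in[of "insert i J" I "{0}" W g i])
    show "\<exists>L c. Vector_Spaces.linear scale scale L \<and> L ` {0} \<subseteq> {0} \<and> (\<forall>k\<in>I. \<forall>w\<in>W k. L w = scale (c k) w) \<and> c i \<noteq> c j"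
      if ij: "i \<in> I" "j \<in> I" "i \<noteq> j" for i j
    proof -
      obtain L c where L: "Vector_Spaces.linear scale scale L" "\<forall>k\<in>I. \<forall>w\<in>W k. L w = scale (c k) w" "c i \<noteq> c j"
        using sep[OF ij] by blast
      interpret L: Vector_Spaces.linear scale scale L by (rule L(1))
      show ?thesis using L by (intro exI[of _ L] exI[of _ c]) auto
    qed
    show "g k \<in> W k" if "k \<in> insert i J" for k
      using that J w W i by (auto simp: g_def subspace_neg)
  qed (use J s i W in auto)
  then show ?thesis by (simp add: g_def)
qed

text \<open>The criterion that a product of distinct linear factors implies diagonalizability, for
  one vector and inside a stable subspace \<open>E\<close>.\<close>

lemma eigen_decomposition:
  assumes L: "Vector_Spaces.linear scale scale L" and "distinct as"
    and E: "subspace E" "L ` E \<subseteq> E" and "x \<in> E"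
    and "fold (\<lambda>a z. L z - scale a z) as x = 0"
  shows "x \<in> span {z \<in> E. \<exists>a\<in>set as. L z = scale a z}"
  using assms(2,5,6)
proof (induction as arbitrary: x)
  case Nil
  then show ?case by (simp add: span_zero)
next
  case (Cons a as)
  interpret L: Vector_Spaces.linear scale scale L by (rule L)
  let ?Z = "\<lambda>b. {z \<in> E. L z = scale b z}"
  have Z: "subspace (?Z b)" for b
    using E(1) by (auto intro!: subspaceI simp: subspace_0 subspace_add subspace_scale L.add L.scale
      scale_right_distrib scale_left_commute)
  let ?z = "L x - scale a x"
  have "?z \<in> E" using Cons.prems E by (auto intro!: subspace_diff subspace_scale)
  then have "?z \<in> span {z \<in> E. \<exists>b\<in>set as. L z = scale b z}"
    using Cons by simp
  also have "{z \<in> E. \<exists>b\<in>set as. L z = scale b z} = (\<Union>b\<in>set as. ?Z b)" by auto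
  finally obtain J f where J: "finite J" "J \<subseteq> set as" "\<forall>i\<in>J. f i \<in> ?Z i" "?z = (\<Sum>i\<in>J. f i)"
    using span_UN_subspaces[of "set as" ?Z ?z] Z by blast
  \<comment> \<open>By induction \<open>?z\<close>, the image of \<open>x\<close> under
    \<open>L - a\<close>, is a sum of eigenvectors for values \<open>b\<close> other than
    \<open>a\<close>. Dividing the components by \<open>b - a\<close> inverts \<open>L - a\<close>
    on them, so \<open>x - ?y\<close> is an eigenvector for \<open>a\<close>.\<close>
  let ?y = "\<Sum>b\<in>J. scale (inverse (b - a)) (f b)"
  let ?S = "{z \<in> E. \<exists>b\<in>set (a # as). L z = scale b z}"
  have fS: "f b \<in> ?S" if "b \<in> J" for b using J that by auto
  have yE: "?y \<in> E" using J E(1) by (intro subspace_sum_scale) auto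
  have "L ?y - scale a ?y = (\<Sum>b\<in>J. scale (inverse (b - a)) (L (f b) - scale a (f b)))"
    by (simp add: L.sum L.scale scale_sum_right sum_subtractf scale_right_diff_distrib scale_left_commute mult.commute)
  also have "\<dots> = (\<Sum>b\<in>J. f b)"
  proof (rule sum.cong)
    fix b assume b: "b \<in> J"
    then have "b \<noteq> a" using J Cons.prems by auto
    moreover have "L (f b) = scale b (f b)" using J b by auto
    ultimately show "scale (inverse (b - a)) (L (f b) - scale a (f b)) = f b"
      by (simp add: scale_left_diff_distrib[symmetric])
  qed simp
  finally have "L (x - ?y) = scale a (x - ?y)"
    using J(4) by (simp add: L.diff scale_right_diff_distrib algebra_simps)
  then have "x - ?y \<in> ?S" using yE Cons.prems E(1) by (auto intro: subspace_diff)
  then have "x - ?y \<in> span ?S" by (rule span_base)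
  moreover have "?y \<in> span ?S" using fS by (intro subspace_sum_scale span_base) auto
  ultimately have "(x - ?y) + ?y \<in> span ?S" by (rule span_add)
  then show ?case by simp
qed

end

text \<open>The map \<open>\<psi>\<close> sends \<open>x\<close> to the vector with coordinates
  \<open>B v x\<close>. Nondegeneracy makes it injective on \<open>X\<close>, hence bijective, and
  the dual vector of \<open>u\<close> is its preimage.\<close>

lemma (in finite_dimensional_vector_space) dual_basis_exists:
  assumes X: "subspace X" and U: "U \<subseteq> X" "independent U" "X \<subseteq> span U"
    and lin: "\<And>x. Vector_Spaces.linear scale (*) (B x)"
    and lin': "\<And>y. Vector_Spaces.linear scale (*) (\<lambda>x. B x y)"
    and nondeg: "\<And>y. y \<in> X \<Longrightarrow> (\<And>x. x \<in> X \<Longrightarrow> B x y = 0) \<Longrightarrow> y = 0"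
  shows "\<exists>u'. \<forall>u\<in>U. u' u \<in> X \<and> (\<forall>v\<in>U. B v (u' u) = (if v = u then 1 else 0))"
proof -
  interpret finite_dimensional_vector_space_pair_1 scale Basis scale by unfold_locales
  have fin: "finite U" using U finiteI_independent by blast
  define \<psi> where "\<psi> x = (\<Sum>v\<in>U. scale (B v x) v)" for x
  have lin\<psi>: "Vector_Spaces.linear scale scale \<psi>"
  proof -
    have "B v (x + y) = B v x + B v y" "B v (scale c x) = c * B v x" for v x y c
    proof -
      interpret Vector_Spaces.linear scale "(*)" "B v" by (rule lin)
      show "B v (x + y) = B v x + B v y" "B v (scale c x) = c * B v x" by (simp_all add: add scale)
    qed
    then show ?thesis
      by unfold_locales (simp_all add: \<psi>_def scale_left_distrib sum.distrib scale_sum_right)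
  qed
  interpret \<psi>: Vector_Spaces.linear scale scale \<psi> by (rule lin\<psi>)
  have coeff0: "c v = 0" if "(\<Sum>v\<in>U. scale (c v) v) = 0" "v \<in> U" for c v
    using independentD[OF U(2) fin subset_refl that] .
  have inj: "inj_on \<psi> X"
  proof (subst \<psi>.inj_on_iff_eq_0[OF X], intro ballI impI)
    fix x assume x: "x \<in> X" "\<psi> x = 0"
    have "B y x = 0" if "y \<in> X" for y
    proof -
      interpret l: Vector_Spaces.linear scale "(*)" "\<lambda>y. B y x" by (rule lin')
      show ?thesis using l.eq_0_on_span[of U y] coeff0[of "\<lambda>v. B v x"] x that U(3)
        unfolding \<psi>_def by blast
    qed
    then show "x = 0" using nondeg x by blast
  qed
  have "\<psi> ` X \<subseteq> X" using X U(1) by (auto simp: \<psi>_def intro!: subspace_sum_scale)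
  moreover have "dim (\<psi> ` X) = dim X"
    using dim_image_eq[OF lin\<psi>, of X] inj X by (metis span_eq_iff)
  ultimately have surj: "\<psi> ` X = X"
    using subspace_dim_equal[OF \<psi>.subspace_image[OF X] X] by simp
  show ?thesis
  proof (intro exI[of _ "\<lambda>u. SOME x. x \<in> X \<and> \<psi> x = u"] ballI)
    fix u assume u: "u \<in> U"
    define x where "x = (SOME x. x \<in> X \<and> \<psi> x = u)"
    have "\<exists>x. x \<in> X \<and> \<psi> x = u" using surj u U(1) by (metis (no_types, lifting) imageE subsetD)
    then have x: "x \<in> X" "\<psi> x = u" unfolding x_def by (rule someI2_ex; blast)+
    have "(\<Sum>v\<in>U. scale (B v x - (if v = u then 1 else 0)) v) = \<psi> x - (\<Sum>v\<in>U. if v = u then v else 0)"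
      unfolding \<psi>_def sum_subtractf[symmetric]
      by (intro sum.cong) (auto simp: scale_left_diff_distrib)
    also have "\<dots> = 0" using x u fin by simp
    finally have "\<forall>v\<in>U. B v x - (if v = u then 1 else 0) = 0" using coeff0[of "\<lambda>v. B v x - (if v = u then 1 else 0)"] by blast
    with x show "(SOME x. x \<in> X \<and> \<psi> x = u) \<in> X \<and>
       (\<forall>v\<in>U. B v (SOME x. x \<in> X \<and> \<psi> x = u) = (if v = u then 1 else 0))"
      unfolding x_def[symmetric] by simp
  qed
qed

text \<open>For a maximal independent family of irreducible submodules, an irreducible one not
  contained in the span of the family meets it only in 0 and could be added. So the family already
  spans.\<close>

lemma completely_reducibleI:
  fixes scV :: "complex \<Rightarrow> 'v::ab_group_add \<Rightarrow> 'v"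
  assumes vs: "vector_space scV"
    and lin: "\<And>x. Vector_Spaces.linear scV scV (act x)"
    and span: "\<And>v. v \<in> module.span scV (\<Union>{W. irreducible_submodule scV act A W})"
  shows "completely_reducible scV act A"
proof -
  interpret vector_space scV by (rule vs)
  let ?Irr = "{W. irreducible_submodule scV act A W}"
  \<comment> \<open>Independence tests only finite subfamilies, so it passes to unions of chains and
    Zorn's lemma applies.\<close>
  define indep where "indep \<W> \<longleftrightarrow> (\<forall>J f. finite J \<and> J \<subseteq> \<W> \<and> (\<forall>W\<in>J. f W \<in> W) \<and> (\<Sum>W\<in>J. f W) = 0
      \<longrightarrow> (\<forall>W\<in>J. f W = 0))" for \<W> :: "'v set set"
  have sub: "subspace W" if "W \<in> ?Irr" for W
    using that by (auto simp: irreducible_submodule_def submodule_def)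
  have "\<exists>M\<in>{\<W>. \<W> \<subseteq> ?Irr \<and> indep \<W>}. \<forall>X\<in>{\<W>. \<W> \<subseteq> ?Irr \<and> indep \<W>}. M \<subseteq> X \<longrightarrow> X = M"
  proof (rule subset_Zorn_nonempty)
    show "{\<W>. \<W> \<subseteq> ?Irr \<and> indep \<W>} \<noteq> {}" by (auto simp: indep_def intro!: exI[of _ "{}"])
    fix C assume C: "C \<noteq> {}" "subset.chain {\<W>. \<W> \<subseteq> ?Irr \<and> indep \<W>} C"
    have "\<exists>\<W>\<in>C. J \<subseteq> \<W>" if "finite J" "J \<subseteq> \<Union>C" for J
      using finite_subset_Union_chain[OF that C] by blast
    note dir = this
    have CI: "\<W> \<subseteq> ?Irr" "indep \<W>" if "\<W> \<in> C" for \<W>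
      using C(2) that unfolding subset.chain_def by blast+
    have "indep (\<Union>C)"
      unfolding indep_def
    proof (intro allI impI; elim conjE)
      fix J f assume J: "finite J" "J \<subseteq> \<Union>C" "\<forall>W\<in>J. f W \<in> W" "(\<Sum>W\<in>J. f W) = 0"
      obtain \<W> where "\<W> \<in> C" "J \<subseteq> \<W>" using dir[OF J(1,2)] by blast
      then show "\<forall>W\<in>J. f W = 0" using J CI(2)[of \<W>] unfolding indep_def by blast
    qed
    moreover have "\<Union>C \<subseteq> ?Irr" using CI(1) by blast
    ultimately show "\<Union>C \<in> {\<W>. \<W> \<subseteq> ?Irr \<and> indep \<W>}" by blast
  qed
  then obtain M where M: "M \<subseteq> ?Irr" "indep M"
    and max: "\<And>X. X \<subseteq> ?Irr \<Longrightarrow> indep X \<Longrightarrow> M \<subseteq> X \<Longrightarrow> X = M" by auto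
  have indepM: "f W = 0" if "finite J" "J \<subseteq> M" "\<And>W. W \<in> J \<Longrightarrow> f W \<in> W" "(\<Sum>W\<in>J. f W) = 0" "W \<in> J" for J f W
    using M(2) that unfolding indep_def by blast
  have spanM: "x \<in> span (\<Union>M) \<longleftrightarrow> (\<exists>J f. finite J \<and> J \<subseteq> M \<and> (\<forall>W\<in>J. f W \<in> W) \<and> x = (\<Sum>W\<in>J. f W))" for x
  proof
    assume "x \<in> span (\<Union>M)"
    then show "\<exists>J f. finite J \<and> J \<subseteq> M \<and> (\<forall>W\<in>J. f W \<in> W) \<and> x = (\<Sum>W\<in>J. f W)"
      using span_UN_subspaces[of M "\<lambda>W. W" x] sub M(1) by (simp add: subset_iff)
  next
    assume "\<exists>J f. finite J \<and> J \<subseteq> M \<and> (\<forall>W\<in>J. f W \<in> W) \<and> x = (\<Sum>W\<in>J. f W)"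
    then obtain J f where J: "J \<subseteq> M" "\<forall>W\<in>J. f W \<in> W" "x = (\<Sum>W\<in>J. f W)" by blast
    show "x \<in> span (\<Union>M)" unfolding J(3) using J(1,2) by (intro span_sum span_base) blast
  qed
  have "submodule scV act A (span (\<Union>M))"
    unfolding submodule_def
  proof (intro conjI ballI)
    fix x w assume x: "x \<in> A" and w: "w \<in> span (\<Union>M)"
    show "act x w \<in> span (\<Union>M)"
    proof (rule linear_on_span_in[OF lin subspace_span w])
      fix a assume "a \<in> \<Union>M"
      then obtain W where W: "W \<in> M" "a \<in> W" by blast
      then have "act x a \<in> W" using M(1) x unfolding irreducible_submodule_def submodule_def by blast
      then show "act x a \<in> span (\<Union>M)" using W(1) by (intro span_base) blast
    qed
  qed simp
  note sm = this
  have "W \<subseteq> span (\<Union>M)" if W: "W \<in> ?Irr" for W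
  proof (rule ccontr)
    assume nW: "\<not> W \<subseteq> span (\<Union>M)"
    have "submodule scV act A (W \<inter> span (\<Union>M))"
      using W sm unfolding irreducible_submodule_def submodule_def by (auto intro: subspace_inter)
    with W nW have int: "W \<inter> span (\<Union>M) = {0}" unfolding irreducible_submodule_def by blast
    have "indep (insert W M)"
      unfolding indep_def
    proof (intro allI impI; elim conjE)
      fix J f assume J: "finite J" "J \<subseteq> insert W M" "\<forall>W\<in>J. f W \<in> W" "(\<Sum>W\<in>J. f W) = 0"
      show "\<forall>W\<in>J. f W = 0"
      proof (cases "W \<in> J")
        case True
        have eq: "f W + (\<Sum>W\<in>J - {W}. f W) = 0" using J True by (simp add: sum.remove[symmetric])
        have rest: "(\<Sum>W\<in>J - {W}. f W) \<in> span (\<Union>M)" using J by (intro span_sum span_base) auto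
        have "f W = - (\<Sum>W\<in>J - {W}. f W)" using eq by (simp add: eq_neg_iff_add_eq_0)
        then have "f W \<in> W \<inter> span (\<Union>M)" using rest J True span_neg by auto
        then have f0: "f W = 0" using int by blast
        with eq have "(\<Sum>W\<in>J - {W}. f W) = 0" by simp
        then have "f W' = 0" if "W' \<in> J - {W}" for W'
          using J that by (intro indepM[of "J - {W}" f W']) auto
        with f0 show ?thesis by blast
      next
        case False
        then show ?thesis using J by (intro ballI indepM[of J f]) auto
      qed
    qed
    then have "W \<in> M" using max[of "insert W M"] M(1) W by blast
    then show False using nW span_superset[of "\<Union>M"] by blast
  qed
  then have "span (\<Union>?Irr) \<subseteq> span (\<Union>M)" by (intro span_minimal) auto
  with span have all: "x \<in> span (\<Union>M)" for x by blast
  have "direct_sum_decomp scV M (\<lambda>W. W)"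
    unfolding direct_sum_decomp_def
  proof (intro conjI ballI allI)
    show "subspace W" if "W \<in> M" for W using sub M that by blast
    fix v
    obtain J f where J: "finite J" "J \<subseteq> M" "\<forall>W\<in>J. f W \<in> W" "v = (\<Sum>W\<in>J. f W)"
      using iffD1[OF spanM all[of v]] by (elim exE conjE) (rule that)
    let ?P = "\<lambda>f. (\<forall>i. i \<notin> M \<longrightarrow> f i = 0) \<and> (\<forall>i\<in>M. f i \<in> i) \<and> finite {i. f i \<noteq> 0} \<and> v = (\<Sum>i | f i \<noteq> 0. f i)"
    let ?g = "\<lambda>W. if W \<in> J then f W else 0"
    have fin: "finite {i. ?g i \<noteq> 0}" using J(1) by (rule rev_finite_subset) (auto split: if_splits)
    have "(\<Sum>i | ?g i \<noteq> 0. ?g i) = (\<Sum>W\<in>J. f W)"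
      using J(1) by (intro sum.mono_neutral_cong_left) auto
    moreover have "?g W \<in> W" if "W \<in> M" for W
      using J(3) sub[of W] M(1) that subspace_0[of W] by auto
    moreover have "?g W = 0" if "W \<notin> M" for W using J(2) that by auto
    ultimately have g: "?P ?g" using fin J(4)
      by (intro conjI allI impI ballI) (assumption | simp only:)+
    show "\<exists>!f. ?P f"
    proof (rule ex1I[of _ ?g])
      fix f' assume f': "?P f'"
      define J' where "J' = {i. f' i \<noteq> 0} \<union> {i. ?g i \<noteq> 0}"
      have finJ': "finite J'" using f' fin unfolding J'_def by simp
      have "(\<Sum>W\<in>J'. f' W) = (\<Sum>i | f' i \<noteq> 0. f' i)"
        using finJ' by (intro sum.mono_neutral_right) (auto simp: J'_def)
      moreover have "(\<Sum>W\<in>J'. ?g W) = (\<Sum>i | ?g i \<noteq> 0. ?g i)"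
        using finJ' by (intro sum.mono_neutral_right) (auto simp: J'_def)
      ultimately have "(\<Sum>W\<in>J'. f' W) = (\<Sum>W\<in>J'. ?g W)" using f' g by argo
      then have "(\<Sum>W\<in>J'. f' W - ?g W) = 0" by (simp add: sum_subtractf)
      moreover have J'M: "J' \<subseteq> M"
      proof
        fix W assume "W \<in> J'"
        then have "f' W \<noteq> 0 \<or> ?g W \<noteq> 0" unfolding J'_def by blast
        then show "W \<in> M" using f' g by blast
      qed
      moreover have "\<forall>W\<in>J'. f' W - ?g W \<in> W"
      proof
        fix W assume "W \<in> J'"
        then have W: "W \<in> M" using J'M by blast
        then have "f' W \<in> W" "?g W \<in> W" using f' g by blast+
        then show "f' W - ?g W \<in> W" using sub[of W] M(1) W by (blast intro: subspace_diff)
      qed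
      ultimately have diff: "f' W - ?g W = 0" if "W \<in> J'" for W
        using finJ' that by (intro indepM[of J' "\<lambda>W. f' W - ?g W"]) blast+
      show "f' = ?g"
      proof
        fix W show "f' W = ?g W"
        proof (cases "W \<in> J'")
          case True
          then show ?thesis using diff[of W] by (simp only: right_minus_eq)
        next
          case False
          then show ?thesis unfolding J'_def by simp
        qed
      qed
    qed (rule g)
  qed
  with M(1) show ?thesis unfolding completely_reducible_def by blast
qed

section \<open>Invariant forms and dual bases\<close>

text \<open>The bracket and the form live on the whole superalgebra, while the ordinary Lie
  identities are required only on \<open>g\<close>, which will be the even part.\<close>

locale invariant_form = finite_dimensional_vector_space sc Basis
  for sc :: "complex \<Rightarrow> 'g::ab_group_add \<Rightarrow> 'g" and Basis +
  fixes br :: "'g \<Rightarrow> 'g \<Rightarrow> 'g" and B :: "'g \<Rightarrow> 'g \<Rightarrow> complex" and g :: "'g set"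
  assumes lin_br_r: "Vector_Spaces.linear sc sc (br x)"
    and lin_br_l: "Vector_Spaces.linear sc sc (\<lambda>x. br x y)"
    and lin_B_r: "Vector_Spaces.linear sc (*) (B x)"
    and lin_B_l: "Vector_Spaces.linear sc (*) (\<lambda>x. B x y)"
    and g_subspace: "subspace g"
    and br_closed: "x \<in> g \<Longrightarrow> y \<in> g \<Longrightarrow> br x y \<in> g"
    and br_skew: "x \<in> g \<Longrightarrow> y \<in> g \<Longrightarrow> br x y = - br y x"
    and jacobi: "x \<in> g \<Longrightarrow> y \<in> g \<Longrightarrow> z \<in> g \<Longrightarrow> br x (br y z) = br (br x y) z + br y (br x z)"
    and B_sym: "x \<in> g \<Longrightarrow> y \<in> g \<Longrightarrow> B x y = B y x"
    and B_inv: "B (br x y) z = B x (br y z)"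
begin

sublocale br_r: Vector_Spaces.linear sc sc "br x" for x by (rule lin_br_r)
sublocale br_l: Vector_Spaces.linear sc sc "\<lambda>x. br x y" for y by (rule lin_br_l)
sublocale B_r: Vector_Spaces.linear sc "(*)" "B x" for x by (rule lin_B_r)
sublocale B_l: Vector_Spaces.linear sc "(*)" "\<lambda>x. B x y" for y by (rule lin_B_l)

end

text \<open>To be used with \<open>X\<close> the simple algebra and with \<open>X\<close> the
  center. The two expansions say that the sum of \<open>u \<otimes> du u\<close> over
  \<open>U\<close> is the canonical tensor of the form on \<open>X\<close>.\<close>

locale dual_pair = invariant_form +
  fixes X U :: "'a set" and du :: "'a \<Rightarrow> 'a"
  assumes fin_U: "finite U" and U_X: "U \<subseteq> X" and du_X: "u \<in> U \<Longrightarrow> du u \<in> X"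
    and X_sub: "X \<subseteq> g" and X_closed: "x \<in> X \<Longrightarrow> y \<in> X \<Longrightarrow> br x y \<in> X"
    and expand_U: "x \<in> X \<Longrightarrow> x = (\<Sum>u\<in>U. sc (B x (du u)) u)"
    and expand_du: "x \<in> X \<Longrightarrow> x = (\<Sum>u\<in>U. sc (B x u) (du u))"
begin

lemma U_g: "u \<in> U \<Longrightarrow> u \<in> g" and du_g: "u \<in> U \<Longrightarrow> du u \<in> g"
  using U_X du_X X_sub by auto

text \<open>Symmetry of the canonical tensor, tested against an arbitrary bilinear map
  \<open>\<beta>\<close> so that it serves brackets as well as products of loop operators.\<close>

lemma dual_flip:
  assumes b1: "\<And>y. Vector_Spaces.linear sc s2 (\<lambda>x. \<beta> x y)"
    and b2: "\<And>x. Vector_Spaces.linear sc s2 (\<beta> x)"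
  shows "(\<Sum>u\<in>U. \<beta> u (du u)) = (\<Sum>u\<in>U. \<beta> (du u) u)"
proof -
  interpret b1: Vector_Spaces.linear sc s2 "\<lambda>x. \<beta> x y" for y by (rule b1)
  interpret b2: Vector_Spaces.linear sc s2 "\<beta> z" for z by (rule b2)
  have "(\<Sum>u\<in>U. \<beta> u (du u)) = (\<Sum>u\<in>U. \<beta> u (\<Sum>v\<in>U. sc (B (du u) (du v)) v))"
    using expand_U du_X by (intro sum.cong) auto
  also have "\<dots> = (\<Sum>u\<in>U. \<Sum>v\<in>U. s2 (B (du u) (du v)) (\<beta> u v))"
    by (simp add: b2.sum b2.scale)
  also have "\<dots> = (\<Sum>v\<in>U. \<Sum>u\<in>U. s2 (B (du u) (du v)) (\<beta> u v))" by (rule sum.swap)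
  also have "\<dots> = (\<Sum>v\<in>U. \<beta> (\<Sum>u\<in>U. sc (B (du v) (du u)) u) v)"
    using B_sym du_g by (auto simp: b1.sum b1.scale intro!: sum.cong)
  also have "\<dots> = (\<Sum>v\<in>U. \<beta> (du v) v)"
    using expand_U du_X by (intro sum.cong) (auto simp flip: expand_U)
  finally show ?thesis .
qed

text \<open>Invariance of the canonical tensor under \<open>ad x\<close>: by invariance of the form,
  the matrix of \<open>ad x\<close> in the basis \<open>U\<close> is minus the transpose of its
  matrix in the dual basis.\<close>

lemma dual_invariant:
  assumes b1: "\<And>y. Vector_Spaces.linear sc s2 (\<lambda>x. \<beta> x y)"
    and b2: "\<And>x. Vector_Spaces.linear sc s2 (\<beta> x)" and x: "x \<in> X"
  shows "(\<Sum>u\<in>U. \<beta> (br x u) (du u)) = - (\<Sum>u\<in>U. \<beta> u (br x (du u)))"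
proof -
  interpret b1: Vector_Spaces.linear sc s2 "\<lambda>x. \<beta> x y" for y by (rule b1)
  interpret b2: Vector_Spaces.linear sc s2 "\<beta> z" for z by (rule b2)
  have eq: "B (br x u) (du v) = - B (br x (du v)) u" if "u \<in> U" "v \<in> U" for u v
  proof -
    have "br x u = - br u x" using X_sub x U_g[OF that(1)] by (intro br_skew) auto
    then have "B (br x u) (du v) = - B (br u x) (du v)" by (simp add: B_l.neg)
    also have "B (br u x) (du v) = B u (br x (du v))" by (rule B_inv)
    also have "\<dots> = B (br x (du v)) u"
      using x that U_g du_g X_sub by (intro B_sym br_closed) auto
    finally show ?thesis .
  qed
  have "(\<Sum>u\<in>U. \<beta> (br x u) (du u)) = (\<Sum>u\<in>U. \<beta> (\<Sum>v\<in>U. sc (B (br x u) (du v)) v) (du u))"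
    using U_X x X_closed by (intro sum.cong) (auto simp flip: expand_U)
  also have "\<dots> = (\<Sum>u\<in>U. \<Sum>v\<in>U. s2 (B (br x u) (du v)) (\<beta> v (du u)))"
    by (simp add: b1.sum b1.scale)
  also have "\<dots> = (\<Sum>v\<in>U. \<Sum>u\<in>U. s2 (- B (br x (du v)) u) (\<beta> v (du u)))"
    by (subst sum.swap) (auto simp: eq intro!: sum.cong)
  also have "\<dots> = (\<Sum>v\<in>U. - \<beta> v (\<Sum>u\<in>U. sc (B (br x (du v)) u) (du u)))"
    by (simp add: b2.sum b2.scale sum_negf)
  also have "\<dots> = (\<Sum>v\<in>U. - \<beta> v (br x (du v)))"
    using du_X x X_closed by (intro sum.cong) (auto simp flip: expand_du)
  finally show ?thesis by (simp add: sum_negf)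
qed

end

lemma (in invariant_form) dual_pair_exists:
  assumes X: "subspace X" "X \<subseteq> g" and closed: "\<And>x y. x \<in> X \<Longrightarrow> y \<in> X \<Longrightarrow> br x y \<in> X"
    and nondeg: "\<And>y. y \<in> X \<Longrightarrow> (\<And>x. x \<in> X \<Longrightarrow> B x y = 0) \<Longrightarrow> y = 0"
    and U: "U \<subseteq> X" "independent U" "X \<subseteq> span U"
  shows "\<exists>du. dual_pair sc Basis br B g X U du \<and> (\<forall>u\<in>U. \<forall>v\<in>U. B v (du u) = (if v = u then 1 else 0))"
proof -
  obtain du where du: "\<And>u. u \<in> U \<Longrightarrow> du u \<in> X"
    and d: "\<And>u v. u \<in> U \<Longrightarrow> v \<in> U \<Longrightarrow> B v (du u) = (if v = u then 1 else 0)"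
    using dual_basis_exists[OF X(1) U lin_B_r lin_B_l nondeg] by blast
  have fin: "finite U" using U(2) finiteI_independent by blast
  have zero: "y = 0" if y: "y \<in> X" "\<And>v. v \<in> U \<Longrightarrow> B v y = 0" for y
  proof (rule nondeg[OF y(1)])
    fix x assume "x \<in> X"
    then show "B x y = 0" using B_l.eq_0_on_span[of U y x] y(2) U(3) by blast
  qed
  have "dual_pair sc Basis br B g X U du"
  proof unfold_locales
    fix x assume x: "x \<in> X"
    show "x = (\<Sum>u\<in>U. sc (B x (du u)) u)"
    proof -
      obtain c where c: "x = (\<Sum>u\<in>U. sc (c u) u)"
        using x U(3) span_finite[OF fin] by auto
      have "B x (du v) = c v" if "v \<in> U" for v
      proof -
        have "B x (du v) = (\<Sum>u\<in>U. c u * B u (du v))" unfolding c by (simp add: B_l.sum B_l.scale)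
        also have "\<dots> = (\<Sum>u\<in>U. if u = v then c u else 0)" using d that by (intro sum.cong) auto
        finally show ?thesis using that fin by simp
      qed
      then show ?thesis using c by simp
    qed
    show "x = (\<Sum>u\<in>U. sc (B x u) (du u))"
    proof -
      have in_X: "(\<Sum>u\<in>U. sc (B x u) (du u)) \<in> X" using du X(1) by (intro subspace_sum_scale) auto
      have "x - (\<Sum>u\<in>U. sc (B x u) (du u)) = 0"
      proof (rule zero)
        show "x - (\<Sum>u\<in>U. sc (B x u) (du u)) \<in> X" using X(1) x in_X by (rule subspace_diff)
        fix v assume v: "v \<in> U"
        have "B v (\<Sum>u\<in>U. sc (B x u) (du u)) = (\<Sum>u\<in>U. if u = v then B x u else 0)"
          using d v by (auto simp: B_r.sum B_r.scale intro!: sum.cong)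
        also have "\<dots> = B v x" using v fin B_sym[of x v] x X(2) U(1) by auto
        finally show "B v (x - (\<Sum>u\<in>U. sc (B x u) (du u))) = 0" by (simp add: B_r.diff)
      qed
      then show ?thesis by simp
    qed
  qed (use fin du U X closed in auto)
  with d show ?thesis by blast
qed

section \<open>Roots of the simple Lie algebra\<close>

lemma dual_space_add:
  "\<alpha> \<in> dual_space sc S \<Longrightarrow> \<beta> \<in> dual_space sc S \<Longrightarrow> (\<lambda>y. \<alpha> y + \<beta> y) \<in> dual_space sc S"
  by (auto simp: dual_space_def distrib_left)

lemma dual_space_neg: "\<alpha> \<in> dual_space sc S \<Longrightarrow> (\<lambda>y. - \<alpha> y) \<in> dual_space sc S"
  by (auto simp: dual_space_def)

lemma dual_space_0: "(\<lambda>y. 0) \<in> dual_space sc S"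
  by (auto simp: dual_space_def)

lemma dual_space_mult: "\<alpha> \<in> dual_space sc S \<Longrightarrow> (\<lambda>y. c * \<alpha> y) \<in> dual_space sc S"
  by (auto simp: dual_space_def distrib_left)

lemma dual_space_sum:
  "(\<And>i. i \<in> I \<Longrightarrow> \<alpha> i \<in> dual_space sc S) \<Longrightarrow> (\<lambda>y. \<Sum>i\<in>I. \<alpha> i y) \<in> dual_space sc S"
  by (auto simp: dual_space_def sum.distrib sum_distrib_left)

lemma dual_space_eqI:
  "\<alpha> \<in> dual_space sc S \<Longrightarrow> \<beta> \<in> dual_space sc S \<Longrightarrow> (\<And>y. y \<in> S \<Longrightarrow> \<alpha> y = \<beta> y) \<Longrightarrow> \<alpha> = \<beta>"
  unfolding dual_space_def by (rule ext) (metis (mono_tags, lifting) mem_Collect_eq)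

locale split_simple = invariant_form sc Basis br B g
  for sc :: "complex \<Rightarrow> 'g::ab_group_add \<Rightarrow> 'g" and Basis br B g +
  fixes L t :: "'g set" and \<Pi> :: "('g \<Rightarrow> complex) set" and \<theta> :: "'g \<Rightarrow> complex"
  assumes L_g: "L \<subseteq> g" and L_simple: "simple_lie_algebra sc br L"
    and t_L: "t \<subseteq> L" and t_subspace: "subspace t"
    and t_abelian: "x \<in> t \<Longrightarrow> y \<in> t \<Longrightarrow> br x y = 0"
    and t_self_centralizing: "x \<in> L \<Longrightarrow> (\<And>y. y \<in> t \<Longrightarrow> br y x = 0) \<Longrightarrow> x \<in> t"
    and t_diagonal: "x \<in> L \<Longrightarrow> x \<in> span (\<Union>\<alpha>\<in>dual_space sc t. root_space sc br t L \<alpha>)"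
    and B_nondeg: "y \<in> L \<Longrightarrow> (\<And>x. x \<in> L \<Longrightarrow> B x y = 0) \<Longrightarrow> y = 0"
    and simple_system: "simple_root_system (roots sc br t L) \<Pi>"
    and highest: "highest_root (roots sc br t L) \<Pi> \<theta>"
    and pos_def: "positive_definite_on_roots B t (roots sc br t L)"
    and norm_2: "dual_form B t \<theta> \<theta> = 2"
begin

abbreviation "R \<equiv> root_space sc br t L"
abbreviation "D \<equiv> dual_space sc t"
abbreviation "\<Delta> \<equiv> roots sc br t L"

lemma L_subspace: "subspace L" and L_closed: "x \<in> L \<Longrightarrow> y \<in> L \<Longrightarrow> br x y \<in> L"
  using L_simple by (auto simp: simple_lie_algebra_def lie_subalgebra_def)

lemma t_g: "y \<in> t \<Longrightarrow> y \<in> g" using t_L L_g by auto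
lemma L_g': "y \<in> L \<Longrightarrow> y \<in> g" using L_g by auto

lemma R_L: "x \<in> R \<alpha> \<Longrightarrow> x \<in> L"
  and R_br: "x \<in> R \<alpha> \<Longrightarrow> y \<in> t \<Longrightarrow> br y x = sc (\<alpha> y) x"
  by (auto simp: root_space_def)

lemma R_subspace: "subspace (R \<alpha>)"
  using L_subspace unfolding root_space_def
  by (auto intro!: subspaceI simp: subspace_0 subspace_add subspace_scale br_r.add br_r.scale
      scale_right_distrib scale_left_commute)

lemma R_br_R:
  assumes "x \<in> R \<alpha>" "z \<in> R \<beta>" shows "br x z \<in> R (\<lambda>y. \<alpha> y + \<beta> y)"
proof -
  have "br y (br x z) = sc (\<alpha> y + \<beta> y) (br x z)" if "y \<in> t" for y
    using jacobi[OF t_g[OF that] L_g'[OF R_L[OF assms(1)]] L_g'[OF R_L[OF assms(2)]]]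
      R_br[OF assms(1) that] R_br[OF assms(2) that]
    by (simp add: br_l.scale br_r.scale scale_left_distrib)
  then show ?thesis using L_closed[OF R_L[OF assms(1)] R_L[OF assms(2)]] by (auto simp: root_space_def)
qed

lemma R_0: "R (\<lambda>y. 0) = t"
  using t_L t_abelian t_self_centralizing by (auto simp: root_space_def)

lemma B_R_orth:
  assumes "x \<in> R \<alpha>" "z \<in> R \<beta>" "y \<in> t" "\<alpha> y + \<beta> y \<noteq> 0" shows "B x z = 0"
proof -
  have "\<alpha> y * B x z = B (br y x) z" using R_br[OF assms(1,3)] by (simp add: B_l.scale)
  also have "\<dots> = - B (br x y) z"
    using br_skew[OF t_g[OF assms(3)] L_g'[OF R_L[OF assms(1)]]] by (simp add: B_l.neg)
  also have "\<dots> = - (\<beta> y * B x z)" using R_br[OF assms(2,3)] by (simp add: B_inv B_r.scale)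
  finally have "(\<alpha> y + \<beta> y) * B x z = 0" by (simp add: distrib_right)
  then show ?thesis using assms by simp
qed

lemma D_sep: "\<alpha> \<in> D \<Longrightarrow> \<beta> \<in> D \<Longrightarrow> \<alpha> \<noteq> \<beta> \<Longrightarrow> \<exists>y\<in>t. \<alpha> y \<noteq> \<beta> y"
  using dual_space_eqI by blast

lemma D_off: "\<alpha> \<in> D \<Longrightarrow> y \<notin> t \<Longrightarrow> \<alpha> y = 0"
  by (simp add: dual_space_def)

lemma D_sum: "\<alpha> \<in> D \<Longrightarrow> (\<And>i. i \<in> I \<Longrightarrow> f i \<in> t) \<Longrightarrow> \<alpha> (\<Sum>i\<in>I. f i) = (\<Sum>i\<in>I. \<alpha> (f i))"
proof (induction I rule: infinite_finite_induct)
  case (insert i I)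
  then show ?case using subspace_sum[OF t_subspace, of I f] by (auto simp: dual_space_def)
next
  case empty
  then have "\<alpha> (sc 0 0) = 0" using subspace_0[OF t_subspace] unfolding dual_space_def by fastforce
  then show ?case by simp
next
  case (infinite A)
  then have "\<alpha> (sc 0 0) = 0" using subspace_0[OF t_subspace] unfolding dual_space_def by fastforce
  then show ?case using infinite by simp
qed

lemma D_scale: "\<alpha> \<in> D \<Longrightarrow> y \<in> t \<Longrightarrow> \<alpha> (sc c y) = c * \<alpha> y"
  by (simp add: dual_space_def)

text \<open>Root spaces of nonzero weight are orthogonal to \<open>t\<close>, so an element of
  \<open>t\<close> orthogonal to \<open>t\<close> is orthogonal to \<open>L\<close>.\<close>

lemma t_nondeg:
  assumes "y \<in> t" "\<And>x. x \<in> t \<Longrightarrow> B x y = 0" shows "y = 0"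
proof (rule B_nondeg)
  show "y \<in> L" using assms t_L by auto
  fix x assume "x \<in> L"
  have "B x y \<in> {0}"
  proof (rule linear_on_span_in[OF lin_B_l _ t_diagonal[OF \<open>x \<in> L\<close>]])
    fix a assume "a \<in> (\<Union>\<alpha>\<in>D. R \<alpha>)"
    then obtain \<alpha> where a: "\<alpha> \<in> D" "a \<in> R \<alpha>" by blast
    show "B a y \<in> {0}"
    proof (cases "\<alpha> = (\<lambda>y. 0)")
      case True
      then show ?thesis using a assms(2) R_0 by simp
    next
      case False
      then obtain y' where "y' \<in> t" "\<alpha> y' \<noteq> 0" using D_sep[OF a(1) dual_space_0] by auto
      then show ?thesis using B_R_orth[OF a(2), of y "\<lambda>y. 0" y'] assms(1) R_0 by simp
    qed
  qed (auto simp: module.subspace_def module_def algebra_simps)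
  then show "B x y = 0" by simp
qed

section \<open>A basis of weight vectors and its dual basis\<close>

definition "U = (SOME U. U \<subseteq> (\<Union>\<alpha>\<in>D. R \<alpha>) \<and> independent U \<and> (\<Union>\<alpha>\<in>D. R \<alpha>) \<subseteq> span U)"
definition "du = (SOME du. dual_pair sc Basis br B g L U du \<and>
  (\<forall>u\<in>U. \<forall>v\<in>U. B v (du u) = (if v = u then 1 else 0)))"
definition "wt u = (SOME \<alpha>. \<alpha> \<in> D \<and> u \<in> R \<alpha>)"

lemma U_props: "U \<subseteq> (\<Union>\<alpha>\<in>D. R \<alpha>)" "independent U" "(\<Union>\<alpha>\<in>D. R \<alpha>) \<subseteq> span U"
proof -
  have "\<exists>U. U \<subseteq> (\<Union>\<alpha>\<in>D. R \<alpha>) \<and> independent U \<and> (\<Union>\<alpha>\<in>D. R \<alpha>) \<subseteq> span U"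
    using basis_exists by metis
  then have "U \<subseteq> (\<Union>\<alpha>\<in>D. R \<alpha>) \<and> independent U \<and> (\<Union>\<alpha>\<in>D. R \<alpha>) \<subseteq> span U"
    unfolding U_def by (rule someI_ex)
  then show "U \<subseteq> (\<Union>\<alpha>\<in>D. R \<alpha>)" "independent U" "(\<Union>\<alpha>\<in>D. R \<alpha>) \<subseteq> span U" by auto
qed

lemma U_L: "U \<subseteq> L" using U_props(1) R_L by blast

lemma L_span_U: "L \<subseteq> span U"
  using t_diagonal U_props(3) span_minimal[OF _ subspace_span] by blast

lemma
  shows du_pair: "dual_pair sc Basis br B g L U du"
    and B_du: "u \<in> U \<Longrightarrow> v \<in> U \<Longrightarrow> B v (du u) = (if v = u then 1 else 0)"
proof -
  have "dual_pair sc Basis br B g L U du \<and>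
  (\<forall>u\<in>U. \<forall>v\<in>U. B v (du u) = (if v = u then 1 else 0))"
    unfolding du_def
    by (rule someI_ex[OF dual_pair_exists[OF L_subspace L_g L_closed B_nondeg U_L U_props(2) L_span_U]])
  then show "dual_pair sc Basis br B g L U du"
    "u \<in> U \<Longrightarrow> v \<in> U \<Longrightarrow> B v (du u) = (if v = u then 1 else 0)" by auto
qed

sublocale dp: dual_pair sc Basis br B g L U du by (rule du_pair)

lemma wt: "u \<in> U \<Longrightarrow> wt u \<in> D \<and> u \<in> R (wt u)"
  unfolding wt_def by (rule someI_ex[of "\<lambda>\<alpha>. \<alpha> \<in> D \<and> u \<in> R \<alpha>"]) (use U_props(1) in blast)

lemma U_nz: "u \<in> U \<Longrightarrow> u \<noteq> 0"
  using U_props(2) dependent_zero by blast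

lemma R_indep:
  assumes "\<alpha> \<in> D" "x \<in> R \<alpha>" "x \<in> span (\<Union>\<beta>\<in>D - {\<alpha>}. R \<beta>)" shows "x = 0"
proof (rule eigen_independent[OF _ _ assms(1-3)])
  fix i j assume ij: "i \<in> D" "j \<in> D" "i \<noteq> j"
  then obtain y where y: "y \<in> t" "i y \<noteq> j y" using D_sep by blast
  show "\<exists>L c. Vector_Spaces.linear sc sc L \<and> (\<forall>k\<in>D. \<forall>w\<in>R k. L w = sc (c k) w) \<and> c i \<noteq> c j"
    using lin_br_r y R_br by (intro exI[of _ "br y"] exI[of _ "\<lambda>k. k y"]) auto
qed (rule R_subspace)

text \<open>Otherwise the whole basis would lie in the other weight spaces and \<open>x\<close>
  would be in their span, against \<open>R_indep\<close>.\<close>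

lemma ex_U:
  assumes "\<alpha> \<in> D" "x \<in> R \<alpha>" "x \<noteq> 0" shows "\<exists>u\<in>U. wt u = \<alpha>"
proof (rule ccontr)
  assume "\<not> ?thesis"
  then have "U \<subseteq> (\<Union>\<beta>\<in>D - {\<alpha>}. R \<beta>)" using wt by blast
  then have "x \<in> span (\<Union>\<beta>\<in>D - {\<alpha>}. R \<beta>)" using L_span_U R_L[OF assms(2)] span_mono by blast
  then show False using R_indep assms by blast
qed

lemma roots_D: "\<alpha> \<in> \<Delta> \<Longrightarrow> \<alpha> \<in> D" and roots_nz: "\<alpha> \<in> \<Delta> \<Longrightarrow> \<alpha> \<noteq> (\<lambda>y. 0)"
  by (auto simp: roots_def)

lemma root_R: "\<alpha> \<in> \<Delta> \<Longrightarrow> \<exists>x\<in>R \<alpha>. x \<noteq> 0"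
  using subspace_0[OF R_subspace] by (auto simp: roots_def)

lemma rootI: "\<alpha> \<in> D \<Longrightarrow> \<alpha> \<noteq> (\<lambda>y. 0) \<Longrightarrow> x \<in> R \<alpha> \<Longrightarrow> x \<noteq> 0 \<Longrightarrow> \<alpha> \<in> \<Delta>"
  by (auto simp: roots_def)

lemma wt_root: "u \<in> U \<Longrightarrow> wt u \<noteq> (\<lambda>y. 0) \<Longrightarrow> wt u \<in> \<Delta>"
  using wt U_nz rootI by blast

lemma root_ex_U: "\<alpha> \<in> \<Delta> \<Longrightarrow> \<exists>u\<in>U. wt u = \<alpha>"
  using root_R ex_U roots_D by blast

lemma finite_roots: "finite \<Delta>"
  by (rule finite_subset[of _ "wt ` U"]) (use root_ex_U dp.fin_U in auto)

text \<open>By invariance, \<open>br y (du u)\<close> and \<open>du u\<close> scaled by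
  \<open>- wt u y\<close> have the same pairing with every basis vector; nondegeneracy does the
  rest. The dual basis thus supplies the root vectors of opposite weight.\<close>

lemma du_R: assumes u: "u \<in> U" shows "du u \<in> R (\<lambda>y. - wt u y)"
proof -
  have duL: "du u \<in> L" using dp.du_X u by blast
  have "br y (du u) = sc (- wt u y) (du u)" if y: "y \<in> t" for y
  proof -
    have "br y (du u) - sc (- wt u y) (du u) = 0"
    proof (rule B_nondeg)
      show "br y (du u) - sc (- wt u y) (du u) \<in> L"
        using duL y t_L L_subspace by (auto intro!: subspace_diff subspace_scale L_closed simp del: scale_minus_left)
      fix x assume "x \<in> L"
      have "B x (br y (du u) - sc (- wt u y) (du u)) \<in> {0}"
      proof (rule linear_on_span_in[OF lin_B_l])
        show "x \<in> span U" using L_span_U \<open>x \<in> L\<close> by blast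
        fix v assume v: "v \<in> U"
        have "B v (br y (du u)) = B (br v y) (du u)" by (simp add: B_inv)
        also have "\<dots> = - B (br y v) (du u)"
          using v y U_L L_g' t_g by (subst br_skew) (auto simp: B_l.neg)
        also have "\<dots> = - (wt v y * B v (du u))" using R_br[OF conjunct2[OF wt[OF v]] y] by (simp add: B_l.scale)
        finally show "B v (br y (du u) - sc (- wt u y) (du u)) \<in> {0}"
          using B_du[OF u v] by (simp add: B_r.diff B_r.scale B_r.add B_r.neg)
      qed (auto simp: module.subspace_def module_def algebra_simps)
      then show "B x (br y (du u) - sc (- wt u y) (du u)) = 0" by simp
    qed
    then show ?thesis by (simp only: right_minus_eq)
  qed
  then show ?thesis using duL by (auto simp: root_space_def)
qed

lemma du_nz: "u \<in> U \<Longrightarrow> du u \<noteq> 0"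
  using B_du[of u u] by auto

lemma neg_root: assumes "\<alpha> \<in> \<Delta>" shows "(\<lambda>y. - \<alpha> y) \<in> \<Delta>"
proof -
  obtain u where u: "u \<in> U" "wt u = \<alpha>" using root_ex_U assms by blast
  have "(\<lambda>y. - \<alpha> y) \<noteq> (\<lambda>y. 0)" using roots_nz[OF assms] by (auto simp: fun_eq_iff)
  then show ?thesis
    using dual_space_neg[OF roots_D[OF assms]] du_R[OF u(1)] du_nz[OF u(1)] u(2)
    by (intro rootI[of _ "du u"]) auto
qed

definition "U0 = {u \<in> U. wt u = (\<lambda>y. 0)}"
text \<open>The vector of \<open>t\<close> that represents \<open>\<nu>\<close> under the form. It
  agrees with \<open>dual_vector\<close> on \<open>D\<close>, but the explicit sum is visibly linear
  in \<open>\<nu>\<close>.\<close>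

definition "tv \<nu> = (\<Sum>u\<in>U0. sc (\<nu> u) (du u))"
definition "Up = {u \<in> U. wt u \<in> positive_roots \<Delta> \<Pi>}"
text \<open>The sum 2\<rho> of the positive roots. Summation over basis vectors counts each root
  with the dimension of its root space.\<close>

definition "two_rho = (\<lambda>y. \<Sum>u\<in>Up. wt u y)"

lemma fin_U0: "finite U0" and fin_Up: "finite Up"
  using dp.fin_U by (auto simp: U0_def Up_def)

lemma U0_t: "u \<in> U0 \<Longrightarrow> u \<in> t" and du_U0_t: "u \<in> U0 \<Longrightarrow> du u \<in> t"
proof -
  assume "u \<in> U0"
  then have u: "u \<in> U" "wt u = (\<lambda>y. 0)" by (auto simp: U0_def)
  show "u \<in> t" using u wt R_0 by metis
  show "du u \<in> t" using u du_R[OF u(1)] R_0 by simp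
qed

lemma tv_t: "tv \<nu> \<in> t"
  unfolding tv_def using t_subspace du_U0_t by (intro subspace_sum_scale)

lemma expand_t: assumes "y \<in> t" shows "y = (\<Sum>u\<in>U0. sc (B y (du u)) u)"
proof -
  have "y = (\<Sum>u\<in>U. sc (B y (du u)) u)" using assms t_L by (intro dp.expand_U) auto
  also have "\<dots> = (\<Sum>u\<in>U0. sc (B y (du u)) u)"
  proof (rule sum.mono_neutral_right)
    show "\<forall>u\<in>U - U0. sc (B y (du u)) u = 0"
    proof
      fix u assume "u \<in> U - U0"
      then have u: "u \<in> U" "wt u \<noteq> (\<lambda>y. 0)" by (auto simp: U0_def)
      then obtain y' where "y' \<in> t" "wt u y' \<noteq> 0" using D_sep[of "wt u" "\<lambda>y. 0"] dual_space_0 wt by auto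
      then have "B y (du u) = 0" using B_R_orth[of y "\<lambda>y. 0" "du u" "\<lambda>y. - wt u y" y'] assms R_0 du_R u by simp
      then show "sc (B y (du u)) u = 0" by simp
    qed
  qed (auto simp: U0_def dp.fin_U)
  finally show ?thesis .
qed

lemma B_tv: assumes "\<nu> \<in> D" "y \<in> t" shows "B (tv \<nu>) y = \<nu> y"
proof -
  have "B (tv \<nu>) y = (\<Sum>u\<in>U0. \<nu> u * B y (du u))"
    unfolding tv_def using B_sym[of y] assms du_U0_t t_g by (auto simp: B_l.sum B_l.scale intro!: sum.cong)
  also have "\<dots> = \<nu> (\<Sum>u\<in>U0. sc (B y (du u)) u)"
    using assms U0_t t_subspace by (subst D_sum) (auto simp: D_scale mult.commute intro: subspace_scale)
  finally show ?thesis using expand_t[OF assms(2)] by simp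
qed

lemma tv_unique: assumes "\<nu> \<in> D" "x \<in> t" "\<And>y. y \<in> t \<Longrightarrow> B x y = \<nu> y" shows "x = tv \<nu>"
proof -
  have "x - tv \<nu> = 0"
  proof (rule t_nondeg)
    show d: "x - tv \<nu> \<in> t" using assms tv_t t_subspace by (intro subspace_diff)
    fix y assume y: "y \<in> t"
    have "B y (x - tv \<nu>) = B (x - tv \<nu>) y" using d y t_g by (intro B_sym) auto
    then show "B y (x - tv \<nu>) = 0" using assms y B_tv by (simp add: B_l.diff)
  qed
  then show ?thesis by simp
qed

lemma dual_vector_tv: assumes "\<nu> \<in> D" shows "dual_vector B t \<nu> = tv \<nu>"
  unfolding dual_vector_def using assms tv_t B_tv tv_unique by (intro the_equality) auto

lemma dual_form_tv: "\<nu> \<in> D \<Longrightarrow> \<mu> \<in> D \<Longrightarrow> dual_form B t \<nu> \<mu> = \<nu> (tv \<mu>)"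
  unfolding dual_form_def by (simp add: dual_vector_tv B_tv tv_t)

lemma ip_sym: "\<nu> \<in> D \<Longrightarrow> \<mu> \<in> D \<Longrightarrow> \<nu> (tv \<mu>) = \<mu> (tv \<nu>)"
  by (metis B_sym B_tv t_g tv_t)

lemma tv_add: "\<nu> \<in> D \<Longrightarrow> \<mu> \<in> D \<Longrightarrow> tv (\<lambda>y. \<nu> y + \<mu> y) = tv \<nu> + tv \<mu>"
  unfolding tv_def by (simp add: scale_left_distrib sum.distrib)

lemma tv_neg: "tv (\<lambda>y. - \<nu> y) = - tv \<nu>"
  unfolding tv_def by (simp add: sum_negf)

text \<open>The bracket lies in \<open>t\<close>, and invariance moves \<open>y\<close> onto
  \<open>f\<close>, which shows that it represents \<open>B e f\<close> times
  \<open>\<alpha>\<close>.\<close>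

lemma br_opposite:
  assumes "\<alpha> \<in> D" "e \<in> R \<alpha>" "f \<in> R (\<lambda>y. - \<alpha> y)"
  shows "br e f = sc (B e f) (tv \<alpha>)"
proof -
  have eft: "br e f \<in> t" using R_br_R[OF assms(2,3)] R_0 by simp
  have D: "(\<lambda>y. B e f * \<alpha> y) \<in> D" using assms by (intro dual_space_mult)
  have "br e f = tv (\<lambda>y. B e f * \<alpha> y)"
  proof (rule tv_unique[OF D eft])
    fix y assume y: "y \<in> t"
    have "br f y = - br y f" using y t_g L_g' R_L[OF assms(3)] by (intro br_skew)
    then show "B (br e f) y = B e f * \<alpha> y"
      using R_br[OF assms(3) y] by (simp add: B_inv B_r.scale)
  qed
  also have "\<dots> = sc (B e f) (tv \<alpha>)" by (simp add: tv_def scale_sum_right)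
  finally show ?thesis .
qed

section \<open>Positive roots and the positivity of 2\<rho>\<close>

lemma simple_root: "\<beta> \<in> \<Pi> \<Longrightarrow> \<beta> \<in> \<Delta>" and fin_Pi: "finite \<Pi>"
  using simple_system by (auto simp: simple_root_system_def)

lemma simple_indep: "(\<And>y. (\<Sum>\<beta>\<in>\<Pi>. c \<beta> * \<beta> y) = 0) \<Longrightarrow> \<beta> \<in> \<Pi> \<Longrightarrow> c \<beta> = 0"
  using simple_system unfolding simple_root_system_def by blast

lemma nat_comb_D: "nat_comb \<Pi> c \<in> D"
  unfolding nat_comb_def using simple_root roots_D by (intro dual_space_sum dual_space_mult) auto

lemma nat_comb_unique:
  assumes "nat_comb \<Pi> c = nat_comb \<Pi> c'" "\<beta> \<in> \<Pi>" shows "c \<beta> = c' \<beta>"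
proof -
  have "of_nat (c \<beta>) - of_nat (c' \<beta>) = (0::complex)"
  proof (rule simple_indep[OF _ assms(2)])
    fix y show "(\<Sum>\<beta>\<in>\<Pi>. (of_nat (c \<beta>) - of_nat (c' \<beta>)) * \<beta> y) = 0"
      using fun_cong[OF assms(1), of y] by (simp add: nat_comb_def left_diff_distrib sum_subtractf)
  qed
  then show ?thesis by simp
qed

lemma nat_comb_add: "nat_comb \<Pi> c y + nat_comb \<Pi> c' y = nat_comb \<Pi> (\<lambda>\<beta>. c \<beta> + c' \<beta>) y"
  by (simp add: nat_comb_def sum.distrib distrib_right)

lemma nat_comb_0: "nat_comb \<Pi> (\<lambda>_. 0) = (\<lambda>y. 0)"
  by (simp add: nat_comb_def)

lemma nat_comb_single: "\<beta> \<in> \<Pi> \<Longrightarrow> nat_comb \<Pi> (\<lambda>\<gamma>. if \<gamma> = \<beta> then n else 0) = (\<lambda>y. of_nat n * \<beta> y)"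
  unfolding nat_comb_def
proof
  fix y assume "\<beta> \<in> \<Pi>"
  have "(\<Sum>\<gamma>\<in>\<Pi>. of_nat (if \<gamma> = \<beta> then n else 0) * \<gamma> y) = (\<Sum>\<gamma>\<in>\<Pi>. if \<gamma> = \<beta> then of_nat n * \<gamma> y else 0)"
    by (intro sum.cong) auto
  then show "(\<Sum>\<gamma>\<in>\<Pi>. of_nat (if \<gamma> = \<beta> then n else 0) * \<gamma> y) = of_nat n * \<beta> y"
    using \<open>\<beta> \<in> \<Pi>\<close> fin_Pi by simp
qed

lemma nat_comb_simple: "\<beta> \<in> \<Pi> \<Longrightarrow> \<beta> = nat_comb \<Pi> (\<lambda>\<gamma>. if \<gamma> = \<beta> then 1 else 0)"
  by (simp add: nat_comb_single)

lemma nat_comb_eq_0: "nat_comb \<Pi> c = (\<lambda>y. 0) \<Longrightarrow> \<beta> \<in> \<Pi> \<Longrightarrow> c \<beta> = 0"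
  using nat_comb_unique[of c "\<lambda>_. 0" \<beta>] nat_comb_0 by simp

lemma nat_comb_sum_0:
  "(\<And>y. nat_comb \<Pi> c y + nat_comb \<Pi> c' y = 0) \<Longrightarrow> \<beta> \<in> \<Pi> \<Longrightarrow> c \<beta> = 0 \<and> c' \<beta> = 0"
  using nat_comb_eq_0[of "\<lambda>\<beta>. c \<beta> + c' \<beta>" \<beta>] nat_comb_add[of c _ c'] by fastforce

lemma root_cases:
  assumes "\<alpha> \<in> \<Delta>"
  obtains c where "\<alpha> = nat_comb \<Pi> c" | c where "\<alpha> = (\<lambda>y. - nat_comb \<Pi> c y)"
  using simple_system assms unfolding simple_root_system_def by blast

lemma root_positive_or_negative:
  assumes "\<alpha> \<in> \<Delta>"
  shows "\<alpha> \<in> positive_roots \<Delta> \<Pi> \<or> (\<lambda>y. - \<alpha> y) \<in> positive_roots \<Delta> \<Pi>"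
  using assms neg_root[OF assms] by (cases rule: root_cases[OF assms]) (auto simp: positive_roots_def)

lemma positive_root: "\<alpha> \<in> positive_roots \<Delta> \<Pi> \<Longrightarrow> \<alpha> \<in> \<Delta>"
  by (simp add: positive_roots_def)

lemma positive_neg: "\<alpha> \<in> positive_roots \<Delta> \<Pi> \<Longrightarrow> (\<lambda>y. - \<alpha> y) \<notin> positive_roots \<Delta> \<Pi>"
proof
  assume a: "\<alpha> \<in> positive_roots \<Delta> \<Pi>" "(\<lambda>y. - \<alpha> y) \<in> positive_roots \<Delta> \<Pi>"
  obtain c where c: "\<alpha> = nat_comb \<Pi> c" using a(1) by (auto simp: positive_roots_def)
  obtain c' where c': "(\<lambda>y. - \<alpha> y) = nat_comb \<Pi> c'" using a(2) by (auto simp: positive_roots_def)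
  have s: "nat_comb \<Pi> c y + nat_comb \<Pi> c' y = 0" for y
    using fun_cong[OF c', of y] fun_cong[OF c, of y] by (metis add.right_inverse)
  have "nat_comb \<Pi> c = (\<lambda>y. 0)"
    using nat_comb_sum_0[of c c', OF s] unfolding nat_comb_def by simp
  then show False using roots_nz[OF positive_root[OF a(1)]] c by simp
qed

text \<open>The strict order on complex numbers compares real parts and requires equal imaginary
  parts, so this inequality and the later ones of its kind also assert that the value is
  real.\<close>

lemma ip_pos:
  assumes "\<alpha> \<in> \<Delta>" shows "\<alpha> (tv \<alpha>) > 0"
proof -
  have "\<alpha> = (\<lambda>y. \<Sum>\<beta>\<in>\<Delta>. complex_of_real (if \<beta> = \<alpha> then 1 else 0) * \<beta> y)"
  proof
    fix y
    have "(\<Sum>\<beta>\<in>\<Delta>. complex_of_real (if \<beta> = \<alpha> then 1 else 0) * \<beta> y) = (\<Sum>\<beta>\<in>\<Delta>. if \<beta> = \<alpha> then \<beta> y else 0)"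
      by (intro sum.cong) auto
    then show "\<alpha> y = (\<Sum>\<beta>\<in>\<Delta>. complex_of_real (if \<beta> = \<alpha> then 1 else 0) * \<beta> y)"
      using finite_roots assms by simp
  qed
  then have "\<alpha> \<in> real_root_span \<Delta>" unfolding real_root_span_def mem_Collect_eq by (intro exI[of _ "\<lambda>\<beta>. if \<beta> = \<alpha> then 1 else 0"] conjI TrueI)
  then have "dual_form B t \<alpha> \<alpha> \<in> \<real> \<and> 0 < Re (dual_form B t \<alpha> \<alpha>)"
    using pos_def roots_nz[OF assms] unfolding positive_definite_on_roots_def by blast
  then show ?thesis using roots_D[OF assms]
    by (simp add: dual_form_tv less_complex_def complex_is_Real_iff)
qed

lemma two_rho_D: "two_rho \<in> D"
  unfolding two_rho_def Up_def using wt by (intro dual_space_sum) auto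

text \<open>The elements of \<open>U\<close> of positive weight that is not a multiple of \<open>\<beta>\<close> span a space stable under
  \<open>ad e\<close> and \<open>ad f\<close> for \<open>e\<close>, \<open>f\<close> of weights \<open>\<beta>\<close>, \<open>-\<beta>\<close>; so \<open>ad [e, f]\<close> has trace 0 on it.\<close>

lemma two_rho_simple:
  assumes \<beta>: "\<beta> \<in> \<Pi>" shows "two_rho (tv \<beta>) > 0"
proof -
  obtain e where e: "e \<in> U" "wt e = \<beta>" using root_ex_U simple_root \<beta> by blast
  define f where "f = du e"
  have \<beta>D: "\<beta> \<in> D" using \<beta> simple_root roots_D by blast
  have eR: "e \<in> R \<beta>" and fR: "f \<in> R (\<lambda>y. - \<beta> y)" using e wt du_R unfolding f_def by auto
  have ef: "br e f = tv \<beta>" using br_opposite[OF \<beta>D eR fR] B_du[OF e(1) e(1)] by (simp add: f_def)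
  define P where "P = {u \<in> U. \<exists>c. wt u = nat_comb \<Pi> c \<and> (\<exists>\<gamma>\<in>\<Pi>. \<gamma> \<noteq> \<beta> \<and> c \<gamma> > 0)}"
  have PU: "P \<subseteq> U" by (auto simp: P_def)
  define sg where "sg s = (\<lambda>y. s * \<beta> y)" for s :: complex
  \<comment> \<open>If \<open>b\<close> occurs in \<open>br x u\<close>, then \<open>wt b\<close> is
    \<open>wt u\<close> plus or minus \<open>\<beta>\<close>. This leaves the coefficient of
    \<open>\<gamma>\<close> positive, and as a root cannot have coefficients of both signs,
    \<open>wt b\<close> is again positive.\<close>
  have stable: "b \<in> P" if u: "u \<in> P" and b: "b \<in> U" and x: "x \<in> R (sg s)" and s: "s = 1 \<or> s = -1"
    and nz: "B (br x u) (du b) \<noteq> 0" for u b x s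
  proof -
    obtain c \<gamma> where c: "u \<in> U" "wt u = nat_comb \<Pi> c" "\<gamma> \<in> \<Pi>" "\<gamma> \<noteq> \<beta>" "c \<gamma> > 0"
      using u by (auto simp: P_def)
    have "br x u \<in> R (\<lambda>y. sg s y + wt u y)" using R_br_R x wt c(1) by blast
    then have "sg s y + wt u y + - wt b y = 0" if "y \<in> t" for y
      using B_R_orth du_R[OF b] that nz by blast
    then have eq: "wt b = (\<lambda>y. sg s y + wt u y)"
      using wt c(1) b \<beta>D unfolding sg_def
      by (intro dual_space_eqI[of _ sc t] dual_space_add dual_space_mult) (auto simp: algebra_simps)
    let ?\<beta> = "\<lambda>\<gamma>. if \<gamma> = \<beta> then 1 else 0::nat"
    have bb: "nat_comb \<Pi> ?\<beta> = \<beta>" using nat_comb_simple[OF \<beta>] by simp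
    have eq': "wt b y = s * \<beta> y + nat_comb \<Pi> c y" for y using eq c(2) by (simp add: sg_def)
    have no_neg: False if "\<And>y. wt b y = - nat_comb \<Pi> c' y" for c'
    proof (cases "s = 1")
      case True
      then have "nat_comb \<Pi> (\<lambda>\<delta>. ?\<beta> \<delta> + c \<delta>) y + nat_comb \<Pi> c' y = 0" for y
        using that[of y] eq'[of y] bb by (simp flip: nat_comb_add)
      then show ?thesis using nat_comb_sum_0[of "\<lambda>\<delta>. ?\<beta> \<delta> + c \<delta>" c' \<gamma>] c by auto
    next
      case False
      then have "nat_comb \<Pi> (\<lambda>\<delta>. c \<delta> + c' \<delta>) = nat_comb \<Pi> ?\<beta>"
        using that eq' bb s by (intro ext) (simp add: diff_eq_eq flip: nat_comb_add)
      then show ?thesis using nat_comb_unique[of "\<lambda>\<delta>. c \<delta> + c' \<delta>" ?\<beta> \<gamma>] c by auto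
    qed
    have "wt b \<noteq> (\<lambda>y. 0)" using no_neg[of "\<lambda>_. 0"] by (auto simp: nat_comb_0)
    then have wtb: "wt b \<in> \<Delta>" using wt_root b by blast
    obtain c' where c': "wt b = nat_comb \<Pi> c'"
    proof (cases rule: root_cases[OF wtb])
      case (2 c')
      then show ?thesis using no_neg[of c'] by simp
    qed (use that in blast)
    have "c' \<gamma> = c \<gamma>"
    proof (cases "s = 1")
      case True
      then have "nat_comb \<Pi> c' = nat_comb \<Pi> (\<lambda>\<delta>. ?\<beta> \<delta> + c \<delta>)"
        using eq' bb c' by (intro ext) (simp flip: nat_comb_add)
      then show ?thesis using nat_comb_unique[of c' "\<lambda>\<delta>. ?\<beta> \<delta> + c \<delta>" \<gamma>] c by auto
    next
      case False
      then have "nat_comb \<Pi> (\<lambda>\<delta>. ?\<beta> \<delta> + c' \<delta>) = nat_comb \<Pi> c"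
        using eq' bb c' s by (intro ext) (simp flip: nat_comb_add)
      then show ?thesis using nat_comb_unique[of "\<lambda>\<delta>. ?\<beta> \<delta> + c' \<delta>" c \<gamma>] c by auto
    qed
    then have "\<exists>\<gamma>\<in>\<Pi>. \<gamma> \<noteq> \<beta> \<and> c' \<gamma> > 0" using c by auto
    then show ?thesis using b c' unfolding P_def by blast
  qed
  have eR': "e \<in> R (sg 1)" and fR': "f \<in> R (sg (-1))" using eR fR by (simp_all add: sg_def)
  have expand: "br x u = (\<Sum>b\<in>P. sc (B (br x u) (du b)) b)"
    if u: "u \<in> P" and x: "x \<in> R (sg s)" and s: "s = 1 \<or> s = -1" for u x s
  proof -
    have "br x u = (\<Sum>b\<in>U. sc (B (br x u) (du b)) b)"
      using u PU U_L x R_L by (intro dp.expand_U L_closed) auto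
    also have "\<dots> = (\<Sum>b\<in>P. sc (B (br x u) (du b)) b)"
      using stable[OF u _ x s] PU dp.fin_U by (intro sum.mono_neutral_right) auto
    finally show ?thesis .
  qed
  have gg: "e \<in> g" "f \<in> g" "\<And>u. u \<in> P \<Longrightarrow> u \<in> g" using eR fR R_L L_g' PU dp.U_g by auto
  have "wt u (tv \<beta>) = (\<Sum>b\<in>P. B (br f u) (du b) * B (br e b) (du u)) - (\<Sum>b\<in>P. B (br e u) (du b) * B (br f b) (du u))"
    if u: "u \<in> P" for u
  proof -
    have uU: "u \<in> U" using u PU by blast
    have "wt u (tv \<beta>) = B (br (tv \<beta>) u) (du u)"
      using R_br[OF conjunct2[OF wt[OF uU]] tv_t] B_du[OF uU uU] by (simp add: B_l.scale)
    also have "br (tv \<beta>) u = br e (br f u) - br f (br e u)"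
      using jacobi[OF gg(1,2) gg(3)[OF u]] ef by simp
    also have "B \<dots> (du u) = B (br e (\<Sum>b\<in>P. sc (B (br f u) (du b)) b)) (du u) - B (br f (\<Sum>b\<in>P. sc (B (br e u) (du b)) b)) (du u)"
      using expand[OF u eR'] expand[OF u fR'] by (simp add: B_l.diff)
    also have "\<dots> = (\<Sum>b\<in>P. B (br f u) (du b) * B (br e b) (du u)) - (\<Sum>b\<in>P. B (br e u) (du b) * B (br f b) (du u))"
      by (simp add: br_r.sum br_r.scale B_l.sum B_l.scale)
    finally show ?thesis .
  qed
  \<comment> \<open>The trace on the span of \<open>P\<close> of the commutator of
    \<open>ad e\<close> and \<open>ad f\<close>, in coordinates; the two double sums agree after
    exchanging \<open>u\<close> and \<open>b\<close>.\<close>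
  then have "(\<Sum>u\<in>P. wt u (tv \<beta>)) = (\<Sum>u\<in>P. \<Sum>b\<in>P. B (br f u) (du b) * B (br e b) (du u))
      - (\<Sum>u\<in>P. \<Sum>b\<in>P. B (br e u) (du b) * B (br f b) (du u))"
    by (simp add: sum_subtractf)
  also have "(\<Sum>u\<in>P. \<Sum>b\<in>P. B (br e u) (du b) * B (br f b) (du u)) = (\<Sum>u\<in>P. \<Sum>b\<in>P. B (br f u) (du b) * B (br e b) (du u))"
    by (subst sum.swap) (simp add: mult.commute)
  finally have trace0: "(\<Sum>u\<in>P. wt u (tv \<beta>)) = 0" by simp
  have P_Up: "P \<subseteq> Up"
  proof
    fix u assume "u \<in> P"
    then obtain c \<gamma> where c: "u \<in> U" "wt u = nat_comb \<Pi> c" "\<gamma> \<in> \<Pi>" "c \<gamma> > 0" by (auto simp: P_def)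
    then have "wt u \<noteq> (\<lambda>y. 0)" using nat_comb_eq_0[of c \<gamma>] by auto
    then have "wt u \<in> \<Delta>" using c wt_root by blast
    then show "u \<in> Up" using c unfolding Up_def positive_roots_def by blast
  qed
  have rest: "wt u (tv \<beta>) > 0" if "u \<in> Up - P" for u
  proof -
    have "u \<in> U \<and> wt u \<in> \<Delta> \<and> (\<exists>c. wt u = nat_comb \<Pi> c)"
      using DiffD1[OF that] unfolding Up_def positive_roots_def mem_Collect_eq .
    then obtain c where c: "u \<in> U" "wt u \<in> \<Delta>" "wt u = nat_comb \<Pi> c" by (elim conjE exE)
    have "c \<gamma> = 0" if "\<gamma> \<in> \<Pi>" "\<gamma> \<noteq> \<beta>" for \<gamma>
    proof (rule ccontr)
      assume "c \<gamma> \<noteq> 0"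
      then have "u \<in> P" unfolding P_def mem_Collect_eq using c that by (intro conjI exI[of _ c] bexI[of _ \<gamma>]) auto
      then show False using DiffD2[OF \<open>u \<in> Up - P\<close>] by simp
    qed
    then have "nat_comb \<Pi> c = nat_comb \<Pi> (\<lambda>\<gamma>. if \<gamma> = \<beta> then c \<beta> else 0)"
      unfolding nat_comb_def by (intro ext sum.cong) auto
    then have eq: "wt u = (\<lambda>y. of_nat (c \<beta>) * \<beta> y)" using c nat_comb_single[OF \<beta>] by simp
    then have "c \<beta> \<noteq> 0" using roots_nz[OF c(2)] by auto
    then show ?thesis using ip_pos[OF simple_root[OF \<beta>]] eq by (simp add: less_complex_def)
  qed
  have "e \<in> Up - P"
  proof -
    have "e \<in> Up" using e simple_root[OF \<beta>] nat_comb_simple[OF \<beta>] unfolding Up_def positive_roots_def by blast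
    moreover have "e \<notin> P"
    proof
      assume "e \<in> P"
      then obtain c \<gamma> where c: "\<beta> = nat_comb \<Pi> c" "\<gamma> \<in> \<Pi>" "\<gamma> \<noteq> \<beta>" "c \<gamma> > 0" using e by (auto simp: P_def)
      show False using nat_comb_unique[of c _ \<gamma>, OF trans[OF sym[OF c(1)] nat_comb_simple[OF \<beta>]]] c by simp
    qed
    ultimately show ?thesis by blast
  qed
  \<comment> \<open>Only positive multiples of \<open>\<beta>\<close> are left over, each with a
    positive value, and \<open>e\<close> makes the sum nonempty.\<close>
  then have "(\<Sum>u\<in>Up - P. wt u (tv \<beta>)) > 0"
    using rest fin_Up by (intro sum_pos) auto
  moreover have "two_rho (tv \<beta>) = (\<Sum>u\<in>Up - P. wt u (tv \<beta>)) + (\<Sum>u\<in>P. wt u (tv \<beta>))"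
    unfolding two_rho_def using P_Up fin_Up by (rule sum.subset_diff)
  ultimately show ?thesis using trace0 by simp
qed

lemma nat_comb_tv: "\<nu> \<in> D \<Longrightarrow> \<nu> (tv (nat_comb \<Pi> c)) = (\<Sum>\<beta>\<in>\<Pi>. of_nat (c \<beta>) * \<nu> (tv \<beta>))"
  using ip_sym[OF _ nat_comb_D, of \<nu> c] ip_sym[of \<nu>] simple_root roots_D
  by (auto simp: nat_comb_def intro!: sum.cong)

lemma positive_on_comb:
  assumes "\<nu> \<in> D" "\<And>\<beta>. \<beta> \<in> \<Pi> \<Longrightarrow> \<nu> (tv \<beta>) > 0" shows "\<nu> (tv (nat_comb \<Pi> c)) \<ge> 0"
  using assms by (auto simp: nat_comb_tv less_imp_le less_eq_complex_def[of 0 "of_nat _"] intro!: sum_nonneg mult_nonneg_nonneg)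

lemma positive_on_positive_roots:
  assumes "\<nu> \<in> D" "\<And>\<beta>. \<beta> \<in> \<Pi> \<Longrightarrow> \<nu> (tv \<beta>) > 0" "\<alpha> \<in> positive_roots \<Delta> \<Pi>"
  shows "\<nu> (tv \<alpha>) > 0"
proof -
  obtain c where c: "\<alpha> = nat_comb \<Pi> c" "\<alpha> \<in> \<Delta>" using assms(3) by (auto simp: positive_roots_def)
  have "\<exists>\<beta>\<in>\<Pi>. c \<beta> \<noteq> 0"
  proof (rule ccontr)
    assume "\<not> ?thesis"
    then have "\<alpha> = (\<lambda>y. 0)" unfolding c nat_comb_def by simp
    then show False using roots_nz c(2) by blast
  qed
  then obtain \<beta> where \<beta>: "\<beta> \<in> \<Pi>" "c \<beta> > 0" by auto
  have "(\<Sum>\<beta>\<in>\<Pi>. of_nat (c \<beta>) * \<nu> (tv \<beta>)) > 0"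
  proof (rule sum_pos2[OF fin_Pi \<beta>(1)])
    show "0 < of_nat (c \<beta>) * \<nu> (tv \<beta>)" using \<beta> assms(2)[OF \<beta>(1)] by (simp add: less_complex_def)
    show "0 \<le> of_nat (c \<gamma>) * \<nu> (tv \<gamma>)" if "\<gamma> \<in> \<Pi>" for \<gamma>
      using assms(2)[OF that] by (intro mult_nonneg_nonneg) (auto simp: less_imp_le less_eq_complex_def[of 0 "of_nat _"])
  qed
  then show ?thesis using nat_comb_tv[OF assms(1)] c(1) by simp
qed

section \<open>The highest root\<close>

lemma theta_root: "\<theta> \<in> \<Delta>" and theta_D: "\<theta> \<in> D"
  using highest roots_D by (auto simp: highest_root_def)

lemma theta_ge: "\<alpha> \<in> \<Delta> \<Longrightarrow> \<exists>c. \<theta> = (\<lambda>y. \<alpha> y + nat_comb \<Pi> c y)"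
  using highest by (auto simp: highest_root_def)

lemma theta_positive: "\<theta> \<in> positive_roots \<Delta> \<Pi>"
proof (rule ccontr)
  assume "\<theta> \<notin> positive_roots \<Delta> \<Pi>"
  then have n: "(\<lambda>y. - \<theta> y) \<in> positive_roots \<Delta> \<Pi>" using root_positive_or_negative theta_root by blast
  then obtain c where c: "(\<lambda>y. - \<theta> y) = nat_comb \<Pi> c" by (auto simp: positive_roots_def)
  \<comment> \<open>Maximality against the root \<open>- \<theta>\<close> makes 2\<theta> a
    nonnegative combination of simple roots, while \<open>- \<theta>\<close> is one too; all
    coefficients then vanish.\<close>
  obtain c' where c': "\<theta> = (\<lambda>y. - \<theta> y + nat_comb \<Pi> c' y)" using theta_ge[OF neg_root[OF theta_root]] by blast
  have s: "nat_comb \<Pi> (\<lambda>\<beta>. c \<beta> + c \<beta>) y + nat_comb \<Pi> c' y = 0" for y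
    using fun_cong[OF c, of y] fun_cong[OF c', of y]
    by (simp flip: nat_comb_add) (metis add.left_inverse)
  have "c \<beta> = 0" if "\<beta> \<in> \<Pi>" for \<beta> using nat_comb_sum_0[OF s that] by simp
  then have "(\<lambda>y. - \<theta> y) = (\<lambda>y. 0)" unfolding c nat_comb_def by simp
  then show False using roots_nz[OF positive_root[OF n]] by blast
qed

text \<open>A nonzero bracket would make \<open>\<alpha> + \<theta>\<close> a root above
  \<open>\<theta>\<close>; it is not 0, being a sum of two positive roots.\<close>

lemma theta_top:
  assumes "\<alpha> \<in> positive_roots \<Delta> \<Pi>" "x \<in> R \<alpha>" "z \<in> R \<theta>" shows "br x z = 0"
proof (rule ccontr)
  assume nz: "br x z \<noteq> 0"
  obtain c where c: "\<alpha> = nat_comb \<Pi> c" "\<alpha> \<in> \<Delta>" using assms(1) by (auto simp: positive_roots_def)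
  have "(\<lambda>y. \<alpha> y + \<theta> y) \<in> D" using c(2) theta_root by (intro dual_space_add roots_D)
  moreover have "(\<lambda>y. \<alpha> y + \<theta> y) \<noteq> (\<lambda>y. 0)"
  proof
    assume "(\<lambda>y. \<alpha> y + \<theta> y) = (\<lambda>y. 0)"
    then have "(\<lambda>y. - \<alpha> y) = \<theta>" by (intro ext) (metis add_eq_0_iff)
    then show False using positive_neg[OF assms(1)] theta_positive by simp
  qed
  ultimately have "(\<lambda>y. \<alpha> y + \<theta> y) \<in> \<Delta>" using rootI R_br_R[OF assms(2,3)] nz by blast
  then obtain c' where "\<theta> = (\<lambda>y. \<alpha> y + \<theta> y + nat_comb \<Pi> c' y)" using theta_ge by blast
  then have s: "nat_comb \<Pi> c y + nat_comb \<Pi> c' y = 0" for y using c(1) by (metis add.commute add.left_commute add_left_cancel add_0_right)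
  have "\<alpha> = (\<lambda>y. 0)" using nat_comb_sum_0[of c c', OF s] unfolding c nat_comb_def by simp
  then show False using roots_nz c(2) by blast
qed

text \<open>Stated modulo a submodule \<open>S\<close>, so that it applies to subquotients.\<close>

lemma casimir_singular:
  fixes s2 :: "complex \<Rightarrow> 'm::ab_group_add \<Rightarrow> 'm"
  assumes vs: "vector_space s2" and S: "module.subspace s2 S"
    and \<phi>_add: "\<And>x y w. \<phi> x (w + y) = \<phi> x w + \<phi> x y"
    and \<phi>S: "\<And>x w. x \<in> L \<Longrightarrow> w \<in> S \<Longrightarrow> \<phi> x w \<in> S"
    and comm: "\<And>x y. x \<in> L \<Longrightarrow> y \<in> L \<Longrightarrow> \<phi> x (\<phi> y v) = \<phi> y (\<phi> x v) + \<phi> (br x y) v"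
    and sing: "\<And>\<alpha> x. \<alpha> \<in> positive_roots \<Delta> \<Pi> \<Longrightarrow> x \<in> R \<alpha> \<Longrightarrow> \<phi> x v \<in> S"
    and wtv: "\<And>y w. y \<in> t \<Longrightarrow> \<phi> y v = s2 (\<nu> y) v" "\<And>y c. y \<in> t \<Longrightarrow> \<phi> y (s2 c v) = s2 c (\<phi> y v)"
    and \<nu>: "\<nu> \<in> D"
  shows "(\<Sum>u\<in>U. \<phi> u (\<phi> (du u) v)) - s2 (\<nu> (tv \<nu>) + \<nu> (tv two_rho)) v \<in> S"
proof -
  interpret s2: vector_space s2 by (rule vs)
  let ?Un = "U - (U0 \<union> Up)"
  have split: "U0 \<union> Up \<subseteq> U" "U0 \<inter> Up = {}"
    using roots_nz positive_root by (auto simp: U0_def Up_def)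
  have UnL: "u \<in> U \<Longrightarrow> u \<in> L \<and> du u \<in> L" for u using U_L dp.du_X by blast
  have "(\<Sum>u\<in>U. \<phi> u (\<phi> (du u) v)) = (\<Sum>u\<in>U0. \<phi> u (\<phi> (du u) v)) + (\<Sum>u\<in>Up. \<phi> u (\<phi> (du u) v)) + (\<Sum>u\<in>?Un. \<phi> u (\<phi> (du u) v))"
    using sum.subset_diff[OF split(1) dp.fin_U, of "\<lambda>u. \<phi> u (\<phi> (du u) v)"]
      sum.union_disjoint[OF fin_U0 fin_Up split(2), of "\<lambda>u. \<phi> u (\<phi> (du u) v)"] by (simp add: add.commute)
  \<comment> \<open>For \<open>u\<close> of negative weight the right factor \<open>du u\<close> is
    a raising vector and already maps \<open>v\<close> into \<open>S\<close>.\<close>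
  moreover have "(\<Sum>u\<in>?Un. \<phi> u (\<phi> (du u) v)) \<in> S"
  proof (rule s2.subspace_sum[OF S])
    fix u assume u: "u \<in> ?Un"
    then have "wt u \<in> \<Delta>" "wt u \<notin> positive_roots \<Delta> \<Pi>" using wt_root by (auto simp: U0_def Up_def)
    then have "(\<lambda>y. - wt u y) \<in> positive_roots \<Delta> \<Pi>" using root_positive_or_negative by blast
    then have "\<phi> (du u) v \<in> S" using sing du_R u by blast
    then show "\<phi> u (\<phi> (du u) v) \<in> S" using \<phi>S UnL u by blast
  qed
  moreover have "(\<Sum>u\<in>U0. \<phi> u (\<phi> (du u) v)) = s2 (\<nu> (tv \<nu>)) v"
  proof -
    have "(\<Sum>u\<in>U0. \<phi> u (\<phi> (du u) v)) = (\<Sum>u\<in>U0. s2 (\<nu> u * \<nu> (du u)) v)"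
      using U0_t du_U0_t wtv by (intro sum.cong) (auto simp: mult.commute)
    also have "\<dots> = s2 (\<Sum>u\<in>U0. \<nu> u * \<nu> (du u)) v" by (simp add: s2.scale_sum_left)
    also have "(\<Sum>u\<in>U0. \<nu> u * \<nu> (du u)) = \<nu> (tv \<nu>)"
      unfolding tv_def using \<nu> du_U0_t t_subspace by (subst D_sum) (auto simp: D_scale intro!: subspace_scale)
    finally show ?thesis .
  qed
  \<comment> \<open>Here \<open>u\<close> raises and \<open>du u\<close> lowers. Exchanging them
    costs \<open>br u (du u) = tv (wt u)\<close>, and these brackets add up to the term with
    2\<rho>.\<close>
  moreover have "(\<Sum>u\<in>Up. \<phi> u (\<phi> (du u) v)) - s2 (\<nu> (tv two_rho)) v \<in> S"
  proof -
    have "\<nu> (tv two_rho) = (\<Sum>u\<in>Up. \<nu> (tv (wt u)))"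
      using ip_sym[OF \<nu> two_rho_D] ip_sym[OF \<nu>] wt by (auto simp: two_rho_def Up_def intro!: sum.cong)
    then have "(\<Sum>u\<in>Up. \<phi> u (\<phi> (du u) v)) - s2 (\<nu> (tv two_rho)) v = (\<Sum>u\<in>Up. \<phi> (du u) (\<phi> u v))"
    proof -
      have "\<phi> u (\<phi> (du u) v) = \<phi> (du u) (\<phi> u v) + s2 (\<nu> (tv (wt u))) v" if "u \<in> Up" for u
      proof -
        have u: "u \<in> U" using that by (auto simp: Up_def)
        have "br u (du u) = tv (wt u)"
          using br_opposite[of "wt u" u "du u"] wt[OF u] du_R[OF u] B_du[OF u u] by simp
        then show ?thesis using comm[of u "du u"] UnL[OF u] wtv(1)[OF tv_t] by simp
      qed
      then have "(\<Sum>u\<in>Up. \<phi> u (\<phi> (du u) v)) = (\<Sum>u\<in>Up. \<phi> (du u) (\<phi> u v)) + (\<Sum>u\<in>Up. s2 (\<nu> (tv (wt u))) v)"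
        by (simp add: sum.distrib)
      with \<open>\<nu> (tv two_rho) = _\<close> show ?thesis by (simp add: s2.scale_sum_left)
    qed
    moreover have "(\<Sum>u\<in>Up. \<phi> (du u) (\<phi> u v)) \<in> S"
    proof (rule s2.subspace_sum[OF S])
      fix u assume "u \<in> Up"
      then show "\<phi> (du u) (\<phi> u v) \<in> S" using sing wt UnL \<phi>S by (auto simp: Up_def)
    qed
    ultimately show ?thesis by simp
  qed
  moreover have "a + b + c - s2 (\<nu> (tv \<nu>) + \<nu> (tv two_rho)) v \<in> S"
    if "a = s2 (\<nu> (tv \<nu>)) v" "b - s2 (\<nu> (tv two_rho)) v \<in> S" "c \<in> S" for a b c
    using s2.subspace_add[OF S that(2,3)] that(1) by (simp add: s2.scale_left_distrib algebra_simps)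
  ultimately show ?thesis by simp
qed

text \<open>Twice the dual Coxeter number: the Casimir eigenvalue (\<theta>, \<theta> + 2\<rho>) of
  the adjoint representation, with (\<theta>, \<theta>) = 2.\<close>

definition "dual_coxeter2 = 2 + two_rho (tv \<theta>)"

lemma dual_coxeter2_pos: "dual_coxeter2 > 0"
proof -
  have "two_rho (tv \<theta>) > 0" by (rule positive_on_positive_roots[OF two_rho_D two_rho_simple theta_positive])
  then show ?thesis by (simp add: dual_coxeter2_def less_complex_def)
qed

lemma theta_norm: "\<theta> (tv \<theta>) = 2"
  using norm_2 dual_form_tv[OF theta_D theta_D] by simp

text \<open>The Casimir operator commutes with \<open>ad L\<close>, so its eigenspace for this value
  is an ideal. It contains the vectors of weight \<open>\<theta>\<close>, which are singular in the
  adjoint representation, and simplicity makes it all of \<open>L\<close>.\<close>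

lemma adjoint_casimir:
  assumes "x \<in> L" shows "(\<Sum>u\<in>U. br u (br (du u) x)) = sc dual_coxeter2 x"
proof -
  let ?C = "\<lambda>x. \<Sum>u\<in>U. br u (br (du u) x)"
  let ?I = "{x \<in> L. ?C x = sc dual_coxeter2 x}"
  have Ug: "u \<in> U \<Longrightarrow> u \<in> g \<and> du u \<in> g" for u using dp.U_g dp.du_g by blast
  have C_comm: "?C (br z x) = br z (?C x)" if z: "z \<in> L" and x: "x \<in> L" for z x
  proof -
    have "br z (?C x) = (\<Sum>u\<in>U. br (br z u) (br (du u) x) + br u (br z (br (du u) x)))"
      using z x Ug L_g' by (auto simp: br_r.sum intro!: sum.cong jacobi br_closed)
    also have "\<dots> = (\<Sum>u\<in>U. br (br z u) (br (du u) x)) + (\<Sum>u\<in>U. br u (br (br z (du u)) x)) + ?C (br z x)"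
      using z x Ug L_g' jacobi[of z _ x] by (auto simp: sum.distrib br_r.add)
    also have "(\<Sum>u\<in>U. br (br z u) (br (du u) x)) = - (\<Sum>u\<in>U. br u (br (br z (du u)) x))"
    proof (rule dp.dual_invariant[OF _ _ z])
      show "Vector_Spaces.linear sc sc (\<lambda>a. br a (br y x))" for y by (rule lin_br_l)
      show "Vector_Spaces.linear sc sc (\<lambda>y. br a (br y x))" for a
        by unfold_locales (simp_all add: br_l.add br_r.add br_l.scale br_r.scale)
    qed
    finally show ?thesis by simp
  qed
  have "lie_ideal sc br L ?I"
    unfolding lie_ideal_def
  proof (intro conjI ballI)
    show "subspace ?I"
      using L_subspace by (auto intro!: subspaceI simp: subspace_0 subspace_add subspace_scale br_r.add
          br_r.scale scale_right_distrib sum.distrib scale_left_commute simp flip: scale_sum_right)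
    show "br x y \<in> ?I" if "x \<in> L" "y \<in> ?I" for x y
      using that C_comm L_closed by (auto simp: br_r.scale)
  qed auto
  moreover have "?I \<noteq> {0}"
  proof -
    obtain e where e: "e \<in> R \<theta>" "e \<noteq> 0" using root_R[OF theta_root] by blast
    have "?C e - sc (\<theta> (tv \<theta>) + \<theta> (tv two_rho)) e \<in> {0}"
    proof (rule casimir_singular[where \<phi> = br and ?s2.0 = sc])
      show "br x (br y e) = br y (br x e) + br (br x y) e" if "x \<in> L" "y \<in> L" for x y
        using jacobi[of x y e] that L_g' R_L[OF e(1)] by simp
    qed (use theta_top[OF _ _ e(1)] R_br[OF e(1)] theta_D vector_space_axioms in \<open>auto simp: br_r.add br_r.scale\<close>)
    then have "?C e = sc dual_coxeter2 e"
      using theta_norm ip_sym[OF theta_D two_rho_D] by (simp add: dual_coxeter2_def)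
    then show ?thesis using e R_L by blast
  qed
  ultimately have "?I = L" using L_simple unfolding simple_lie_algebra_def by blast
  then show ?thesis using assms by blast
qed

end

section \<open>The Sugawara operator\<close>

text \<open>\<open>E x n\<close> is the action of \<open>x \<otimes> t^n\<close> and
  \<open>k\<close> is the level. In \<open>smooth\<close> the bound depends on \<open>v\<close>
  alone, not on \<open>x\<close>; it makes the Sugawara sum finite on each vector.\<close>

locale loop_module = invariant_form sc Basis br B g + V: vector_space scV
  for sc :: "complex \<Rightarrow> 'g::ab_group_add \<Rightarrow> 'g" and Basis br B g
    and scV :: "complex \<Rightarrow> 'v::ab_group_add \<Rightarrow> 'v" +
  fixes E :: "'g \<Rightarrow> int \<Rightarrow> 'v \<Rightarrow> 'v" and k :: complex
  assumes lin_E: "Vector_Spaces.linear scV scV (E x n)"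
    and lin_E_l: "Vector_Spaces.linear sc scV (\<lambda>x. E x n v)"
    and E_comm: "x \<in> g \<Longrightarrow> y \<in> g \<Longrightarrow> E x m (E y n v) =
          E y n (E x m v) + E (br x y) (m + n) v + scV (if m + n = 0 then of_int m * B x y * k else 0) v"
    and smooth: "\<exists>N::nat. \<forall>x. \<forall>n > int N. E x n v = 0"
begin

sublocale E_r: Vector_Spaces.linear scV scV "E x n" for x n by (rule lin_E)
sublocale E_l: Vector_Spaces.linear sc scV "\<lambda>x. E x n v" for n v by (rule lin_E_l)

end

locale sugawara = dual_pair sc Basis br B g X U du + loop_module sc Basis br B g scV E k
  for sc :: "complex \<Rightarrow> 'g::ab_group_add \<Rightarrow> 'g" and Basis br B g X U du
    and scV :: "complex \<Rightarrow> 'v::ab_group_add \<Rightarrow> 'v" and E k +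
  fixes h2 :: complex
  assumes casimir: "x \<in> X \<Longrightarrow> (\<Sum>u\<in>U. br u (br (du u) x)) = sc h2 x"
begin

definition "A n v = (\<Sum>u\<in>U. E u (- n) (E (du u) n v))"
definition "bound v = (SOME N::nat. \<forall>x. \<forall>n > int N. E x n v = 0)"
text \<open>The normally ordered sum over all integers \<open>n\<close>, that is,
  \<open>2k + h2\<close> times the Virasoro operator \<open>L_0\<close> of the Sugawara
  construction. Normal ordering makes the modes \<open>n\<close> and \<open>- n\<close> contribute
  equally, whence the factor 2.\<close>

definition "T v = A 0 v + scV 2 (\<Sum>n=1..int (bound v). A n v)"

lemma bound: "n > int (bound v) \<Longrightarrow> E x n v = 0"
proof -
  have "\<forall>x. \<forall>n > int (bound v). E x n v = 0" unfolding bound_def by (rule someI_ex[OF smooth])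
  then show "n > int (bound v) \<Longrightarrow> E x n v = 0" by blast
qed

text \<open>Any cutoff beyond which all modes kill \<open>v\<close> will do, so that several vectors
  can share one.\<close>

lemma T_eq:
  assumes "\<And>u n. n > N \<Longrightarrow> E u n v = 0"
  shows "T v = A 0 v + scV 2 (\<Sum>n=1..N. A n v)"
proof -
  have "(\<Sum>n=1..int (bound v). A n v) = (\<Sum>n=1..max N (bound v). A n v)"
    by (rule sum.mono_neutral_left) (auto simp: A_def bound)
  also have "\<dots> = (\<Sum>n=1..N. A n v)"
    by (rule sum.mono_neutral_right) (auto simp: A_def assms)
  finally show ?thesis by (simp add: T_def)
qed

lemma lin_A: "Vector_Spaces.linear scV scV (A n)"
  unfolding A_def
  by unfold_locales (simp_all add: E_r.add sum.distrib E_r.scale V.scale_sum_right)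

sublocale A: Vector_Spaces.linear scV scV "A n" for n by (rule lin_A)

lemma lin_T: "Vector_Spaces.linear scV scV T"
proof unfold_locales
  fix v w c
  define N where "N = max (int (bound v)) (int (bound w))"
  have v: "E u n v = 0" and w: "E u n w = 0" if "n > N" for u n
    using that bound by (auto simp: N_def)
  have "T (v + w) = A 0 (v + w) + scV 2 (\<Sum>n=1..N. A n (v + w))"
    by (rule T_eq) (simp add: E_r.add v w)
  also have "\<dots> = T v + T w"
    using T_eq[of N v] T_eq[of N w] v w by (simp add: A.add sum.distrib V.scale_right_distrib)
  finally show "T (v + w) = T v + T w" .
  have "T (scV c v) = A 0 (scV c v) + scV 2 (\<Sum>n=1..N. A n (scV c v))"
    by (rule T_eq) (simp add: E_r.scale v)
  also have "\<dots> = scV c (T v)"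
    using T_eq[of N v] v by (simp add: A.scale V.scale_right_distrib V.scale_left_commute flip: V.scale_sum_right)
  finally show "T (scV c v) = scV c (T v)" .
qed

sublocale T: Vector_Spaces.linear scV scV T by (rule lin_T)

text \<open>The mixed case, for modes of the center against the operator of the simple algebra and
  conversely: brackets and central terms both vanish.\<close>

lemma T_commute_orthogonal:
  assumes x: "x \<in> g" and "\<And>y. y \<in> X \<Longrightarrow> br x y = 0" "\<And>y. y \<in> X \<Longrightarrow> B x y = 0"
  shows "E x m (T v) = T (E x m v)"
proof -
  have comm: "E x m (E y n w) = E y n (E x m w)" if "y \<in> X" for y n w
    using that assms X_sub E_comm[of x y m n w] by auto
  have A: "E x m (A n w) = A n (E x m w)" for n w
    using U_X du_X by (auto simp: A_def E_r.sum comm intro!: sum.cong)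
  define N where "N = max (int (bound v)) (int (bound (E x m v)))"
  have "T v = A 0 v + scV 2 (\<Sum>n=1..N. A n v)" by (rule T_eq) (simp add: N_def bound)
  moreover have "T (E x m v) = A 0 (E x m v) + scV 2 (\<Sum>n=1..N. A n (E x m v))"
    by (rule T_eq) (simp add: N_def bound)
  ultimately show ?thesis by (simp add: E_r.add E_r.scale E_r.sum A)
qed

context
  fixes x :: 'g and m :: int and v :: 'v
  assumes x: "x \<in> X"
begin

text \<open>What remains of the commutator of \<open>x(m)\<close> with \<open>A n\<close> when
  \<open>x\<close> hits the left factor. With index \<open>n + m\<close> and a minus sign it also
  describes the right factor, which makes the sum over \<open>n\<close> telescope.\<close>

definition "c n = (\<Sum>u\<in>U. E (br x u) (m - n) (E (du u) n v))"

lemma lin_E_E: "Vector_Spaces.linear sc scV (\<lambda>a. E a p (E b q w))"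
  "Vector_Spaces.linear sc scV (\<lambda>b. E a p (E b q w))"
  by (rule lin_E_l) (unfold_locales, simp_all add: E_l.add E_r.add E_l.scale E_r.scale)

text \<open>The Leibniz rule. \<open>dual_invariant\<close> turns the brackets with
  \<open>du u\<close> into \<open>- c (n + m)\<close>; the central terms survive only for
  \<open>n = m\<close> and \<open>n = - m\<close> and sum back to \<open>x(m)\<close> by the two
  expansions of \<open>x\<close>.\<close>

lemma commute_A:
  "E x m (A n v) - A n (E x m v) = c n - c (n + m) +
     scV ((if m = n then of_int m * k else 0) + (if m = - n then of_int m * k else 0)) (E x m v)"
proof -
  have xg: "x \<in> g" by (rule subsetD[OF X_sub x])
  have "E x m (E u (- n) (E (du u) n v)) = E u (- n) (E (du u) n (E x m v))
      + E u (- n) (E (br x (du u)) (n + m) v)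
      + scV (if m = - n then of_int m * k else 0) (scV (B x (du u)) (E u m v))
      + E (br x u) (m - n) (E (du u) n v)
      + scV (if m = n then of_int m * k else 0) (scV (B x u) (E (du u) m v))" if "u \<in> U" for u
  proof -
    have "scV (if m + - n = 0 then of_int m * B x u * k else 0) (E (du u) n v)
        = scV (if m = n then of_int m * k else 0) (scV (B x u) (E (du u) m v))"
    proof (cases "m = n")
      case True
      have "of_int m * B x u * k = of_int m * k * B x u" by (rule mult.commute[THEN trans], unfold mult.assoc, rule mult.left_commute)
      then show ?thesis unfolding True by (simp only: add.right_inverse refl if_True V.scale_scale)
    next
      case False
      then have "m + - n \<noteq> 0" by simp
      with False show ?thesis by (simp only: if_False V.scale_zero_left)
    qed
    moreover have "E u (- n) (scV (if m + n = 0 then of_int m * B x (du u) * k else 0) v)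
        = scV (if m = - n then of_int m * k else 0) (scV (B x (du u)) (E u m v))"
    proof (cases "m = - n")
      case True
      have "of_int m * B x (du u) * k = of_int m * k * B x (du u)" by (rule mult.commute[THEN trans], unfold mult.assoc, rule mult.left_commute)
      then show ?thesis unfolding True by (simp only: add.left_inverse refl if_True V.scale_scale E_r.scale)
    next
      case False
      then have "m + n \<noteq> 0" by simp
      with False show ?thesis by (simp only: if_False V.scale_zero_left E_r.zero)
    qed
    ultimately show ?thesis
      using E_comm[OF xg U_g[OF that], of m "- n" "E (du u) n v"] E_comm[OF xg du_g[OF that], of m n v]
      by (simp add: E_r.add add.commute[of m n] add.assoc)
  qed
  then have "E x m (A n v) = A n (E x m v)
      + (\<Sum>u\<in>U. E u (- n) (E (br x (du u)) (n + m) v))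
      + scV (if m = - n then of_int m * k else 0) (\<Sum>u\<in>U. scV (B x (du u)) (E u m v))
      + c n
      + scV (if m = n then of_int m * k else 0) (\<Sum>u\<in>U. scV (B x u) (E (du u) m v))"
    by (simp add: A_def c_def E_r.sum sum.distrib V.scale_sum_right)
  also have "(\<Sum>u\<in>U. scV (B x (du u)) (E u m v)) = E x m v"
    using arg_cong[OF expand_U[OF x], of "\<lambda>x. E x m v"] by (simp add: E_l.sum E_l.scale)
  also have "(\<Sum>u\<in>U. scV (B x u) (E (du u) m v)) = E x m v"
    using arg_cong[OF expand_du[OF x], of "\<lambda>x. E x m v"] by (simp add: E_l.sum E_l.scale)
  also have "(\<Sum>u\<in>U. E u (- n) (E (br x (du u)) (n + m) v)) = - c (n + m)"
    using dual_invariant[OF lin_E_E(1) lin_E_E(2) x, of "- n" "n + m" v] by (simp add: c_def)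
  finally show ?thesis by (simp add: V.scale_left_distrib algebra_simps)
qed

text \<open>Exchanging the two factors of \<open>c (m - n)\<close> returns \<open>- c n\<close> and
  a commutator. Its bracket part is the Casimir operator applied to \<open>x\<close>; its central
  part vanishes, because the sum of \<open>br (du u) u\<close> equals its own negative by symmetry
  of the tensor and skewness.\<close>

lemma c_reflect: "c n + c (m - n) = scV h2 (E x m v)"
proof -
  have xg: "x \<in> g" by (rule subsetD[OF X_sub x])
  have lin_br_br: "Vector_Spaces.linear sc sc (\<lambda>b. br a (br b z))" for a z
    by unfold_locales (simp_all add: br_l.add br_r.add br_l.scale br_r.scale)
  have "c (m - n) = - (\<Sum>u\<in>U. E u n (E (br x (du u)) (m - n) v))"
    using dual_invariant[OF lin_E_E(1) lin_E_E(2) x, of n "m - n" v] by (simp add: c_def)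
  also have "(\<Sum>u\<in>U. E u n (E (br x (du u)) (m - n) v)) = (\<Sum>u\<in>U. E (du u) n (E (br x u) (m - n) v))"
    by (rule dual_flip[where \<beta> = "\<lambda>a b. E a n (E (br x b) (m - n) v)" and ?s2.0 = scV], rule lin_E_l)
       (unfold_locales, simp_all add: E_l.add E_r.add E_l.scale E_r.scale br_r.add br_r.scale)
  also have "\<dots> = (\<Sum>u\<in>U. E (br x u) (m - n) (E (du u) n v) + E (br (du u) (br x u)) m v
      + scV (if m = 0 then of_int n * B (du u) (br x u) * k else 0) v)"
    using E_comm[OF du_g br_closed[OF xg U_g]] by (intro sum.cong) auto
  also have "\<dots> = c n + E (\<Sum>u\<in>U. br (du u) (br x u)) m v
      + scV (if m = 0 then of_int n * (\<Sum>u\<in>U. B (du u) (br x u)) * k else 0) v"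
    by (simp add: sum.distrib c_def E_l.sum V.scale_sum_left sum_distrib_left sum_distrib_right)
  also have "(\<Sum>u\<in>U. br (du u) (br x u)) = - sc h2 x"
  proof -
    have "(\<Sum>u\<in>U. br (du u) (br x u)) = (\<Sum>u\<in>U. - br (du u) (br u x))"
    proof (rule sum.cong)
      fix u assume "u \<in> U"
      then have "br x u = - br u x" using xg U_g by (intro br_skew)
      then show "br (du u) (br x u) = - br (du u) (br u x)" by (simp add: br_r.neg)
    qed simp
    also have "\<dots> = - (\<Sum>u\<in>U. br (du u) (br u x))" by (simp add: sum_negf)
    also have "(\<Sum>u\<in>U. br (du u) (br u x)) = (\<Sum>u\<in>U. br u (br (du u) x))"
      using dual_flip[where \<beta> = "\<lambda>a b. br a (br b x)" and ?s2.0 = sc, OF lin_br_l lin_br_br] by simp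
    finally show ?thesis using casimir[OF x] by simp
  qed
  also have "(\<Sum>u\<in>U. B (du u) (br x u)) = 0"
  proof -
    have flip: "(\<Sum>u\<in>U. br u (du u)) = (\<Sum>u\<in>U. br (du u) u)"
      by (rule dual_flip[where \<beta> = br and ?s2.0 = sc, OF lin_br_l lin_br_r])
    also have "\<dots> = - (\<Sum>u\<in>U. br u (du u))"
      unfolding sum_negf[symmetric] using U_g du_g by (intro sum.cong br_skew) auto
    finally have "sc 2 (\<Sum>u\<in>U. br u (du u)) = 0"
      using scale_left_distrib[of 1 1 "\<Sum>u\<in>U. br u (du u)"] by (metis add.right_inverse one_add_one scale_one)
    then have 0: "(\<Sum>u\<in>U. br (du u) u) = 0" using flip by simp
    have "(\<Sum>u\<in>U. B (du u) (br x u)) = (\<Sum>u\<in>U. - B (br (du u) u) x)"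
    proof (rule sum.cong)
      fix u assume "u \<in> U"
      then have "br x u = - br u x" using xg U_g by (intro br_skew)
      then show "B (du u) (br x u) = - B (br (du u) u) x" by (simp add: B_r.neg B_inv)
    qed simp
    also have "\<dots> = - B (\<Sum>u\<in>U. br (du u) u) x" by (simp add: sum_negf B_l.sum)
    finally show ?thesis using 0 by simp
  qed
  finally show ?thesis by (simp add: E_l.neg E_l.scale)
qed

text \<open>The telescoped sums leave \<open>|m|\<close> terms \<open>c n\<close>. Doubled and
  combined with the contribution \<open>c 0 - c m\<close> of mode 0 they form pairs
  \<open>c n + c (m - n)\<close>, each worth \<open>h2\<close>; the central terms give
  \<open>2 k\<close>.\<close>

lemma commute_T: "E x m (T v) = T (E x m v) + scV (of_int m * (2 * k + h2)) (E x m v)"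
proof -
  \<comment> \<open>The extra \<open>|m|\<close> lets the shifted sum be cut off at the same
    \<open>N\<close>, and puts \<open>m\<close> or \<open>- m\<close> into the range of summation
    when \<open>m\<close> is not 0.\<close>
  define N where "N = int (bound v) + int (bound (E x m v)) + \<bar>m\<bar>"
  have c0: "c n = 0" if "n > N - \<bar>m\<bar>" for n
    unfolding c_def using that by (auto simp: N_def bound intro!: sum.neutral)
  have "T v = A 0 v + scV 2 (\<Sum>n=1..N. A n v)" by (rule T_eq) (simp add: N_def bound)
  moreover have "T (E x m v) = A 0 (E x m v) + scV 2 (\<Sum>n=1..N. A n (E x m v))"
    by (rule T_eq) (simp add: N_def bound)
  ultimately have "E x m (T v) - T (E x m v) = (E x m (A 0 v) - A 0 (E x m v))
      + scV 2 (\<Sum>n=1..N. E x m (A n v) - A n (E x m v))"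
    by (simp add: E_r.add E_r.scale E_r.sum sum_subtractf V.scale_right_diff_distrib)
  also have "\<dots> = (c 0 - c m) + scV 2 ((\<Sum>n=1..N. c n) - (\<Sum>n=1..N. c (n + m))) + scV 2
      (scV (\<Sum>n=1..N. (if m = n then of_int m * k else 0) + (if m = - n then of_int m * k else 0)) (E x m v))"
  proof -
    have "E x m (A 0 v) - A 0 (E x m v) = c 0 - c m"
      unfolding commute_A by (cases "m = 0") simp_all
    moreover have "(\<Sum>n=1..N. c n - c (n + m) + scV (d n) w) = (\<Sum>n=1..N. c n) - (\<Sum>n=1..N. c (n + m)) + scV (\<Sum>n=1..N. d n) w"
      for d w by (simp only: sum.distrib sum_subtractf V.scale_sum_left)
    ultimately show ?thesis by (simp only: commute_A V.scale_right_distrib add.assoc)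
  qed
  also have "(\<Sum>n=1..N. (if m = n then of_int m * k else 0) + (if m = - n then of_int m * k else 0)) = of_int m * k"
  proof -
    have "(\<Sum>n=1..N. if m = - n then of_int m * k else 0) = (\<Sum>n=1..N. if n = - m then of_int m * k else 0)"
      by (intro sum.cong) auto
    then have "(\<Sum>n=1..N. (if m = n then of_int m * k else 0) + (if m = - n then of_int m * k else 0))
      = (if m \<in> {1..N} then of_int m * k else 0) + (if - m \<in> {1..N} then of_int m * k else 0)"
      by (simp add: sum.distrib)
    then show ?thesis by (auto simp: N_def)
  qed
  also have "(c 0 - c m) + scV 2 ((\<Sum>n=1..N. c n) - (\<Sum>n=1..N. c (n + m))) = scV (of_int m * h2) (E x m v)"
  proof -
    have shift: "(\<Sum>n=1..N. c (n + m)) = (\<Sum>n=1+m..N+m. c n)"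
      by (rule sum.reindex_bij_witness[of _ "\<lambda>n. n - m" "\<lambda>n. n + m"]) auto
    have two: "scV 2 w = w + w" for w using V.scale_left_distrib[of 1 1 w] by simp
    have reflect: "(\<Sum>n\<in>I. c n) + (\<Sum>n\<in>I. c (m - n)) = scV (of_nat (card I)) (scV h2 (E x m v))" for I
      by (simp only: sum.distrib[symmetric] c_reflect V.sum_constant_scale)
    show ?thesis
    proof (cases "m \<ge> 0")
      case True
      have "(\<Sum>n=1+m..N+m. c n) = (\<Sum>n=1+m..N. c n)"
        using True c0 by (intro sum.mono_neutral_right) (auto simp: N_def)
      moreover have "(\<Sum>n=1..N. c n) = (\<Sum>n=1..m. c n) + (\<Sum>n=1+m..N. c n)"
        using True by (subst sum.union_disjoint[symmetric]) (auto simp: N_def intro!: sum.cong)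
      ultimately have d: "(\<Sum>n=1..N. c n) - (\<Sum>n=1..N. c (n + m)) = (\<Sum>n=1..m. c n)" using shift by simp
      have "(\<Sum>n=1..m. c (m - n)) = (\<Sum>n=0..m-1. c n)"
        by (rule sum.reindex_bij_witness[of _ "\<lambda>n. m - n" "\<lambda>n. m - n"]) auto
      moreover have "c 0 + (\<Sum>n=1..m. c n) = (\<Sum>n=0..m-1. c n) + c m"
      proof -
        have "{0..m} = insert 0 {1..m}" using True by auto
        then have "(\<Sum>n=0..m. c n) = c 0 + (\<Sum>n=1..m. c n)" by simp
        moreover have "{0..m} = insert m {0..m-1}" using True by auto
        then have "(\<Sum>n=0..m. c n) = c m + (\<Sum>n=0..m-1. c n)" by simp
        ultimately have "c 0 + (\<Sum>n=1..m. c n) = c m + (\<Sum>n=0..m-1. c n)" by simp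
        then show ?thesis by (simp add: add.commute)
      qed
      \<comment> \<open>One of the two copies of the sum from 1 to \<open>m\<close> absorbs
        \<open>c 0 - c m\<close> and becomes the sum from 0 to \<open>m - 1\<close>, which is the
        reflected sum.\<close>
      ultimately have "c 0 - c m + scV 2 (\<Sum>n=1..m. c n) = (\<Sum>n=1..m. c n) + (\<Sum>n=1..m. c (m - n))"
        unfolding two by (simp add: algebra_simps)
      then show ?thesis using True unfolding d reflect by simp
    next
      case False
      have "(\<Sum>n=1+m..N+m. c n) = (\<Sum>n=1+m..N. c n)"
        using False c0 by (intro sum.mono_neutral_left) (auto simp: N_def)
      moreover have "(\<Sum>n=1+m..N. c n) = (\<Sum>n=1+m..0. c n) + (\<Sum>n=1..N. c n)"
        using False by (subst sum.union_disjoint[symmetric]) (auto simp: N_def intro!: sum.cong)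
      ultimately have d: "(\<Sum>n=1..N. c n) - (\<Sum>n=1..N. c (n + m)) = - (\<Sum>n=1+m..0. c n)" using shift by simp
      have "(\<Sum>n=1+m..0. c (m - n)) = (\<Sum>n=m..-1. c n)"
        by (rule sum.reindex_bij_witness[of _ "\<lambda>n. m - n" "\<lambda>n. m - n"]) auto
      moreover have "c m + (\<Sum>n=1+m..0. c n) = (\<Sum>n=m..-1. c n) + c 0"
      proof -
        have "{m..0} = insert m {1+m..0}" using False by auto
        then have "(\<Sum>n=m..0. c n) = c m + (\<Sum>n=1+m..0. c n)" by simp
        moreover have "{m..0} = insert 0 {m..-1}" using False by auto
        then have "(\<Sum>n=m..0. c n) = c 0 + (\<Sum>n=m..-1. c n)" by simp
        ultimately have "c m + (\<Sum>n=1+m..0. c n) = c 0 + (\<Sum>n=m..-1. c n)" by simp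
        then show ?thesis by (simp add: add.commute)
      qed
      ultimately have "c 0 - c m + scV 2 (- (\<Sum>n=1+m..0. c n)) = - ((\<Sum>n=1+m..0. c n) + (\<Sum>n=1+m..0. c (m - n)))"
        unfolding two by (simp add: algebra_simps)
      then show ?thesis using False unfolding d reflect by simp
    qed
  qed
  also have "scV (of_int m * h2) (E x m v) + scV 2 (scV (of_int m * k) (E x m v))
      = scV (of_int m * h2 + 2 * (of_int m * k)) (E x m v)"
    by (simp only: V.scale_scale V.scale_left_distrib)
  also have "of_int m * h2 + 2 * (of_int m * k) = of_int m * (2 * k + h2)"
    by (simp only: distrib_left mult.left_commute[of 2] add.commute[of "of_int m * h2"])
  finally show ?thesis by (simp only: diff_eq_eq add.commute)
qed

end

end

section \<open>Integrable modules of the even affine algebra\<close>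

text \<open>Modulo \<open>S\<close> the operator \<open>e\<close> maps \<open>f^(n+1) v\<close> to
  \<open>(n+1)(\<mu> - n)\<close> times \<open>f^n v\<close>. At the first power that falls into
  \<open>S\<close> this factor has to vanish. Working modulo \<open>S\<close> makes integrality
  available for vectors that are singular only in a quotient.\<close>

lemma sl2_lowest_power:
  fixes scale :: "complex \<Rightarrow> 'b::ab_group_add \<Rightarrow> 'b"
  assumes vs: "vector_space scale" and e: "Vector_Spaces.linear scale scale e" and f: "Vector_Spaces.linear scale scale f"
    and h: "Vector_Spaces.linear scale scale h"
    and ef: "\<And>w. e (f w) = f (e w) + h w" and hf: "\<And>w. h (f w) = f (h w) - scale 2 (f w)"
    and S: "module.subspace scale S" "e ` S \<subseteq> S" "f ` S \<subseteq> S"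
    and v: "v \<notin> S" "e v \<in> S" "h v = scale \<mu> v" "(f ^^ N) v = 0"
  shows "\<exists>m::nat. \<mu> = of_nat m"
proof -
  interpret vector_space scale by (rule vs)
  interpret e: Vector_Spaces.linear scale scale e by (rule e)
  interpret f: Vector_Spaces.linear scale scale f by (rule f)
  interpret h: Vector_Spaces.linear scale scale h by (rule h)
  have hn: "h ((f ^^ n) v) = scale (\<mu> - 2 * of_nat n) ((f ^^ n) v)" for n
  proof (induction n)
    case 0
    then show ?case by (simp add: v)
  next
    case (Suc n)
    have "h ((f ^^ Suc n) v) = scale (\<mu> - 2 * of_nat n) (f ((f ^^ n) v)) - scale 2 (f ((f ^^ n) v))"
      by (simp only: funpow.simps o_apply hf Suc f.scale)
    also have "\<dots> = scale (\<mu> - 2 * of_nat n - 2) (f ((f ^^ n) v))"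
      by (simp only: scale_left_diff_distrib)
    also have "\<mu> - 2 * of_nat n - 2 = \<mu> - 2 * of_nat (Suc n)" by simp
    finally show ?case by simp
  qed
  have en: "e ((f ^^ Suc n) v) - scale (of_nat (Suc n) * (\<mu> - of_nat n)) ((f ^^ n) v) \<in> S" for n
  proof (induction n)
    case 0
    then show ?case using v S by (auto simp: ef image_subset_iff)
  next
    case (Suc n)
    have "e ((f ^^ Suc (Suc n)) v) = f (e ((f ^^ Suc n) v)) + scale (\<mu> - 2 * of_nat (Suc n)) ((f ^^ Suc n) v)"
      using ef[of "(f ^^ Suc n) v"] hn[of "Suc n"] by simp
    then have "e ((f ^^ Suc (Suc n)) v) - scale (of_nat (Suc (Suc n)) * (\<mu> - of_nat (Suc n))) ((f ^^ Suc n) v)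
      = f (e ((f ^^ Suc n) v)) + scale ((\<mu> - 2 * of_nat (Suc n)) - of_nat (Suc (Suc n)) * (\<mu> - of_nat (Suc n))) ((f ^^ Suc n) v)"
      by (simp only: scale_left_diff_distrib add_diff_eq)
    also have "(\<mu> - 2 * of_nat (Suc n)) - of_nat (Suc (Suc n)) * (\<mu> - of_nat (Suc n)) = - (of_nat (Suc n) * (\<mu> - of_nat n))"
      by (simp add: algebra_simps)
    also have "f (e ((f ^^ Suc n) v)) + scale (- (of_nat (Suc n) * (\<mu> - of_nat n))) ((f ^^ Suc n) v)
      = f (e ((f ^^ Suc n) v) - scale (of_nat (Suc n) * (\<mu> - of_nat n)) ((f ^^ n) v))"
      by (simp add: f.diff f.scale)
    finally show ?case using Suc S(3) by auto
  qed
  define n where "n = (LEAST n. (f ^^ n) v \<in> S)"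
  have "(f ^^ N) v \<in> S" using v(4) subspace_0[OF S(1)] by simp
  then have n: "(f ^^ n) v \<in> S" unfolding n_def by (rule LeastI)
  then obtain m where m: "n = Suc m" using v(1) by (cases n) auto
  then have nm: "(f ^^ m) v \<notin> S" using not_less_Least[of m "\<lambda>n. (f ^^ n) v \<in> S"] n_def by simp
  have "e ((f ^^ Suc m) v) \<in> S" using n m S(2) by blast
  then have "scale (of_nat (Suc m) * (\<mu> - of_nat m)) ((f ^^ m) v) \<in> S"
    using subspace_diff[OF S(1) _ en[of m]] by fastforce
  then have "scale (inverse (of_nat (Suc m) * (\<mu> - of_nat m))) (scale (of_nat (Suc m) * (\<mu> - of_nat m)) ((f ^^ m) v)) \<in> S"
    by (rule subspace_scale[OF S(1)])
  moreover have "scale (inverse r) (scale r w) = w" if "r \<noteq> 0" for r w using that by simp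
  ultimately have "of_nat (Suc m) * (\<mu> - of_nat m) = 0" using nm by metis
  then show ?thesis by (metis eq_iff_diff_eq_0 mult_eq_0_iff of_nat_neq_0)
qed

text \<open>All that remains of the superalgebra: the action of its even affine part, with finite
  dimensional weight spaces, nilpotent root vectors, finite dimensional \<open>L\<close>-orbits and
  degrees in \<open>a0\<close> minus the natural numbers.\<close>

locale even_module = split_simple sc Basis br B g L t \<Pi> \<theta> + loop_module sc Basis br B g scV E "of_nat lev"
  for sc :: "complex \<Rightarrow> 'g::ab_group_add \<Rightarrow> 'g" and Basis br B g L t \<Pi> \<theta>
    and scV :: "complex \<Rightarrow> 'v::ab_group_add \<Rightarrow> 'v" and E and lev :: nat +
  fixes H :: "'g set" and dd :: "'v \<Rightarrow> 'v"
  assumes H_subspace: "subspace H" and H_g: "H \<subseteq> g"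
    and H_central: "x \<in> H \<Longrightarrow> y \<in> g \<Longrightarrow> br x y = 0"
    and g_decomp: "x \<in> g \<Longrightarrow> \<exists>a\<in>L. \<exists>b\<in>H. x = a + b"
    and L_H: "L \<inter> H = {0}"
    and B_L_H: "x \<in> L \<Longrightarrow> y \<in> H \<Longrightarrow> B x y = 0"
    and H_nondeg: "y \<in> H \<Longrightarrow> (\<And>x. x \<in> H \<Longrightarrow> B x y = 0) \<Longrightarrow> y = 0"
    and lin_dd: "Vector_Spaces.linear scV scV dd"
    and dd_E: "dd (E x n v) = E x n (dd v) + scV (of_int n) (E x n v)"
    and lev_pos: "lev > 0"
    and dd_bounded: "\<exists>a0. \<forall>v a. v \<noteq> 0 \<longrightarrow> dd v = scV a v \<longrightarrow> (\<exists>j::nat. a = a0 - of_nat j)"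
    and L_finite: "\<exists>T. finite T \<and> (\<forall>xs. set xs \<subseteq> L \<longrightarrow> foldr (\<lambda>x. E x 0) xs v \<in> V.span T)"
    and simple_nilpotent: "\<beta> \<in> \<Pi> \<Longrightarrow> (e, f) \<in> chevalley_pairs sc br t L \<beta> \<Longrightarrow> locally_nilpotent (E f 0)"
    and theta_nilpotent: "(e, f) \<in> chevalley_pairs sc br t L \<theta> \<Longrightarrow> locally_nilpotent (E e (- 1))"
    and weight_decomposition:
      "v \<in> V.span (\<Union>(\<nu>, a)\<in>{\<nu>. \<forall>y. y \<notin> t \<union> H \<longrightarrow> \<nu> y = 0} \<times> UNIV.
              {w. (\<forall>y\<in>t \<union> H. E y 0 w = scV (\<nu> y) w) \<and> dd w = scV a w})"
    and weight_finite:
      "\<exists>T. finite T \<and> {w. (\<forall>y\<in>t \<union> H. E y 0 w = scV (\<nu> y) w) \<and> dd w = scV a w} \<subseteq> V.span T"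
begin

section \<open>Weights, submodules and singular vectors\<close>

sublocale dd: Vector_Spaces.linear scV scV dd by (rule lin_dd)

text \<open>Weights are stored as functions vanishing off \<open>t \<union> H\<close>. Roots vanish off \<open>t\<close>, so that
  shifting a weight by a root is pointwise addition. The affine weight \<open>\<nu> + a \<delta>\<close> is the pair \<open>(\<nu>, a)\<close>;
  \<open>rv \<alpha>\<close> consists of the vectors \<open>x\<close> for which \<open>x \<otimes> t\<^sup>n\<close> has weight \<open>\<alpha> + n \<delta>\<close>, and \<open>ap \<alpha> n\<close> says that
  \<open>\<alpha> + n \<delta>\<close> is a positive affine root.\<close>

definition "Fn = {\<nu> :: 'g \<Rightarrow> complex. \<forall>y. y \<notin> t \<union> H \<longrightarrow> \<nu> y = 0}"
definition "W i = {w. (\<forall>y\<in>t \<union> H. E y 0 w = scV (fst i y) w) \<and> dd w = scV (snd i) w}"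
definition "rt \<nu> = (\<lambda>y. if y \<in> t then \<nu> y else 0)"
definition "sub S \<longleftrightarrow> V.subspace S \<and> (\<forall>x\<in>g. \<forall>n. \<forall>w\<in>S. E x n w \<in> S) \<and> (\<forall>w\<in>S. dd w \<in> S)"
definition "rv \<alpha> = R \<alpha> \<union> (if \<alpha> = (\<lambda>_. 0) then H else {})"
definition "ap \<alpha> n \<longleftrightarrow> (\<alpha> \<in> \<Delta> \<or> \<alpha> = (\<lambda>_. 0)) \<and> 0 < n \<or> \<alpha> \<in> positive_roots \<Delta> \<Pi> \<and> n = (0::int)"

lemma W_subspace: "V.subspace (W i)"
  unfolding W_def by (auto intro!: V.subspaceI simp: E_r.add E_r.scale dd.add dd.scale
      V.scale_right_distrib V.scale_left_commute)

lemma W_spanning: "v \<in> V.span (\<Union>i\<in>Fn \<times> UNIV. W i)"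
proof -
  have "(\<Union>(\<nu>, a)\<in>{\<nu>. \<forall>y. y \<notin> t \<union> H \<longrightarrow> \<nu> y = 0} \<times> UNIV.
              {w. (\<forall>y\<in>t \<union> H. E y 0 w = scV (\<nu> y) w) \<and> dd w = scV a w}) = (\<Union>i\<in>Fn \<times> UNIV. W i)"
    unfolding Fn_def W_def by (auto simp: case_prod_beta)
  then show ?thesis using weight_decomposition[of v] by simp
qed

lemma W_finite: "\<exists>T. finite T \<and> W i \<subseteq> V.span T"
  using weight_finite[of "fst i" "snd i"] unfolding W_def .

lemma W_E: "w \<in> W i \<Longrightarrow> y \<in> t \<union> H \<Longrightarrow> E y 0 w = scV (fst i y) w"
  and W_dd: "w \<in> W i \<Longrightarrow> dd w = scV (snd i) w"
  by (auto simp: W_def)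

lemma rv_g: "x \<in> rv \<alpha> \<Longrightarrow> x \<in> g"
  using R_L L_g' H_g by (auto simp: rv_def split: if_splits)

lemma t_g2: "y \<in> t \<union> H \<Longrightarrow> y \<in> g"
  using t_g H_g by auto

lemma br_g_H: "x \<in> g \<Longrightarrow> y \<in> H \<Longrightarrow> br x y = 0"
  using br_skew[of x y] H_central[of y x] H_g by auto

lemma D_0: assumes "\<alpha> \<in> D" shows "\<alpha> 0 = 0"
proof -
  have "\<alpha> (sc 0 0) = 0 * \<alpha> 0" using assms subspace_0[OF t_subspace] by (intro D_scale)
  then show ?thesis by simp
qed

lemma D_H: assumes "\<alpha> \<in> D" "y \<in> H" shows "\<alpha> y = 0"
proof (cases "y \<in> t")
  case True
  then have "y = 0" using L_H t_L assms by blast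
  then show ?thesis using D_0 assms by simp
qed (use D_off assms in blast)

lemma rv_br: assumes "x \<in> rv \<alpha>" "\<alpha> \<in> D" "y \<in> t \<union> H" shows "br y x = sc (\<alpha> y) x"
proof (cases "x \<in> R \<alpha>")
  case True
  then show ?thesis
    using assms R_br[OF True, of y] H_central[of y x] rv_g[OF assms(1)] D_H[OF assms(2), of y] by auto
next
  case False
  then have x: "x \<in> H" "\<alpha> = (\<lambda>_. 0)" using assms by (auto simp: rv_def split: if_splits)
  then show ?thesis using br_g_H[OF t_g2[OF assms(3)] x(1)] by simp
qed

lemma E0_E: "x \<in> g \<Longrightarrow> y \<in> g \<Longrightarrow> E x 0 (E y n v) = E y n (E x 0 v) + E (br x y) n v"
  using E_comm[of x y 0 n v] by simp

lemma W_shift: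
  assumes "w \<in> W (\<nu>, a)" "x \<in> rv \<alpha>" "\<alpha> \<in> D"
  shows "E x n w \<in> W (\<lambda>y. \<nu> y + \<alpha> y, a + of_int n)"
proof -
  have "E y 0 (E x n w) = scV (\<nu> y + \<alpha> y) (E x n w)" if y: "y \<in> t \<union> H" for y
    using E0_E[OF t_g2[OF y] rv_g[OF assms(2)], of n w] rv_br[OF assms(2,3) y] W_E[OF assms(1) y]
    by (simp add: E_l.scale E_r.scale V.scale_left_distrib)
  moreover have "dd (E x n w) = scV (a + of_int n) (E x n w)"
    using W_dd[OF assms(1)] by (simp add: dd_E E_r.scale V.scale_left_distrib)
  ultimately show ?thesis by (simp add: W_def)
qed

lemma Fn_shift: "\<nu> \<in> Fn \<Longrightarrow> \<alpha> \<in> D \<Longrightarrow> (\<lambda>y. \<nu> y + \<alpha> y) \<in> Fn"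
  using D_off by (auto simp: Fn_def)

lemma ap_D: "ap \<alpha> n \<Longrightarrow> \<alpha> \<in> D"
  using roots_D positive_root dual_space_0 by (auto simp: ap_def)

lemma W_sep:
  assumes "i \<in> Fn \<times> UNIV" "j \<in> Fn \<times> UNIV" "i \<noteq> j"
  shows "\<exists>P c. ((\<exists>y\<in>t \<union> H. P = E y 0) \<or> P = dd) \<and> (\<forall>k\<in>Fn \<times> UNIV. \<forall>w\<in>W k. P w = scV (c k) w) \<and> c i \<noteq> c j"
proof (cases "snd i = snd j")
  case False
  then show ?thesis using W_dd by (intro exI[of _ dd] exI[of _ snd]) auto
next
  case True
  then have "fst i \<noteq> fst j" using assms(3) by (simp add: prod_eq_iff)
  then obtain y where y: "fst i y \<noteq> fst j y" by (auto simp: fun_eq_iff)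
  have "y \<in> t \<union> H"
  proof (rule ccontr)
    assume "y \<notin> t \<union> H"
    then have "fst i y = 0" "fst j y = 0" using assms(1,2) unfolding Fn_def mem_Times_iff by blast+
    then show False using y by simp
  qed
  then show ?thesis using y W_E by (intro exI[of _ "E y 0"] exI[of _ "\<lambda>i. fst i y"]) auto
qed

lemma W_independent:
  assumes "i \<in> Fn \<times> UNIV" "w \<in> W i" "w \<in> V.span (\<Union>j\<in>Fn \<times> UNIV - {i}. W j)" shows "w = 0"
proof (rule V.eigen_independent[OF _ W_subspace assms])
  fix i j assume ij: "i \<in> Fn \<times> (UNIV :: complex set)" "j \<in> Fn \<times> (UNIV :: complex set)" "i \<noteq> j"
  show "\<exists>P c. Vector_Spaces.linear scV scV P \<and> (\<forall>k\<in>Fn \<times> UNIV. \<forall>w\<in>W k. P w = scV (c k) w) \<and> c i \<noteq> c j"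
    using W_sep[OF ij] lin_E lin_dd by blast
qed

lemma sub_weight_vector:
  assumes S: "sub S" "w \<in> S" "w \<noteq> 0"
  shows "\<exists>i\<in>Fn \<times> UNIV. \<exists>u\<in>W i. u \<in> S \<and> u \<noteq> 0"
proof -
  obtain J f where J: "finite J" "J \<subseteq> Fn \<times> UNIV" "\<forall>i\<in>J. f i \<in> W i" "w = (\<Sum>i\<in>J. f i)"
    using V.span_UN_subspaces[OF W_subspace W_spanning[of w]] by blast
  have "\<exists>i\<in>J. f i \<noteq> 0" using J(4) S(3) by (auto intro: sum.neutral)
  then obtain i where i: "i \<in> J" "f i \<noteq> 0" by blast
  have "f i \<in> S"
  proof (rule V.eigen_component_in[OF J(1,2) _ _ W_subspace])
    show "V.subspace S" using S by (simp add: sub_def)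
    fix i j assume ij: "i \<in> Fn \<times> (UNIV :: complex set)" "j \<in> Fn \<times> (UNIV :: complex set)" "i \<noteq> j"
    obtain P c where P: "(\<exists>y\<in>t \<union> H. P = E y 0) \<or> P = dd" "\<forall>k\<in>Fn \<times> UNIV. \<forall>w\<in>W k. P w = scV (c k) w" "c i \<noteq> c j"
      using W_sep[OF ij] by blast
    have "P ` S \<subseteq> S" using P(1) S(1) t_g2 unfolding sub_def by blast
    moreover have "Vector_Spaces.linear scV scV P" using P(1) lin_E lin_dd by blast
    ultimately show "\<exists>P c. Vector_Spaces.linear scV scV P \<and> P ` S \<subseteq> S \<and> (\<forall>k\<in>Fn \<times> UNIV. \<forall>w\<in>W k. P w = scV (c k) w) \<and> c i \<noteq> c j"
      using P by blast
  qed (use J i S in auto)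
  then show ?thesis using J i by blast
qed

text \<open>Functions in \<open>Fn\<close> are arbitrary on \<open>t\<close>. A nonzero weight
  vector forces linearity, since it determines the eigenvalues of \<open>y + z\<close> and
  \<open>sc c y\<close>.\<close>

lemma rt_D:
  assumes "w \<in> W (\<nu>, a)" "w \<noteq> 0" shows "rt \<nu> \<in> D"
proof -
  have inj: "scV a w = scV b w \<Longrightarrow> a = b" for a b using assms(2) by simp
  have "\<nu> (y + z) = \<nu> y + \<nu> z" if "y \<in> t" "z \<in> t" for y z
    using that W_E[OF assms(1), of y] W_E[OF assms(1), of z] W_E[OF assms(1), of "y + z"]
      subspace_add[OF t_subspace that]
    by (intro inj) (simp add: E_l.add V.scale_left_distrib)
  moreover have "\<nu> (sc c y) = c * \<nu> y" if "y \<in> t" for c y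
    using that W_E[OF assms(1), of y] W_E[OF assms(1), of "sc c y"]
      subspace_scale[OF t_subspace that, of c]
    by (intro inj) (auto simp add: E_l.scale)
  ultimately show ?thesis
    using subspace_add[OF t_subspace] subspace_scale[OF t_subspace] subspace_0[OF t_subspace]
    unfolding dual_space_def mem_Collect_eq by (intro conjI ballI allI impI) (simp_all add: rt_def)
qed

lemma rt_shift: "\<alpha> \<in> D \<Longrightarrow> rt (\<lambda>y. \<nu> y + \<alpha> y) = (\<lambda>y. rt \<nu> y + \<alpha> y)"
  using D_off by (auto simp: rt_def)

lemma rt_t: "y \<in> t \<Longrightarrow> rt \<nu> y = \<nu> y"
  by (simp add: rt_def)

inductive cone :: "('g \<Rightarrow> complex) \<Rightarrow> int \<Rightarrow> bool" where
  cone_0: "cone (\<lambda>_. 0) 0"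
| cone_step: "cone \<gamma> m \<Longrightarrow> ap \<alpha> n \<Longrightarrow> cone (\<lambda>y. \<gamma> y + \<alpha> y) (m + n)"

text \<open>Sums of at least one positive affine root, where imaginary roots, with
  \<open>\<alpha> = 0\<close> and \<open>n > 0\<close>, count as positive.\<close>

definition "scone \<gamma> m \<longleftrightarrow> (\<exists>\<gamma>' m' \<alpha> n. cone \<gamma>' m' \<and> ap \<alpha> n \<and> \<gamma> = (\<lambda>y. \<gamma>' y + \<alpha> y) \<and> m = m' + n)"

lemma cone_D: "cone \<gamma> m \<Longrightarrow> \<gamma> \<in> D"
  by (induction rule: cone.induct) (auto intro: dual_space_0 dual_space_add ap_D)

lemma scone_cone: "scone \<gamma> m \<Longrightarrow> cone \<gamma> m"
  by (auto simp: scone_def intro: cone_step)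

definition "sing S v i \<longleftrightarrow> i \<in> Fn \<times> UNIV \<and> v \<in> W i \<and> v \<notin> S \<and> (\<forall>\<alpha> n. \<forall>x\<in>rv \<alpha>. ap \<alpha> n \<longrightarrow> E x n v \<in> S)"

lemma sub_0: "sub {0}"
  by (simp add: sub_def V.subspace_single_0)

lemma L_in_span_R: "x \<in> L \<Longrightarrow> x \<in> span (\<Union>\<alpha>\<in>insert (\<lambda>_. 0) \<Delta>. R \<alpha>)"
proof -
  assume x: "x \<in> L"
  have "(\<Union>\<alpha>\<in>D. R \<alpha>) \<subseteq> insert 0 (\<Union>\<alpha>\<in>insert (\<lambda>_. 0) \<Delta>. R \<alpha>)"
    using rootI by fastforce
  then have "span (\<Union>\<alpha>\<in>D. R \<alpha>) \<subseteq> span (\<Union>\<alpha>\<in>insert (\<lambda>_. 0) \<Delta>. R \<alpha>)"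
    by (metis span_insert_0 span_mono)
  then show ?thesis using t_diagonal[OF x] by blast
qed

lemma g_induct:
  assumes S: "V.subspace S" and x: "x \<in> g"
    and R: "\<And>\<alpha> x. \<alpha> \<in> insert (\<lambda>_. 0) \<Delta> \<Longrightarrow> x \<in> rv \<alpha> \<Longrightarrow> E x n v \<in> S"
  shows "E x n v \<in> S"
proof -
  obtain a b where ab: "a \<in> L" "b \<in> H" "x = a + b" using g_decomp[OF x] by blast
  have "E a n v \<in> S"
    by (rule linear_on_span_in[OF lin_E_l S L_in_span_R[OF ab(1)]]) (use R in \<open>auto simp: rv_def\<close>)
  moreover have "E b n v \<in> S" using R[of "\<lambda>_. 0" b] ab(2) by (simp add: rv_def)
  ultimately show ?thesis unfolding ab(3) E_l.add by (rule V.subspace_add[OF S])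
qed

lemma sing_raise:
  assumes "sub S" "sing S v i" "x \<in> g" "n > 0" shows "E x n v \<in> S"
proof (rule g_induct[OF _ assms(3)])
  show "V.subspace S" using assms by (simp add: sub_def)
  show "E x n v \<in> S" if "\<alpha> \<in> insert (\<lambda>_. 0) \<Delta>" "x \<in> rv \<alpha>" for \<alpha> x
    using assms(2,4) that unfolding sing_def ap_def by blast
qed

section \<open>The corrected degree operator and its scalars\<close>

sublocale SL: sugawara sc Basis br B g L U du scV E "of_nat lev" dual_coxeter2
  by unfold_locales (rule adjoint_casimir)

lemma H_dual_pair: "\<exists>p. dual_pair sc Basis br B g H (fst p) (snd p)"
proof -
  obtain UH where UH: "UH \<subseteq> H" "independent UH" "H \<subseteq> span UH" using basis_exists by metis
  have "br x y \<in> H" if "x \<in> H" "y \<in> H" for x y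
    using H_central[OF that(1), of y] that H_g subspace_0[OF H_subspace] by auto
  then show ?thesis using dual_pair_exists[OF H_subspace H_g _ H_nondeg UH] by (metis fst_conv snd_conv)
qed

definition "UH = fst (SOME p. dual_pair sc Basis br B g H (fst p) (snd p))"
definition "duH = snd (SOME p. dual_pair sc Basis br B g H (fst p) (snd p))"

sublocale SH: sugawara sc Basis br B g H UH duH scV E "of_nat lev" 0
proof -
  interpret dual_pair sc Basis br B g H UH duH
    unfolding UH_def duH_def by (rule someI_ex[OF H_dual_pair])
  show "sugawara sc Basis br B g H UH duH scV E (of_nat lev) 0"
  proof unfold_locales
    fix x assume "x \<in> H"
    then have "br u (br (duH u) x) = 0" if "u \<in> UH" for u
      using br_g_H du_g that by simp
    then show "(\<Sum>u\<in>UH. br u (br (duH u) x)) = sc 0 x" by simp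
  qed
qed

definition "kL = 2 * of_nat lev + dual_coxeter2"
definition "kH = 2 * (of_nat lev :: complex)"

text \<open>On modes of \<open>L\<close> the second term cancels the commutator with
  \<open>dd\<close>, on modes of \<open>H\<close> the third, and each commutes with the modes of the
  other summand. The divisors are the factors \<open>2k + h2\<close> of \<open>commute_T\<close>,
  with \<open>h2 = 0\<close> on the center; both are nonzero at positive level.\<close>

definition "Om v = dd v + scV (1 / kL) (SL.T v) + scV (1 / kH) (SH.T v)"

lemma kL_pos: "kL > 0" and kH_pos: "kH > 0"
  using dual_coxeter2_pos lev_pos by (auto simp: kL_def kH_def less_complex_def)

lemma lin_Om: "Vector_Spaces.linear scV scV Om"
  unfolding Om_def
  by unfold_locales (simp_all add: dd.add SL.T.add SH.T.add dd.scale SL.T.scale SH.T.scale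
      V.scale_right_distrib V.scale_left_commute)

sublocale Om: Vector_Spaces.linear scV scV Om by (rule lin_Om)

lemma Om_E:
  assumes x: "x \<in> g" shows "E x n (Om v) = Om (E x n v)"
proof -
  have dd: "E x n (dd v) = dd (E x n v) - scV (of_int n) (E x n v)" for x by (simp add: dd_E)
  have L: "E x n (Om v) = Om (E x n v)" if x: "x \<in> L" for x
  proof -
    have "E x n (SH.T v) = SH.T (E x n v)"
      using x L_g' br_g_H B_L_H by (intro SH.T_commute_orthogonal) auto
    moreover have "scV (1 / kL) (scV (of_int n * kL) (E x n v)) = scV (of_int n) (E x n v)"
      using kL_pos by simp
    moreover have "E x n (SL.T v) = SL.T (E x n v) + scV (of_int n * kL) (E x n v)"
      using SL.commute_T[OF x] by (simp add: kL_def)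
    ultimately show ?thesis
      unfolding Om_def E_r.add E_r.scale dd by (simp add: V.scale_right_distrib del: V.scale_scale)
  qed
  have H: "E x n (Om v) = Om (E x n v)" if x: "x \<in> H" for x
  proof -
    have "B x y = 0" if "y \<in> L" for y
      using B_L_H[OF that x] B_sym[of x y] that x L_g' H_g by auto
    then have "E x n (SL.T v) = SL.T (E x n v)"
      using x L_g' H_g H_central by (intro SL.T_commute_orthogonal) auto
    moreover have "scV (1 / kH) (scV (of_int n * kH) (E x n v)) = scV (of_int n) (E x n v)"
      using kH_pos by simp
    moreover have "E x n (SH.T v) = SH.T (E x n v) + scV (of_int n * kH) (E x n v)"
      using SH.commute_T[OF x] by (simp add: kH_def)
    ultimately show ?thesis
      unfolding Om_def E_r.add E_r.scale dd by (simp add: V.scale_right_distrib del: V.scale_scale)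
  qed
  obtain a b where "a \<in> L" "b \<in> H" "x = a + b" using g_decomp[OF x] by blast
  then show ?thesis using L[of a] H[of b] by (simp add: E_l.add Om.add)
qed

text \<open>Each \<open>A n\<close> has degree 0, because the shifts by \<open>n\<close> and
  \<open>- n\<close> of its two factors cancel.\<close>

lemma dd_T:
  assumes "sugawara sc Basis br B g X U' du' scV E (of_nat lev) h"
  shows "dd (sugawara.T U' du' scV E v) = sugawara.T U' du' scV E (dd v)"
proof -
  interpret S: sugawara sc Basis br B g X U' du' scV E "of_nat lev" h by (rule assms)
  have A: "dd (S.A n w) = S.A n (dd w)" for n w
    by (simp add: S.A_def dd.sum dd_E E_r.add E_r.scale)
  define N where "N = int (S.bound v)"
  have v: "E u n v = 0" if "n > N" for u n using that S.bound by (simp add: N_def)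
  have dv: "E u n (dd v) = 0" if "n > N" for u n using dd_E[of u n v] v[OF that] by simp
  have "S.T v = S.A 0 v + scV 2 (\<Sum>n=1..N. S.A n v)" by (rule S.T_eq) (rule v)
  moreover have "S.T (dd v) = S.A 0 (dd v) + scV 2 (\<Sum>n=1..N. S.A n (dd v))" by (rule S.T_eq) (rule dv)
  ultimately show ?thesis by (simp only: dd.add dd.scale dd.sum A)
qed

lemma Om_dd: "dd (Om v) = Om (dd v)"
  using dd_T[OF SL.sugawara_axioms] dd_T[OF SH.sugawara_axioms]
  by (simp add: Om_def dd.add dd.scale)

lemma Om_W: "w \<in> W i \<Longrightarrow> Om w \<in> W i"
  using Om_E[OF t_g2] Om_dd by (auto simp: W_def Om.scale)

text \<open>For trivial \<open>H\<close> this is the eigenvalue of the affine Casimir operator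
  divided by \<open>kL\<close>. The last term is the analogous quantity of the center, where no
  2\<rho> occurs.\<close>

definition "cs i = snd i + (rt (fst i) (tv (rt (fst i))) + rt (fst i) (tv two_rho)) / kL
    + (\<Sum>u\<in>UH. fst i u * fst i (duH u)) / kH"

text \<open>Positive modes send \<open>v\<close> into \<open>S\<close>, so only zero modes
  contribute: \<open>casimir_singular\<close> evaluates those of \<open>L\<close>, and those of
  \<open>H\<close> act on \<open>v\<close> by scalars.\<close>

lemma sing_Om:
  assumes S: "sub S" and v: "sing S v i" shows "Om v - scV (cs i) v \<in> S"
proof -
  obtain \<nu> a where i: "i = (\<nu>, a)" by (cases i)
  have Ssub: "V.subspace S" using S by (simp add: sub_def)
  have vW: "v \<in> W (\<nu>, a)" and nz: "v \<noteq> 0" using v V.subspace_0[OF Ssub] by (auto simp: sing_def i)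
  have hi: "E u n w \<in> S" if "u \<in> g" "w \<in> S" for u n w using that S by (simp add: sub_def)
  have high: "scV 2 (\<Sum>n=1..N. \<Sum>u\<in>U'. E u (- n) (E (du' u) n v)) \<in> S"
    if "\<And>u. u \<in> U' \<Longrightarrow> u \<in> g \<and> du' u \<in> g" for U' du' and N :: int
    using that by (intro V.subspace_scale[OF Ssub] V.subspace_sum[OF Ssub] hi sing_raise[OF S v]) auto
  have L0: "SL.A 0 v - scV (rt \<nu> (tv (rt \<nu>)) + rt \<nu> (tv two_rho)) v \<in> S"
  proof -
    have "(\<Sum>u\<in>U. E u 0 (E (du u) 0 v)) - scV (rt \<nu> (tv (rt \<nu>)) + rt \<nu> (tv two_rho)) v \<in> S"
    proof (rule casimir_singular[where \<phi> = "\<lambda>x. E x 0" and ?s2.0 = scV])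
      show "E x 0 (w + y) = E x 0 w + E x 0 y" for x y w by (rule E_r.add)
      show "E x 0 (E y 0 v) = E y 0 (E x 0 v) + E (br x y) 0 v" if "x \<in> L" "y \<in> L" for x y
        using E0_E[of x y 0 v] that L_g' by simp
      show "E x 0 v \<in> S" if "\<alpha> \<in> positive_roots \<Delta> \<Pi>" "x \<in> R \<alpha>" for \<alpha> x
        using v that unfolding sing_def ap_def rv_def by blast
      show "E y 0 v = scV (rt \<nu> y) v" if "y \<in> t" for y
        using W_E[OF vW, of y] that by (simp add: rt_t)
    qed (use Ssub hi L_g' rt_D[OF vW nz] V.vector_space_axioms in \<open>auto simp: E_r.scale\<close>)
    then show ?thesis by (simp add: SL.A_def)
  qed
  have H0: "SH.A 0 v = scV (\<Sum>u\<in>UH. \<nu> u * \<nu> (duH u)) v"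
  proof -
    have "E u 0 (E (duH u) 0 v) = scV (\<nu> u * \<nu> (duH u)) v" if "u \<in> UH" for u
      using W_E[OF vW, of u] W_E[OF vW, of "duH u"] SH.U_X SH.du_X[OF that] that
      by (auto simp: E_r.scale mult.commute)
    then show ?thesis by (simp add: SH.A_def V.scale_sum_left)
  qed
  have TL: "SL.T v - scV (rt \<nu> (tv (rt \<nu>)) + rt \<nu> (tv two_rho)) v \<in> S"
    using V.subspace_add[OF Ssub L0 high[of U du "int (SL.bound v)"]] dp.U_g dp.du_g
    by (simp add: SL.T_def SL.A_def algebra_simps)
  have TH: "SH.T v - scV (\<Sum>u\<in>UH. \<nu> u * \<nu> (duH u)) v \<in> S"
    using high[of UH duH "int (SH.bound v)"] SH.U_g SH.du_g H0
    by (simp add: SH.T_def SH.A_def)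
  have split: "Om v - scV (cs i) v = scV (1 / kL) (SL.T v - scV (rt \<nu> (tv (rt \<nu>)) + rt \<nu> (tv two_rho)) v)
      + scV (1 / kH) (SH.T v - scV (\<Sum>u\<in>UH. \<nu> u * \<nu> (duH u)) v)"
    using W_dd[OF vW]
    by (simp add: Om_def cs_def i V.scale_left_distrib V.scale_right_diff_distrib add_divide_distrib algebra_simps)
  show ?thesis unfolding split
    by (intro V.subspace_add[OF Ssub] V.subspace_scale[OF Ssub] TL TH)
qed

section \<open>Dominance and the comparison of scalars\<close>

lemma br_tv_neg: assumes "x \<in> R (\<lambda>y. - \<alpha> y)" shows "br (tv \<nu>) x = sc (- \<alpha> (tv \<nu>)) x"
  using R_br[OF assms tv_t] by simp

text \<open>Nilpotency of the lowering operator feeds \<open>sl2_lowest_power\<close>, for the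
  triple of each simple root and for the affine triple of \<open>f \<otimes> t\<close> and
  \<open>e \<otimes> t^-1\<close>, with \<open>e\<close> and \<open>f\<close> of weights
  \<open>\<theta>\<close> and \<open>- \<theta>\<close>.\<close>

lemma sing_dominant:
  assumes S: "sub S" and v: "sing S v (\<nu>, a)"
  shows "\<beta> \<in> \<Pi> \<Longrightarrow> \<nu> (tv \<beta>) \<ge> 0" and "\<nu> (tv \<theta>) \<le> of_nat lev"
proof -
  have Ssub: "V.subspace S" and SE: "x \<in> g \<Longrightarrow> E x n ` S \<subseteq> S" for x n using S by (auto simp: sub_def)
  have vW: "v \<in> W (\<nu>, a)" and nS: "v \<notin> S" using v by (auto simp: sing_def)
  show "\<nu> (tv \<beta>) \<ge> 0" if \<beta>: "\<beta> \<in> \<Pi>"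
  proof -
    have \<beta>R: "\<beta> \<in> \<Delta>" and \<beta>D: "\<beta> \<in> D" using simple_root[OF \<beta>] roots_D by auto
    obtain e where e: "e \<in> U" "wt e = \<beta>" using root_ex_U[OF \<beta>R] by blast
    \<comment> \<open>The scaling required by \<open>chevalley_pairs\<close>: it makes
      \<open>br e f\<close> the coroot, on which \<open>\<beta>\<close> has the value 2. For
      \<open>\<theta>\<close> the factor is 1.\<close>
    define r where "r = 2 / \<beta> (tv \<beta>)"
    define f where "f = sc r (du e)"
    have \<beta>\<beta>: "\<beta> (tv \<beta>) > 0" by (rule ip_pos[OF \<beta>R])
    then have r\<beta>: "r * \<beta> (tv \<beta>) = 2" by (auto simp: r_def)
    have eR: "e \<in> R \<beta>" using wt[OF e(1)] e(2) by simp
    have fR: "f \<in> R (\<lambda>y. - \<beta> y)" unfolding f_def using du_R[OF e(1)] e(2) by (intro subspace_scale[OF R_subspace]) simp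
    have ef: "br e f = sc r (tv \<beta>)"
      using br_opposite[OF \<beta>D eR fR] B_du[OF e(1) e(1)] by (simp add: f_def B_r.scale)
    have pair: "(e, f) \<in> chevalley_pairs sc br t L \<beta>"
      using eR fR U_nz[OF e(1)] ef R_br[OF eR tv_t] r\<beta> by (simp add: chevalley_pairs_def br_l.scale)
    have gg: "e \<in> g" "f \<in> g" using eR fR R_L L_g' by blast+
    obtain N where N: "(E f 0 ^^ N) v = 0" using simple_nilpotent[OF \<beta> pair] unfolding locally_nilpotent_def by blast
    have "\<exists>m::nat. r * \<nu> (tv \<beta>) = of_nat m"
    proof (rule sl2_lowest_power[OF V.vector_space_axioms lin_E lin_E lin_E _ _ Ssub SE[OF gg(1)] SE[OF gg(2)] nS _ _ N])
      show "E e 0 (E f 0 w) = E f 0 (E e 0 w) + E (br e f) 0 w" for w using E0_E[OF gg] .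
      show "E (br e f) 0 (E f 0 w) = E f 0 (E (br e f) 0 w) - scV 2 (E f 0 w)" for w
      proof -
        have "br (br e f) f = sc (- 2) f" using br_tv_neg[OF fR] r\<beta> by (simp add: ef br_l.scale)
        then show ?thesis using E0_E[OF br_closed[OF gg] gg(2), of 0 w] by (simp add: E_l.scale E_l.neg)
      qed
      show "E e 0 v \<in> S" using v eR \<beta> \<beta>R nat_comb_simple[OF \<beta>] unfolding sing_def ap_def rv_def positive_roots_def by blast
      show "E (br e f) 0 v = scV (r * \<nu> (tv \<beta>)) v" using W_E[OF vW, of "tv \<beta>"] tv_t by (simp add: ef E_l.scale)
    qed
    then obtain m :: nat where "r * \<nu> (tv \<beta>) = of_nat m" by blast
    then have "\<nu> (tv \<beta>) = of_nat m * (\<beta> (tv \<beta>) / 2)" using r\<beta> \<beta>\<beta> by (auto simp: r_def field_simps)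
    moreover have "0 \<le> of_nat m * (\<beta> (tv \<beta>) / 2)" using \<beta>\<beta> by (auto simp: less_complex_def less_eq_complex_def)
    ultimately show ?thesis by (simp only:)
  qed
  show "\<nu> (tv \<theta>) \<le> of_nat lev"
  proof -
    obtain e where e: "e \<in> U" "wt e = \<theta>" using root_ex_U[OF theta_root] by blast
    define f where "f = du e"
    have eR: "e \<in> R \<theta>" using wt[OF e(1)] e(2) by simp
    have fR: "f \<in> R (\<lambda>y. - \<theta> y)" unfolding f_def using du_R[OF e(1)] e(2) by simp
    have Bef: "B e f = 1" using B_du[OF e(1) e(1)] by (simp add: f_def)
    have ef: "br e f = tv \<theta>" using br_opposite[OF theta_D eR fR] Bef by simp
    have pair: "(e, f) \<in> chevalley_pairs sc br t L \<theta>"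
      using eR fR U_nz[OF e(1)] ef R_br[OF eR tv_t] theta_norm by (simp add: chevalley_pairs_def)
    have gg: "e \<in> g" "f \<in> g" using eR fR R_L L_g' by blast+
    have fe: "br f e = - tv \<theta>" using br_skew[OF gg(2,1)] ef by simp
    obtain N where N: "(E e (- 1) ^^ N) v = 0" using theta_nilpotent[OF pair] unfolding locally_nilpotent_def by blast
    \<comment> \<open>The affine coroot \<open>K - tv \<theta>\<close>, which is the bracket of
      \<open>f \<otimes> t\<close> and \<open>e \<otimes> t^-1\<close> as
      \<open>B e f = 1\<close>.\<close>
    let ?h = "\<lambda>w. scV (of_nat lev) w - E (tv \<theta>) 0 w"
    have "\<exists>m::nat. of_nat lev - \<nu> (tv \<theta>) = of_nat m"
    proof (rule sl2_lowest_power[OF V.vector_space_axioms lin_E lin_E _ _ _ Ssub SE[OF gg(2)] SE[OF gg(1)] nS _ _ N])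
      show "Vector_Spaces.linear scV scV ?h"
        by unfold_locales (simp_all add: V.scale_right_distrib E_r.add E_r.scale V.scale_right_diff_distrib V.scale_left_commute)
      show "E f 1 (E e (- 1) w) = E e (- 1) (E f 1 w) + ?h w" for w
        using E_comm[OF gg(2,1), of 1 "-1" w] fe Bef B_sym[OF gg] by (simp add: E_l.neg)
      show "?h (E e (- 1) w) = E e (- 1) (?h w) - scV 2 (E e (- 1) w)" for w
        using E0_E[OF t_g[OF tv_t] gg(1), of \<theta> "- 1" w] R_br[OF eR tv_t, of \<theta>] theta_norm
        by (simp add: E_r.diff E_r.scale E_l.scale)
      have "(\<lambda>y. - \<theta> y) \<in> \<Delta>" by (rule neg_root[OF theta_root])
      then have "ap (\<lambda>y. - \<theta> y) 1" "f \<in> rv (\<lambda>y. - \<theta> y)" using fR by (simp_all add: ap_def rv_def)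
      then show "E f 1 v \<in> S" using v unfolding sing_def by blast
      show "?h v = scV (of_nat lev - \<nu> (tv \<theta>)) v" using W_E[OF vW, of "tv \<theta>"] tv_t by (simp add: V.scale_left_diff_distrib)
    qed
    then obtain m :: nat where m: "of_nat lev - \<nu> (tv \<theta>) = of_nat m" by blast
    then have "\<nu> (tv \<theta>) = of_nat lev - of_nat m" by (simp add: algebra_simps)
    then show ?thesis by (simp add: less_eq_complex_def)
  qed
qed

text \<open>Times \<open>kL\<close> the difference of the scalars is
  \<open>n kL + \<sigma> (tv \<gamma>)\<close>, where \<open>\<sigma>\<close> adds both weights and
  2\<rho>. This is the pairing of \<gamma> + n \<delta> with an affine weight of level
  \<open>kL\<close> that is positive on every positive affine root.\<close>

lemma sing_compare:
  assumes S: "sub S" "sing S v (\<nu>, a)" and S': "sub S'" "sing S' w (\<mu>, b)"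
    and eq: "\<nu> = (\<lambda>y. \<mu> y + \<gamma> y)" "a = b + of_int n" and c: "cs (\<nu>, a) = cs (\<mu>, b)"
  shows "\<not> scone \<gamma> n"
proof
  assume sc: "scone \<gamma> n"
  have vW: "v \<in> W (\<nu>, a)" "v \<noteq> 0" and wW: "w \<in> W (\<mu>, b)" "w \<noteq> 0"
    using assms V.subspace_0 by (auto simp: sing_def sub_def)
  have D\<nu>: "rt \<nu> \<in> D" and D\<mu>: "rt \<mu> \<in> D" using rt_D vW wW by blast+
  have \<gamma>D: "\<gamma> \<in> D" using cone_D scone_cone sc by blast
  define \<sigma> where "\<sigma> y = rt \<nu> y + rt \<mu> y + two_rho y" for y
  have \<sigma>D: "\<sigma> \<in> D" unfolding \<sigma>_def by (intro dual_space_add D\<nu> D\<mu> two_rho_D)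
  have \<sigma>\<beta>: "\<sigma> (tv \<beta>) > 0" if "\<beta> \<in> \<Pi>" for \<beta>
    using sing_dominant(1)[OF S that] sing_dominant(1)[OF S' that] two_rho_simple[OF that]
    by (simp add: \<sigma>_def rt_t tv_t less_complex_def less_eq_complex_def)
  \<comment> \<open>Both weights contribute at most the level, and \<open>kL\<close> exceeds the
    remaining bound by the summand 2 of \<open>dual_coxeter2\<close>. This is strict positivity on
    the affine simple root.\<close>
  have \<sigma>\<theta>: "\<sigma> (tv \<theta>) < kL"
    using sing_dominant(2)[OF S] sing_dominant(2)[OF S']
    by (simp add: \<sigma>_def rt_t tv_t kL_def dual_coxeter2_def less_complex_def less_eq_complex_def)
  have ap: "of_int k * kL + \<sigma> (tv \<alpha>) > 0" if "ap \<alpha> k" for \<alpha> k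
  proof (cases "k > 0")
    case False
    then have "\<alpha> \<in> positive_roots \<Delta> \<Pi>" "k = 0" using that by (auto simp: ap_def)
    then show ?thesis using positive_on_positive_roots[OF \<sigma>D \<sigma>\<beta>] by simp
  next
    case True
    have kk: "of_int k * kL \<ge> kL"
    proof -
      have "Re kL > 0" "Im kL = 0" using kL_pos by (auto simp: less_complex_def)
      moreover have "(1::real) \<le> of_int k" using True by linarith
      ultimately show ?thesis by (simp add: less_eq_complex_def)
    qed
    have "\<sigma> (tv \<alpha>) > - kL"
    proof (cases "\<alpha> = (\<lambda>_. 0)")
      case True
      then have "tv \<alpha> = 0" by (simp add: tv_def)
      then show ?thesis using D_0[OF \<sigma>D] kL_pos by simp
    next
      case False
      then have "\<alpha> \<in> \<Delta>" using that positive_root by (auto simp: ap_def)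
      \<comment> \<open>As \<open>- \<alpha>\<close> is a root, \<open>\<theta> + \<alpha>\<close>
        is a nonnegative combination of simple roots; hence \<open>\<sigma> (tv \<alpha>)\<close> is
        at least minus \<open>\<sigma> (tv \<theta>)\<close>.\<close>
      then obtain c where c: "\<theta> = (\<lambda>y. - \<alpha> y + nat_comb \<Pi> c y)" using theta_ge[OF neg_root] by blast
      then have "tv \<theta> = - tv \<alpha> + tv (nat_comb \<Pi> c)"
        using tv_add[OF dual_space_neg[OF roots_D[OF \<open>\<alpha> \<in> \<Delta>\<close>]] nat_comb_D[of c]] tv_neg[of \<alpha>] by simp
      then have "tv (nat_comb \<Pi> c) = tv \<theta> + tv \<alpha>" by simp
      moreover have "\<sigma> (tv \<theta> + tv \<alpha>) = \<sigma> (tv \<theta>) + \<sigma> (tv \<alpha>)"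
        using \<sigma>D tv_t unfolding dual_space_def by blast
      ultimately have "\<sigma> (tv \<theta>) + \<sigma> (tv \<alpha>) \<ge> 0" using positive_on_comb[OF \<sigma>D \<sigma>\<beta>, of c] by simp
      then show ?thesis using \<sigma>\<theta> by (simp add: less_complex_def less_eq_complex_def)
    qed
    moreover have "Im kL = 0" using kL_pos by (simp add: less_complex_def)
    ultimately show ?thesis using kk by (auto simp: less_complex_def less_eq_complex_def)
  qed
  have add: "of_int (m + k) * kL + \<sigma> (tv (\<lambda>y. \<delta> y + \<alpha> y)) = (of_int m * kL + \<sigma> (tv \<delta>)) + (of_int k * kL + \<sigma> (tv \<alpha>))"
    if "\<delta> \<in> D" "\<alpha> \<in> D" for \<delta> \<alpha> m k
  proof -
    have "\<sigma> (tv \<delta> + tv \<alpha>) = \<sigma> (tv \<delta>) + \<sigma> (tv \<alpha>)" using \<sigma>D tv_t unfolding dual_space_def by blast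
    then show ?thesis using tv_add[OF that] by (simp add: distrib_right)
  qed
  have cone: "of_int m * kL + \<sigma> (tv \<delta>) \<ge> 0" if "cone \<delta> m" for \<delta> m
    using that
  proof (induction rule: cone.induct)
    case cone_0
    have "tv (\<lambda>_. 0) = 0" by (simp add: tv_def)
    then show ?case using D_0[OF \<sigma>D] by simp
  next
    case (cone_step \<delta> m \<alpha> k)
    then show ?case using add[OF cone_D[OF cone_step(1)] ap_D[OF cone_step(2)], of m k] ap[OF cone_step(2)]
      by (simp add: add_nonneg_nonneg less_imp_le)
  qed
  obtain \<gamma>' m' \<alpha> k where d: "cone \<gamma>' m'" "ap \<alpha> k" "\<gamma> = (\<lambda>y. \<gamma>' y + \<alpha> y)" "n = m' + k"
    using sc unfolding scone_def by (elim exE conjE)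
  have pos: "of_int n * kL + \<sigma> (tv \<gamma>) > 0"
    using add[OF cone_D[OF d(1)] ap_D[OF d(2)], of m' k] cone[OF d(1)] ap[OF d(2)] d(3,4)
    by (simp add: less_complex_def less_eq_complex_def)
  have rt: "rt \<nu> = (\<lambda>y. rt \<mu> y + \<gamma> y)" unfolding eq(1) by (rule rt_shift[OF \<gamma>D])
  \<comment> \<open>\<open>\<gamma>\<close> vanishes on \<open>H\<close>, so the contributions of
    the center to both scalars agree.\<close>
  have \<nu>H: "\<nu> y = \<mu> y" if "y \<in> H" for y using D_H[OF \<gamma>D that] eq(1) by simp
  have "(\<Sum>u\<in>UH. \<nu> u * \<nu> (duH u)) = (\<Sum>u\<in>UH. \<mu> u * \<mu> (duH u))"
    using \<nu>H SH.U_X SH.du_X by (intro sum.cong) auto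
  then have "b + of_int n + (rt \<nu> (tv (rt \<nu>)) + rt \<nu> (tv two_rho)) / kL = b + (rt \<mu> (tv (rt \<mu>)) + rt \<mu> (tv two_rho)) / kL"
    using c eq(2) by (simp add: cs_def)
  moreover have "rt \<nu> (tv (rt \<nu>)) + rt \<nu> (tv two_rho) = rt \<mu> (tv (rt \<mu>)) + rt \<mu> (tv two_rho) + \<sigma> (tv \<gamma>)"
  proof -
    have "tv (rt \<nu>) = tv (rt \<mu>) + tv \<gamma>" unfolding rt by (rule tv_add[OF D\<mu> \<gamma>D])
    moreover have "rt \<nu> (tv (rt \<mu>) + tv \<gamma>) = rt \<nu> (tv (rt \<mu>)) + rt \<nu> (tv \<gamma>)"
      using D\<nu> tv_t unfolding dual_space_def by blast
    moreover have "rt \<nu> (tv (rt \<mu>)) = rt \<mu> (tv (rt \<mu>)) + rt \<mu> (tv \<gamma>)"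
      using ip_sym[OF \<gamma>D D\<mu>] by (simp add: rt)
    moreover have "rt \<nu> (tv two_rho) = rt \<mu> (tv two_rho) + two_rho (tv \<gamma>)"
      using ip_sym[OF \<gamma>D two_rho_D] by (simp add: rt)
    ultimately show ?thesis by (simp add: \<sigma>_def)
  qed
  ultimately have "of_int n + \<sigma> (tv \<gamma>) / kL = 0" by (simp add: add_divide_distrib)
  moreover have "kL \<noteq> 0" using kL_pos by auto
  ultimately have "of_int n * kL + \<sigma> (tv \<gamma>) = 0" by (simp add: field_simps)
  then show False using pos by simp
qed

section \<open>Raising to singular vectors\<close>

inductive reach :: "'v \<Rightarrow> ('g \<Rightarrow> complex) \<Rightarrow> int \<Rightarrow> 'v \<Rightarrow> bool" for u where
  reach_0: "reach u (\<lambda>_. 0) 0 u"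
| reach_step: "reach u \<gamma> m v \<Longrightarrow> ap \<alpha> n \<Longrightarrow> x \<in> rv \<alpha> \<Longrightarrow> reach u (\<lambda>y. \<gamma> y + \<alpha> y) (m + n) (E x n v)"

lemma reach_cone: "reach u \<gamma> n v \<Longrightarrow> cone \<gamma> n"
  by (induction rule: reach.induct) (auto intro: cone.intros)

lemma reach_W: "reach u \<gamma> n v \<Longrightarrow> u \<in> W (\<nu>, a) \<Longrightarrow> v \<in> W (\<lambda>y. \<nu> y + \<gamma> y, a + of_int n)"
proof (induction rule: reach.induct)
  case (reach_step \<gamma> m v \<alpha> n x)
  then show ?case using W_shift[OF _ reach_step(3) ap_D[OF reach_step(2)], of v "\<lambda>y. \<nu> y + \<gamma> y" "a + of_int m" n]
    by (simp add: add.assoc)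
qed simp

lemma reach_sub: "reach u \<gamma> n v \<Longrightarrow> sub N \<Longrightarrow> u \<in> N \<Longrightarrow> v \<in> N"
  by (induction rule: reach.induct) (auto simp: sub_def rv_g)

lemma ap_nonneg: "ap \<alpha> n \<Longrightarrow> n \<ge> 0"
  by (auto simp: ap_def)

lemma cone_Fn: "\<nu> \<in> Fn \<Longrightarrow> cone \<gamma> n \<Longrightarrow> (\<lambda>y. \<nu> y + \<gamma> y) \<in> Fn"
  using Fn_shift cone_D by blast

text \<open>Raising happens in two stages: first to the largest degree \<open>n\<close> reachable
  outside \<open>S\<close>, which exists by \<open>dd_bounded\<close>, then by positive roots of
  \<open>L\<close> inside a finite dimensional \<open>L\<close>-orbit.\<close>

lemma exists_sing:
  assumes S: "sub S" and u: "u \<in> W (\<nu>, a)" "\<nu> \<in> Fn" "u \<notin> S"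
  shows "\<exists>v \<gamma> n. reach u \<gamma> n v \<and> sing S v (\<lambda>y. \<nu> y + \<gamma> y, a + of_int n)"
proof -
  have S0: "0 \<in> S" using S V.subspace_0 by (simp add: sub_def)
  obtain a0 where a0: "\<And>v a. v \<noteq> 0 \<Longrightarrow> dd v = scV a v \<Longrightarrow> \<exists>j::nat. a = a0 - of_nat j"
    using dd_bounded by blast
  have u0: "u \<noteq> 0" using u S0 by auto
  obtain j0 :: nat where j0: "a = a0 - of_nat j0" using a0[OF u0 W_dd[OF u(1)]] by auto
  let ?M = "{n. \<exists>\<gamma> v. reach u \<gamma> n v \<and> v \<notin> S}"
  have le: "n \<le> int j0" if n: "n \<in> ?M" for n
  proof -
    obtain \<gamma> v where v: "reach u \<gamma> n v" "v \<notin> S" using n by blast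
    then have "v \<noteq> 0" using S0 by auto
    then obtain j :: nat where "a + of_int n = a0 - of_nat j"
      using a0 W_dd[OF reach_W[OF v(1) u(1)]] by fastforce
    then have "of_int n = (of_int (int j0 - int j) :: complex)" using j0 by (simp add: algebra_simps)
    then have "n = int j0 - int j" by (simp only: of_int_eq_iff)
    then show ?thesis by simp
  qed
  have M0: "0 \<in> ?M" using reach_0 u(3) by blast
  define n where "n = Max (?M \<inter> {0..})"
  have fin: "finite (?M \<inter> {0..})"
  proof (rule finite_subset)
    show "?M \<inter> {0..} \<subseteq> {0..int j0}"
    proof
      fix m assume m: "m \<in> ?M \<inter> {0..}"
      show "m \<in> {0..int j0}" using le[OF IntD1[OF m]] IntD2[OF m] by simp
    qed
  qed simp
  have nM: "n \<in> ?M \<inter> {0..}" unfolding n_def using fin M0 by (intro Max_in) auto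
  have nmax: "m \<le> n" if "m \<in> ?M" "m \<ge> 0" for m unfolding n_def using fin that by (intro Max_ge) auto
  obtain \<gamma>1 u' where u': "reach u \<gamma>1 n u'" "u' \<notin> S" using nM by blast
  obtain T where T: "finite T" "\<And>xs. set xs \<subseteq> L \<Longrightarrow> foldr (\<lambda>x. E x 0) xs u' \<in> V.span T"
    using L_finite[of u'] by blast
  \<comment> \<open>Every positive root is positive on \<open>tv two_rho\<close>. Endless raising in
    degree \<open>n\<close> would give nonzero eigenvectors of \<open>E z 0\<close> with strictly
    growing eigenvalues, hence infinitely many independent vectors in the span of
    \<open>T\<close>.\<close>
  define z where "z = tv two_rho"
  define Orb where "Orb = {v. \<exists>xs. set xs \<subseteq> L \<and> v = foldr (\<lambda>x. E x 0) xs u'}"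
  have "\<exists>\<gamma> v. reach u \<gamma> n v \<and> v \<notin> S \<and> (\<forall>\<alpha>\<in>positive_roots \<Delta> \<Pi>. \<forall>x\<in>R \<alpha>. E x 0 v \<in> S)"
  proof (rule ccontr)
    assume neg: "\<not> ?thesis"
    let ?P = "\<lambda>(i::nat) p. fst p \<notin> S \<and> fst p \<in> Orb \<and> (\<exists>\<gamma>. reach u \<gamma> n (fst p)) \<and> E z 0 (fst p) = scV (snd p) (fst p)"
    let ?Q = "\<lambda>(i::nat) p q. snd q - snd p > (0::complex)"
    have "\<exists>f. \<forall>i. ?P i (f i) \<and> ?Q i (f i) (f (Suc i))"
    proof (rule dependent_nat_choice)
      have "E z 0 u' = scV (\<nu> z + \<gamma>1 z) u'" using W_E[OF reach_W[OF u'(1) u(1)], of z] tv_t by (simp add: z_def)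
      moreover have "u' \<in> Orb" unfolding Orb_def by (auto intro!: exI[of _ "[]"])
      ultimately show "\<exists>p. ?P 0 p" using u' by (intro exI[of _ "(u', \<nu> z + \<gamma>1 z)"]) auto
    next
      fix p :: "'v \<times> complex" and i assume p: "?P i p"
      then obtain \<gamma> where \<gamma>: "reach u \<gamma> n (fst p)" by blast
      then obtain \<alpha> x where x: "\<alpha> \<in> positive_roots \<Delta> \<Pi>" "x \<in> R \<alpha>" "E x 0 (fst p) \<notin> S" using neg p by blast
      have ap: "ap \<alpha> 0" "x \<in> rv \<alpha>" using x by (auto simp: ap_def rv_def)
      have "reach u (\<lambda>y. \<gamma> y + \<alpha> y) (n + 0) (E x 0 (fst p))" by (rule reach_step[OF \<gamma> ap])
      moreover have "E x 0 (fst p) \<in> Orb"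
      proof -
        obtain xs where "set xs \<subseteq> L" "fst p = foldr (\<lambda>x. E x 0) xs u'" using p by (auto simp: Orb_def)
        then show ?thesis unfolding Orb_def using R_L[OF x(2)] by (auto intro!: exI[of _ "x # xs"])
      qed
      moreover have "E z 0 (E x 0 (fst p)) = scV (snd p + \<alpha> z) (E x 0 (fst p))"
        using E0_E[of z x 0 "fst p"] p R_br[OF x(2) tv_t] t_g[OF tv_t] rv_g[OF ap(2)]
        by (simp add: z_def E_r.scale E_l.scale V.scale_left_distrib)
      moreover have "\<alpha> z > 0"
        using positive_on_positive_roots[OF two_rho_D two_rho_simple x(1)]
          ip_sym[OF two_rho_D roots_D[OF positive_root[OF x(1)]]] by (simp add: z_def)
      ultimately show "\<exists>q. ?P (Suc i) q \<and> ?Q i p q"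
        using x(3) by (intro exI[of _ "(E x 0 (fst p), snd p + \<alpha> z)"]) auto
    qed
    then obtain f where f: "\<And>i. ?P i (f i)" "\<And>i. snd (f (Suc i)) - snd (f i) > 0" by blast
    have mono: "strict_mono (\<lambda>i. Re (snd (f i)))"
      unfolding strict_mono_Suc_iff using f(2) by (simp add: less_complex_def)
    then have inj: "snd (f i) \<noteq> snd (f j)" if "i \<noteq> j" for i j
      using that strict_mono_eq[OF mono] by metis
    have "Orb \<subseteq> V.span T" using T(2) unfolding Orb_def by blast
    then have "range (\<lambda>i. fst (f i)) \<subseteq> V.span T" using f(1) by blast
    then obtain j where j: "fst (f j) \<in> V.span ((\<lambda>i. fst (f i)) ` {j<..})"
      using V.seq_dependent[OF T(1)] by blast
    let ?W = "\<lambda>i. {w. E z 0 w = scV (snd (f i)) w}"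
    have "fst (f j) = 0"
    proof (rule V.eigen_independent[where I = UNIV and W = ?W and i = j])
      show "\<exists>P c. Vector_Spaces.linear scV scV P \<and> (\<forall>k\<in>UNIV. \<forall>w\<in>?W k. P w = scV (c k) w) \<and> c i \<noteq> c i'"
        if "i \<noteq> i'" for i i'
        using lin_E inj[OF that] by (intro exI[of _ "E z 0"] exI[of _ "\<lambda>i. snd (f i)"]) auto
      show "V.subspace (?W i)" for i
        by (auto intro!: V.subspaceI simp: E_r.add E_r.scale V.scale_right_distrib V.scale_left_commute)
      have "(\<lambda>i. fst (f i)) ` {j<..} \<subseteq> (\<Union>i\<in>UNIV - {j}. ?W i)"
      proof (rule image_subsetI)
        fix i assume "i \<in> {j<..}"
        then show "fst (f i) \<in> (\<Union>i\<in>UNIV - {j}. ?W i)" using f(1)[of i] by (intro UN_I[of i]) simp_all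
      qed
      then show "fst (f j) \<in> V.span (\<Union>i\<in>UNIV - {j}. ?W i)" using j V.span_mono by blast
    qed (use f(1) in auto)
    then show False using f(1)[of j] S0 by simp
  qed
  then obtain \<gamma> v where v: "reach u \<gamma> n v" "v \<notin> S" "\<And>\<alpha> x. \<alpha> \<in> positive_roots \<Delta> \<Pi> \<Longrightarrow> x \<in> R \<alpha> \<Longrightarrow> E x 0 v \<in> S"
    by blast
  have "E x m v \<in> S" if "ap \<alpha> m" "x \<in> rv \<alpha>" for \<alpha> m x
  proof (cases "m = 0")
    case True
    then have "\<alpha> \<in> positive_roots \<Delta> \<Pi>" using that(1) by (auto simp: ap_def)
    moreover from this have "\<alpha> \<noteq> (\<lambda>_. 0)" using roots_nz positive_root by blast
    ultimately show ?thesis using v(3) that(2) True by (auto simp: rv_def)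
  next
    case False
    show ?thesis
    proof (rule ccontr)
      assume "E x m v \<notin> S"
      then have "n + m \<in> ?M" using reach_step[OF v(1) that] by blast
      moreover have "n + m \<ge> 0" using IntD2[OF nM] ap_nonneg[OF that(1)] by simp
      ultimately have "n + m \<le> n" by (rule nmax)
      then show False using False ap_nonneg[OF that(1)] by simp
    qed
  qed
  then have "sing S v (\<lambda>y. \<nu> y + \<gamma> y, a + of_int n)"
    using cone_Fn[OF u(2) reach_cone[OF v(1)]] reach_W[OF v(1) u(1)] v(2) by (auto simp: sing_def)
  then show ?thesis using v(1) by blast
qed

section \<open>Submodules generated by singular vectors\<close>

inductive low :: "'v \<Rightarrow> ('g \<Rightarrow> complex) \<Rightarrow> int \<Rightarrow> 'v \<Rightarrow> bool" for v where
  low_0: "low v (\<lambda>_. 0) 0 v"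
| low_step: "low v \<gamma> m w \<Longrightarrow> ap \<alpha> n \<Longrightarrow> x \<in> rv (\<lambda>y. - \<alpha> y) \<Longrightarrow> low v (\<lambda>y. \<gamma> y + \<alpha> y) (m + n) (E x (- n) w)"

lemma low_cases: "low v \<gamma> n w \<Longrightarrow> (w = v \<and> \<gamma> = (\<lambda>_. 0) \<and> n = 0) \<or> scone \<gamma> n"
proof (induction rule: low.induct)
  case (low_step \<gamma> m w \<alpha> n x)
  have "cone \<gamma> m" using low_step(4) scone_cone cone_0 by blast
  then show ?case using low_step(2) unfolding scone_def by blast
qed simp

lemma low_W: "low v \<gamma> n w \<Longrightarrow> v \<in> W (\<nu>, a) \<Longrightarrow> w \<in> W (\<lambda>y. \<nu> y - \<gamma> y, a - of_int n)"
proof (induction rule: low.induct)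
  case (low_step \<gamma> m w \<alpha> n x)
  have "(\<lambda>y. - \<alpha> y) \<in> D" by (rule dual_space_neg[OF ap_D[OF low_step(2)]])
  then show ?case using W_shift[OF _ low_step(3), of w "\<lambda>y. \<nu> y - \<gamma> y" "a - of_int m" "- n"] low_step
    by (simp add: diff_diff_eq)
qed simp

lemma low_Fn: "\<nu> \<in> Fn \<Longrightarrow> low v \<gamma> n w \<Longrightarrow> (\<lambda>y. \<nu> y - \<gamma> y) \<in> Fn"
proof -
  assume a: "\<nu> \<in> Fn" "low v \<gamma> n w"
  have "\<gamma> \<in> D" using low_cases[OF a(2)] cone_D scone_cone dual_space_0 by blast
  then have "(\<lambda>y. - \<gamma> y) \<in> D" by (rule dual_space_neg)
  then show "(\<lambda>y. \<nu> y - \<gamma> y) \<in> Fn" using Fn_shift[OF a(1)] by fastforce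
qed

definition "gen v = V.span {w. \<exists>\<gamma> n. low v \<gamma> n w}"

lemma low_gen: "low v \<gamma> n w \<Longrightarrow> w \<in> gen v"
  unfolding gen_def by (rule V.span_base) blast

lemma gen_lower:
  assumes "ap \<alpha> n" "x \<in> rv (\<lambda>y. - \<alpha> y)" "w \<in> gen v" shows "E x (- n) w \<in> gen v"
proof (rule V.linear_on_span_in[OF lin_E _ assms(3)[unfolded gen_def]])
  show "V.subspace (gen v)" by (simp add: gen_def)
  fix w assume "w \<in> {w. \<exists>\<gamma> n. low v \<gamma> n w}"
  then obtain \<gamma> m where "low v \<gamma> m w" by blast
  then show "E x (- n) w \<in> gen v" by (rule low_gen[OF low_step[OF _ assms(1,2)]])
qed

text \<open>Lowering monomials suffice: an arbitrary mode is commuted past the first factor, and the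
  bracket is again a mode applied to a shorter monomial. On \<open>v\<close> itself raising modes
  give 0, and \<open>t\<close> and \<open>H\<close> give scalars.\<close>

lemma sub_gen:
  assumes v: "sing {0} v (\<nu>, a)" shows "sub (gen v)"
proof -
  have sg: "V.subspace (gen v)" by (simp add: gen_def)
  have vW: "v \<in> W (\<nu>, a)" using v by (simp add: sing_def)
  have low_stable: "E x k w \<in> gen v" if low: "low v \<gamma> n w" and x: "x \<in> g" for \<gamma> n w x k
    using low x
  proof (induction arbitrary: x k rule: low.induct)
    case low_0
    show ?case
    proof (rule g_induct[OF sg low_0])
      fix \<alpha> x assume \<alpha>: "\<alpha> \<in> insert (\<lambda>_. 0) \<Delta>" and x: "x \<in> rv \<alpha>"
      have raise: "E x k v = 0" if "ap \<alpha> k" using v that x unfolding sing_def by blast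
      have lower: "E x k v \<in> gen v" if "ap (\<lambda>y. - \<alpha> y) (- k)"
        using gen_lower[OF that, of x v v] low_gen[OF low.low_0] x by simp
      have neg: "(\<lambda>y. - \<alpha> y) \<in> insert (\<lambda>_. 0) \<Delta>" using \<alpha> neg_root by auto
      consider "k > 0" | "k < 0" | "k = 0" "\<alpha> = (\<lambda>_. 0)" | "k = 0" "\<alpha> \<in> \<Delta>" using \<alpha> by fastforce
      then show "E x k v \<in> gen v"
      proof cases
        case 1
        then have "ap \<alpha> k" using \<alpha> by (auto simp: ap_def)
        then show ?thesis using raise V.subspace_0[OF sg] by simp
      next
        case 2
        then show ?thesis using neg by (intro lower) (auto simp: ap_def)
      next
        case 3
        then have "x \<in> t \<union> H" using x R_0 by (auto simp: rv_def)
        then have "E x 0 v = scV (\<nu> x) v" using W_E[OF vW] by simp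
        then show ?thesis using 3 low_gen[OF low.low_0] V.subspace_scale[OF sg] by simp
      next
        case 4
        then have "ap \<alpha> 0 \<or> ap (\<lambda>y. - \<alpha> y) 0" using root_positive_or_negative by (auto simp: ap_def)
        then show ?thesis using raise lower 4 V.subspace_0[OF sg] by auto
      qed
    qed
  next
    case (low_step \<gamma> m w \<alpha> n y)
    have y: "y \<in> g" by (rule rv_g[OF low_step(3)])
    have "E x k (E y (- n) w) = E y (- n) (E x k w) + E (br x y) (k + - n) w
        + scV (if k + - n = 0 then of_int k * B x y * of_nat lev else 0) w"
      by (rule E_comm[OF low_step(5) y])
    moreover have "E y (- n) (E x k w) \<in> gen v"
      using low_step(4)[OF low_step(5)] by (intro gen_lower[OF low_step(2,3)])
    moreover have "E (br x y) (k + - n) w \<in> gen v"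
      using low_step(4) br_closed[OF low_step(5) y] by blast
    moreover have "w \<in> gen v" using low_gen[OF low_step(1)] .
    ultimately show ?case using sg by (auto intro!: V.subspace_add V.subspace_scale)
  qed
  have "E x k w \<in> gen v" if "x \<in> g" "w \<in> gen v" for x k w
    by (rule V.linear_on_span_in[OF lin_E sg that(2)[unfolded gen_def]]) (use low_stable that(1) in blast)
  moreover have "dd w \<in> gen v" if "w \<in> gen v" for w
  proof (rule V.linear_on_span_in[OF lin_dd sg that[unfolded gen_def]])
    fix w assume "w \<in> {w. \<exists>\<gamma> n. low v \<gamma> n w}"
    then obtain \<gamma> n where l: "low v \<gamma> n w" by blast
    show "dd w \<in> gen v" using W_dd[OF low_W[OF l vW]] low_gen[OF l] V.subspace_scale[OF sg] by simp
  qed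
  ultimately show ?thesis using sg by (simp add: sub_def)
qed

definition "irr N \<longleftrightarrow> sub N \<and> N \<noteq> {0} \<and> (\<forall>N'. sub N' \<and> N' \<subseteq> N \<longrightarrow> N' = {0} \<or> N' = N)"

lemma gen_Om:
  assumes v: "sing {0} v i" and w: "w \<in> gen v" shows "Om w = scV (cs i) w"
proof -
  have Ov: "Om v = scV (cs i) v" using sing_Om[OF sub_0 v] by simp
  have "Om w = scV (cs i) w" if "low v \<gamma> n w" for \<gamma> n w
    using that
  proof (induction rule: low.induct)
    case (low_step \<gamma> m w \<alpha> n x)
    then show ?case using Om_E[OF rv_g[OF low_step(3)], of "- n" w] by (simp add: E_r.scale)
  qed (rule Ov)
  then have "{w. \<exists>\<gamma> n. low v \<gamma> n w} \<subseteq> {w. Om w = scV (cs i) w}" by blast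
  moreover have "V.subspace {w. Om w = scV (cs i) w}"
    by (auto intro!: V.subspaceI simp: Om.add Om.scale V.scale_right_distrib V.scale_left_commute)
  ultimately show ?thesis using V.span_minimal w unfolding gen_def by blast
qed

text \<open>A nonzero submodule contains a singular vector \<open>w\<close>, on which
  \<open>Om\<close> has the same scalar as on \<open>v\<close>. By \<open>sing_compare\<close> its
  weight is not strictly below that of \<open>v\<close>, and the only monomial of
  \<open>gen v\<close> not strictly below is \<open>v\<close> itself; so \<open>w\<close> is a
  multiple of \<open>v\<close>.\<close>

lemma irr_gen:
  assumes v: "sing {0} v (\<nu>, a)" shows "irr (gen v)"
  unfolding irr_def
proof (intro conjI allI impI)
  have vW: "v \<in> W (\<nu>, a)" "v \<noteq> 0" and \<nu>: "\<nu> \<in> Fn" using v by (auto simp: sing_def)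
  show "sub (gen v)" by (rule sub_gen[OF v])
  show "gen v \<noteq> {0}" using low_gen[OF low.low_0] vW by blast
  fix N' assume N': "sub N' \<and> N' \<subseteq> gen v"
  show "N' = {0} \<or> N' = gen v"
  proof (rule disjCI)
    assume ne: "N' \<noteq> gen v"
    show "N' = {0}"
    proof (rule ccontr)
      assume "N' \<noteq> {0}"
      then obtain w0 where "w0 \<in> N'" "w0 \<noteq> 0" using N' V.subspace_0 unfolding sub_def by blast
      then obtain i u where u: "i \<in> Fn \<times> UNIV" "u \<in> W i" "u \<in> N'" "u \<noteq> 0"
        using sub_weight_vector N' by blast
      then obtain w \<gamma> n where w: "reach u \<gamma> n w" "sing {0} w (\<lambda>y. fst i y + \<gamma> y, snd i + of_int n)"
        using exists_sing[OF sub_0, of u "fst i" "snd i"] by auto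
      define \<mu> b where "\<mu> = (\<lambda>y. fst i y + \<gamma> y)" and "b = snd i + of_int n"
      have ws: "sing {0} w (\<mu>, b)" using w(2) by (simp add: \<mu>_def b_def)
      have wN: "w \<in> N'" using reach_sub[OF w(1)] N' u by blast
      have wW: "w \<in> W (\<mu>, b)" "w \<noteq> 0" and \<mu>: "\<mu> \<in> Fn" using ws by (auto simp: sing_def)
      have "scV (cs (\<mu>, b)) w = scV (cs (\<nu>, a)) w"
        using gen_Om[OF v, of w] sing_Om[OF sub_0 ws] wN N' by auto
      then have c: "cs (\<nu>, a) = cs (\<mu>, b)" using wW by simp
      have no: "w' \<in> (\<Union>j\<in>Fn \<times> UNIV - {(\<mu>, b)}. W j)"
        if l: "low v \<gamma> n w'" and s: "scone \<gamma> n" for \<gamma> n w'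
      proof -
        have "(\<lambda>y. \<nu> y - \<gamma> y, a - of_int n) \<noteq> (\<mu>, b)"
        proof
          assume "(\<lambda>y. \<nu> y - \<gamma> y, a - of_int n) = (\<mu>, b)"
          then have "\<mu> = (\<lambda>y. \<nu> y - \<gamma> y)" "b = a - of_int n" by auto
          then have "\<nu> = (\<lambda>y. \<mu> y + \<gamma> y)" "a = b + of_int n" by simp_all
          then show False using sing_compare[OF sub_0 v sub_0 ws _ _ c] s by blast
        qed
        then show ?thesis using low_W[OF l vW(1)] low_Fn[OF \<nu> l] by blast
      qed
      have all: "{w. \<exists>\<gamma> n. low v \<gamma> n w} \<subseteq> insert v (\<Union>j\<in>Fn \<times> UNIV - {(\<mu>, b)}. W j)"
      proof
        fix w' assume "w' \<in> {w. \<exists>\<gamma> n. low v \<gamma> n w}"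
        then obtain \<gamma> n where l: "low v \<gamma> n w'" by blast
        show "w' \<in> insert v (\<Union>j\<in>Fn \<times> UNIV - {(\<mu>, b)}. W j)"
          using low_cases[OF l] no[OF l] by blast
      qed
      have "w \<in> V.span (insert v (\<Union>j\<in>Fn \<times> UNIV - {(\<mu>, b)}. W j))"
        using V.span_mono[OF all] wN N' unfolding gen_def by blast
      then obtain s where s: "w - scV s v \<in> V.span (\<Union>j\<in>Fn \<times> UNIV - {(\<mu>, b)}. W j)"
        unfolding V.span_breakdown_eq by blast
      \<comment> \<open>Otherwise \<open>v\<close> too would have a weight other than
        \<open>(\<mu>, b)\<close>, and \<open>w\<close> would lie in the span of the other weight
        spaces.\<close>
      have "(\<mu>, b) = (\<nu>, a)"
      proof (rule ccontr)
        assume "(\<mu>, b) \<noteq> (\<nu>, a)"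
        then have "scV s v \<in> V.span (\<Union>j\<in>Fn \<times> UNIV - {(\<mu>, b)}. W j)"
          using \<nu> vW(1) by (intro V.span_scale V.span_base) blast
        then have "w - scV s v + scV s v \<in> V.span (\<Union>j\<in>Fn \<times> UNIV - {(\<mu>, b)}. W j)"
          using s V.span_add by blast
        then have "w = 0" using W_independent[of "(\<mu>, b)" w] \<mu> wW(1) by simp
        then show False using wW by simp
      qed
      then have "w - scV s v \<in> W (\<mu>, b)"
        using vW wW V.subspace_diff[OF W_subspace] V.subspace_scale[OF W_subspace] by simp
      then have "w - scV s v = 0" using W_independent[of "(\<mu>, b)"] s \<mu> by blast
      then have ws: "w = scV s v" by simp
      then have "s \<noteq> 0" using wW by auto
      then have "v = scV (1 / s) w" using ws by simp
      then have vN: "v \<in> N'" using wN N' V.subspace_scale unfolding sub_def by blast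
      have "w' \<in> N'" if "low v \<gamma> n w'" for \<gamma> n w'
        using that
      proof (induction rule: low.induct)
        case (low_step \<gamma> m w \<alpha> n x)
        then show ?case using N' rv_g[OF low_step(3)] by (simp add: sub_def)
      qed (rule vN)
      then have "gen v \<subseteq> N'" unfolding gen_def using N' by (intro V.span_minimal) (auto simp: sub_def)
      then show False using ne N' by blast
    qed
  qed
qed

theorem span_irr: "v \<in> V.span (\<Union>{N. irr N})"
proof -
  define S where "S = V.span (\<Union>{N. irr N})"
  have Ssub: "V.subspace S" by (simp add: S_def)
  have S: "sub S"
    unfolding sub_def
  proof (intro conjI ballI allI)
    show "E x n w \<in> S" if "x \<in> g" "w \<in> S" for x n w
    proof (rule V.linear_on_span_in[OF lin_E Ssub that(2)[unfolded S_def]])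
      fix w assume "w \<in> \<Union>{N. irr N}"
      then obtain N where N: "irr N" "w \<in> N" by blast
      then have "E x n w \<in> N" using that(1) by (simp add: irr_def sub_def)
      then show "E x n w \<in> S" unfolding S_def using N(1) by (intro V.span_base) blast
    qed
    show "dd w \<in> S" if "w \<in> S" for w
    proof (rule V.linear_on_span_in[OF lin_dd Ssub that[unfolded S_def]])
      fix w assume "w \<in> \<Union>{N. irr N}"
      then obtain N where N: "irr N" "w \<in> N" by blast
      then have "dd w \<in> N" by (simp add: irr_def sub_def)
      then show "dd w \<in> S" unfolding S_def using N(1) by (intro V.span_base) blast
    qed
  qed (rule Ssub)
  have "W i \<subseteq> S" if i: "i \<in> Fn \<times> UNIV" for i
  proof (rule ccontr)
    assume "\<not> W i \<subseteq> S"
    then obtain u where "u \<in> W i" "u \<notin> S" by blast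
    then have "\<exists>v \<gamma> n. reach u \<gamma> n v \<and> sing S v (\<lambda>y. fst i y + \<gamma> y, snd i + of_int n)"
      using exists_sing[OF S, of u "fst i" "snd i"] i by auto
    then obtain v \<nu> a where v: "sing S v (\<nu>, a)" by blast
    define c where "c = cs (\<nu>, a)"
    \<comment> \<open>\<open>Q\<close> measures the failure of \<open>Om\<close> to be the expected
      scalar. On \<open>v\<close> it has values in \<open>S\<close>, so \<open>fitting_shift\<close>
      can work in the finite dimensional space \<open>S \<inter> W (\<nu>, a)\<close>.\<close>
    define Q where "Q w = Om w - scV c w" for w
    have linQ: "Vector_Spaces.linear scV scV Q"
      by unfold_locales (simp_all add: Q_def Om.add Om.scale V.scale_right_distrib V.scale_left_commute
        V.scale_right_diff_distrib)
    interpret Q: Vector_Spaces.linear scV scV Q by (rule linQ)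
    have vW: "v \<in> W (\<nu>, a)" "v \<notin> S" and \<nu>: "\<nu> \<in> Fn" using v by (auto simp: sing_def)
    have QW: "Q w \<in> W (\<nu>, a)" if "w \<in> W (\<nu>, a)" for w
      unfolding Q_def using Om_W that by (intro V.subspace_diff V.subspace_scale W_subspace) auto
    have Om_S: "Om w \<in> S" if "w \<in> S" for w
    proof -
      have E: "E x n w \<in> S" if "x \<in> g" "w \<in> S" for x n w using S that by (simp add: sub_def)
      have "SL.T w \<in> S"
        unfolding SL.T_def SL.A_def using dp.U_g dp.du_g that
        by (intro V.subspace_add V.subspace_scale V.subspace_sum Ssub E) auto
      moreover have "SH.T w \<in> S"
        unfolding SH.T_def SH.A_def using SH.U_g SH.du_g that
        by (intro V.subspace_add V.subspace_scale V.subspace_sum Ssub E) auto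
      moreover have "dd w \<in> S" using S that by (simp add: sub_def)
      ultimately show ?thesis unfolding Om_def by (intro V.subspace_add V.subspace_scale Ssub)
    qed
    have QS: "Q w \<in> S" if "w \<in> S" for w
      unfolding Q_def using Om_S that by (intro V.subspace_diff V.subspace_scale Ssub) auto
    obtain T where T: "finite T" "W (\<nu>, a) \<subseteq> V.span T" using W_finite by blast
    have "\<exists>z\<in>S \<inter> W (\<nu>, a). \<exists>m. (Q ^^ m) (v - z) = 0"
    proof (rule V.fitting_shift[OF linQ _ _ T(1)])
      show "V.subspace (S \<inter> W (\<nu>, a))" by (intro V.subspace_inter Ssub W_subspace)
      show "Q ` (S \<inter> W (\<nu>, a)) \<subseteq> S \<inter> W (\<nu>, a)" using QS QW by blast
      show "S \<inter> W (\<nu>, a) \<subseteq> V.span T" using T(2) by blast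
      show "Q v \<in> S \<inter> W (\<nu>, a)" using QW[OF vW(1)] sing_Om[OF S v] by (simp add: Q_def c_def)
    qed
    then obtain z M where z: "z \<in> S" "z \<in> W (\<nu>, a)" "(Q ^^ M) (v - z) = 0" by blast
    define v' where "v' = v - z"
    have v'W: "v' \<in> W (\<nu>, a)" unfolding v'_def using vW z by (intro V.subspace_diff W_subspace)
    have v'S: "v' \<notin> S" using V.subspace_add[OF Ssub z(1), of v'] vW(2) by (auto simp: v'_def)
    have v': "sing S v' (\<nu>, a)"
      unfolding sing_def
    proof (intro conjI allI ballI impI)
      fix \<alpha> n x assume "x \<in> rv \<alpha>" "ap \<alpha> n"
      then have "E x n v \<in> S" "E x n z \<in> S" using v z(1) S rv_g unfolding sing_def sub_def by blast+
      then show "E x n v' \<in> S" unfolding v'_def E_r.diff by (rule V.subspace_diff[OF Ssub])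
    qed (use \<nu> v'W v'S in auto)
    \<comment> \<open>A submodule, because \<open>Om\<close> commutes with all even modes and with
      \<open>dd\<close>. So a singular vector \<open>w\<close> reached from \<open>v'\<close> stays
      in it, and nilpotency of \<open>Q\<close> forces its scalar to be \<open>c\<close>.\<close>
    define G where "G = {w. (Q ^^ M) w = 0}"
    note linQM = V.linear_funpow[OF linQ]
    have QE: "(Q ^^ m) (E x n w) = E x n ((Q ^^ m) w)" if "x \<in> g" for m x n w
      by (induction m) (simp_all add: Q_def Om_E[OF that] E_r.diff E_r.scale)
    have Qdd: "(Q ^^ m) (dd w) = dd ((Q ^^ m) w)" for m w
      by (induction m) (simp_all add: Q_def Om_dd dd.diff dd.scale)
    have G: "sub G"
    proof -
      interpret QM: Vector_Spaces.linear scV scV "Q ^^ M" by (rule linQM)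
      show ?thesis unfolding sub_def G_def by (auto simp: QM.subspace_kernel QE Qdd)
    qed
    have "sing {0} v' (\<nu>, a)"
      unfolding sing_def
    proof (intro conjI allI ballI impI)
      fix \<alpha> n x assume x: "x \<in> rv \<alpha>" and ap: "ap \<alpha> n"
      show "E x n v' \<in> {0}"
      proof (rule ccontr)
        assume nz: "E x n v' \<notin> {0}"
        have uW: "E x n v' \<in> W (\<lambda>y. \<nu> y + \<alpha> y, a + of_int n)" by (rule W_shift[OF v'W x ap_D[OF ap]])
        obtain w \<gamma> m where w: "reach (E x n v') \<gamma> m w"
          "sing {0} w (\<lambda>y. \<nu> y + \<alpha> y + \<gamma> y, a + of_int n + of_int m)"
          using exists_sing[OF sub_0 uW Fn_shift[OF \<nu> ap_D[OF ap]] nz] by blast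
        define \<mu> b where "\<mu> = (\<lambda>y. \<nu> y + \<alpha> y + \<gamma> y)" and "b = a + of_int n + of_int m"
        have ws: "sing {0} w (\<mu>, b)" using w(2) by (simp add: \<mu>_def b_def)
        have "v' \<in> G" using z(3) by (simp add: G_def v'_def)
        then have "E x n v' \<in> G" using G rv_g[OF x] unfolding sub_def by blast
        then have wG: "w \<in> G" using reach_sub[OF w(1) G] by blast
        have "Om w = scV (cs (\<mu>, b)) w" using sing_Om[OF sub_0 ws] by simp
        then have "Q w = scV (cs (\<mu>, b) - c) w" by (simp add: Q_def V.scale_left_diff_distrib)
        then have "(Q ^^ m) w = scV ((cs (\<mu>, b) - c) ^ m) w" for m
          by (induction m) (simp_all add: Q.scale mult.commute)
        then have "(cs (\<mu>, b) - c) ^ M = 0" using wG ws by (auto simp: G_def sing_def)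
        then have c: "cs (\<mu>, b) = cs (\<nu>, a)" by (simp add: c_def)
        have sc: "scone (\<lambda>y. \<gamma> y + \<alpha> y) (m + n)"
          unfolding scone_def using reach_cone[OF w(1)] ap by blast
        have "\<mu> = (\<lambda>y. \<nu> y + (\<gamma> y + \<alpha> y))" "b = a + of_int (m + n)"
          by (auto simp: \<mu>_def b_def)
        \<comment> \<open>Here \<open>w\<close> is singular in the whole module and
          \<open>v'\<close> so far only modulo \<open>S\<close>.\<close>
        from sing_compare[OF sub_0 ws S v' this c] sc show False by (rule notE)
      qed
    qed (use \<nu> v'W v'S V.subspace_0[OF Ssub] in auto)
    then have "irr (gen v')" by (rule irr_gen)
    then have "v' \<in> S" unfolding S_def using low_gen[OF low.low_0] by (intro V.span_base) blast
    then show False using v'S by simp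
  qed
  then have "V.span (\<Union>i\<in>Fn \<times> UNIV. W i) \<subseteq> S" by (intro V.span_minimal Ssub) blast
  then show ?thesis using W_spanning[of v] by (auto simp: S_def)
qed

end

section \<open>The affine Lie superalgebra\<close>

locale affine_setting = basic_lie_superalgebra sc gr br B
    + super_module "aff_scale sc" "aff_grading gr" "aff_bracket sc br B" scV grV act
  for sc :: "complex \<Rightarrow> 'g::ab_group_add \<Rightarrow> 'g"
    and gr br B
    and scV :: "complex \<Rightarrow> 'v::ab_group_add \<Rightarrow> 'v" and grV act +
  fixes G0 H h :: "'g set" and \<Pi> \<Pi>0 :: "('g \<Rightarrow> complex) set" and \<theta> :: "'g \<Rightarrow> complex" and k :: nat
  assumes center: "H = lie_center br (gr 0)"
    and G0_simple: "simple_lie_algebra sc br G0"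
    and even_part: "gr 0 = {x + y | x y. x \<in> G0 \<and> y \<in> H}" "G0 \<inter> H = {0}"
    and cartan: "cartan_subalgebra sc br h" "h \<subseteq> gr 0"
    and simple_roots_G0: "simple_root_system (roots sc br (h \<inter> G0) G0) \<Pi>0"
    and highest: "highest_root (roots sc br (h \<inter> G0) G0) \<Pi>0 \<theta>"
    and form_positive: "positive_definite_on_roots B (h \<inter> G0) (roots sc br (h \<inter> G0) G0)"
    and form_normalized: "dual_form B (h \<inter> G0) \<theta> \<theta> = 2"
    and integrable: "integrable_module sc br h G0 \<Pi>0 \<theta> scV act"
    and highest_weight: "highest_weight_module sc br h \<Pi> scV act"
    and weight_spaces: "finite_dim_weight_spaces sc h scV act"
    and level: "k > 0" "\<And>v. act aff_K v = scV (of_nat k) v"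
begin

sublocale G: vector_space sc by (rule vector_space)
sublocale V: vector_space scV by (rule module_vector_space)
sublocale actr: Vector_Spaces.linear scV scV "act x" for x by (rule act_linear_right)
sublocale actl: Vector_Spaces.linear "aff_scale sc" scV "\<lambda>x. act x v" for v by (rule act_linear_left)

definition "Bas = (SOME Bas. finite_dimensional_vector_space sc Bas)"

lemma finite_dim_Bas: "finite_dimensional_vector_space sc Bas"
proof -
  obtain T where T: "finite T" "(UNIV :: 'g set) \<subseteq> G.span T" using finite_dimensional by (auto simp: fin_dim_def)
  obtain A where A: "A \<subseteq> T" "G.independent A" "T \<subseteq> G.span A" using G.maximal_independent_subset by blast
  have "G.span A = UNIV" using T(2) A(3) by (metis G.span_mono G.span_span UNIV_eq_I subsetD UNIV_I)
  then have "finite_dimensional_vector_space sc A"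
    using A T(1) by unfold_locales (auto intro: finite_subset)
  then show ?thesis unfolding Bas_def by (rule someI)
qed

lemma gr_subspace: "G.subspace (gr p)"
  using grading by (simp add: direct_sum_decomp_def)

lemma gr_split: "\<exists>a\<in>gr 0. \<exists>b\<in>gr 1. x = a + b"
proof -
  obtain f where f: "\<forall>i. f i \<in> gr i" "finite {i. f i \<noteq> 0}" "x = (\<Sum>i | f i \<noteq> 0. f i)"
    using grading unfolding direct_sum_decomp_def by (metis UNIV_I)
  have UNIV: "(UNIV :: bit set) = {0, 1}" by (auto intro: bit.exhaust)
  have "x = (\<Sum>i\<in>UNIV. f i)"
    unfolding f(3) by (rule sum.mono_neutral_left, simp only: UNIV, simp, auto)
  also note UNIV
  finally have "x = f 0 + f 1" by simp
  then show ?thesis using f(1) by blast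
qed

lemma ssign_0 [simp]: "ssign 0 p = 1" "ssign p 0 = 1"
  by (simp_all add: ssign_def)

sublocale invariant_form sc Bas br B "gr 0"
proof -
  show "invariant_form sc Bas br B (gr 0)"
  proof (intro invariant_form.intro invariant_form_axioms.intro finite_dim_Bas)
    show "br x y \<in> gr 0" if "x \<in> gr 0" "y \<in> gr 0" for x y using bracket_graded[OF that] by simp
    show "br x y = - br y x" if "x \<in> gr 0" "y \<in> gr 0" for x y using super_skew[OF that] by simp
    show "br x (br y z) = br (br x y) z + br y (br x z)" if "x \<in> gr 0" "y \<in> gr 0" "z \<in> gr 0" for x y z
      using super_jacobi[OF that(1,2), of z] by simp
    show "B x y = B y x" if "x \<in> gr 0" "y \<in> gr 0" for x y using form_supersymmetric[OF that] by simp
    show "B (br x y) z = B x (br y z)" for x y z by (rule form_invariant)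
  qed (rule bracket_linear_right bracket_linear_left form_linear_right form_linear_left gr_subspace)+
qed

section \<open>Loop operators of the module\<close>

definition "E x n = act (loop x n)"
definition "dd = act aff_d"

lemma loop_add: "loop (x + y) n = loop x n + loop y n"
  by (simp add: loop_def single_add)

lemma loop_scale: "loop (sc c x) n = aff_scale sc c (loop x n)"
  by (simp add: loop_def aff_scale_def map_single_poly_mapping)

lemma linear_E: "Vector_Spaces.linear scV scV (E x n)"
  unfolding E_def by (rule act_linear_right)

lemma linear_E_left: "Vector_Spaces.linear sc scV (\<lambda>x. E x n v)"
  unfolding E_def by unfold_locales (simp_all add: loop_add loop_scale actl.add actl.scale)

sublocale Er: Vector_Spaces.linear scV scV "E x n" for x n by (rule linear_E)
sublocale El: Vector_Spaces.linear sc scV "\<lambda>x. E x n v" for n v by (rule linear_E_left)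

lemma loop_graded: "x \<in> gr p \<Longrightarrow> loop x n \<in> aff_grading gr p"
  using G.subspace_0[OF gr_subspace[of p]] by (auto simp: loop_def aff_grading_def lookup_single when_def)

lemma d_graded: "aff_d \<in> aff_grading gr 0"
  using G.subspace_0[OF gr_subspace[of 0]] by (auto simp: aff_d_def aff_grading_def)

lemma E_bracket:
  assumes "x \<in> gr p" "y \<in> gr q"
  shows "E x n (E y m v) = scV (ssign p q) (E y m (E x n v)) + E (br x y) (n + m) v
     + scV (if n + m = 0 then of_int n * B x y * of_nat k else 0) v"
proof -
  have "act (aff_bracket sc br B (loop x n) (loop y m)) v = E x n (E y m v) - scV (ssign p q) (E y m (E x n v))"
    unfolding E_def by (rule act_bracket[OF loop_graded[OF assms(1)] loop_graded[OF assms(2)]])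
  moreover have "act (aff_bracket sc br B (loop x n) (loop y m)) v
     = E (br x y) (n + m) v + scV (if n + m = 0 then of_int n * B x y else 0) (scV (of_nat k) v)"
    unfolding aff_bracket_loop actl.add actl.scale level E_def ..
  moreover have "scV (if n + m = 0 then of_int n * B x y else 0) (scV (of_nat k) v)
      = scV (if n + m = 0 then of_int n * B x y * of_nat k else 0) v"
    by (simp only: V.scale_scale if_distrib[of "\<lambda>c. c * of_nat k"] mult_zero_left)
  ultimately have "E x n (E y m v) - scV (ssign p q) (E y m (E x n v)) = E (br x y) (n + m) v
     + scV (if n + m = 0 then of_int n * B x y * of_nat k else 0) v" by (simp only:)
  then show ?thesis by (simp only: diff_eq_eq add.commute add.left_commute)
qed

lemma d_E: "dd (E x n v) = E x n (dd v) + scV (of_int n) (E x n v)"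
proof -
  have h: "dd (E x n v) = E x n (dd v) + scV (of_int n) (E x n v)" if "x \<in> gr p" for x p
    using act_bracket[OF d_graded loop_graded[OF that], of n v]
    by (simp add: E_def dd_def aff_bracket_d actl.scale algebra_simps)
  obtain a b where "a \<in> gr 0" "b \<in> gr 1" "x = a + b" using gr_split by blast
  then show ?thesis using h[of a 0] h[of b 1] 
    by (simp add: El.add dd_def actr.add Er.add V.scale_right_distrib algebra_simps)
qed

lemma linear_dd: "Vector_Spaces.linear scV scV dd"
  unfolding dd_def by (rule act_linear_right)

lemma act_decomp: "act (f, a, b) v = (\<Sum>n\<in>keys f. E (lookup f n) n v) + scV (a * of_nat k) v + scV b (dd v)"
proof -
  have f: "f = (\<Sum>n\<in>keys f. Poly_Mapping.single n (lookup f n))"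
    by (rule poly_mapping_eqI) (simp add: lookup_sum lookup_single when_def sum.delta in_keys_iff)
  have s: "(\<Sum>n\<in>A. (g n, 0::complex, 0::complex)) = ((\<Sum>n\<in>A. g n), 0, 0)" for A and g :: "int \<Rightarrow> int \<Rightarrow>\<^sub>0 'g"
    by (induction A rule: infinite_finite_induct) (auto simp: zero_prod_def)
  have "(f, a, b) = (\<Sum>n\<in>keys f. loop (lookup f n) n) + aff_scale sc a aff_K + aff_scale sc b aff_d"
    using f s[of "\<lambda>n. Poly_Mapping.single n (lookup f n)" "keys f"]
    by (simp add: loop_def aff_K_def aff_d_def aff_scale_def)
  then show ?thesis
    by (simp add: actl.add actl.sum actl.scale E_def dd_def level)
qed

subsection \<open>Boundedness of the degree operator\<close>

lemma E_highest: 
  assumes "\<And>x. x \<in> aff_n_plus sc br h \<Pi> \<Longrightarrow> act x v = 0" "n > 0" shows "E x n v = 0"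
proof -
  have "loop x n \<in> aff_n_plus sc br h \<Pi>"
    using assms(2) G.span_zero by (auto simp: aff_n_plus_def loop_def n_plus_def lookup_single when_def)
  then show ?thesis using assms(1) by (simp add: E_def)
qed

inductive mon :: "'v \<Rightarrow> int \<Rightarrow> 'v \<Rightarrow> bool" for v where
  mon_0: "mon v 0 v"
| mon_step: "mon v j w \<Longrightarrow> x \<in> gr p \<Longrightarrow> n \<le> 0 \<Longrightarrow> mon v (j + n) (E x n w)"

lemma mon_le: "mon v j w \<Longrightarrow> j \<le> 0"
  by (induction rule: mon.induct) auto

lemma mon_dd: "mon v j w \<Longrightarrow> dd v = scV a v \<Longrightarrow> dd w = scV (a + of_int j) w"
  by (induction rule: mon.induct) (simp_all add: d_E Er.add Er.scale V.scale_left_distrib)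

lemma E_in: "V.subspace X \<Longrightarrow> (\<And>x p. x \<in> gr p \<Longrightarrow> E x n w \<in> X) \<Longrightarrow> E x n w \<in> X"
proof -
  assume X: "V.subspace X" "\<And>x p. x \<in> gr p \<Longrightarrow> E x n w \<in> X"
  obtain a b where "a \<in> gr 0" "b \<in> gr 1" "x = a + b" using gr_split by blast
  then show ?thesis using X by (simp add: El.add V.subspace_add)
qed

text \<open>A positive mode moves to the right through a monomial by the super bracket until it
  kills \<open>v\<close>; the brackets produced act on shorter monomials. So the span is stable
  under the whole affine superalgebra and contains the orbit of \<open>v\<close>.\<close>

lemma span_mon:
  assumes top: "\<And>x n. n > 0 \<Longrightarrow> E x n v = 0" and dv: "dd v = scV a v"
    and gen: "enveloping_orbit scV act UNIV v = UNIV"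
  shows "w \<in> V.span {w. \<exists>j. mon v j w}"
proof -
  define X where "X = V.span {w. \<exists>j. mon v j w}"
  have Xs: "V.subspace X" by (simp add: X_def)
  have monX: "mon v j w \<Longrightarrow> w \<in> X" for j w unfolding X_def by (rule V.span_base) blast
  have lower: "E x n w \<in> X" if x: "x \<in> gr p" and "n \<le> 0" "w \<in> X" for x n p w
  proof (rule V.linear_on_span_in[OF linear_E Xs that(3)[unfolded X_def]])
    fix w assume "w \<in> {w. \<exists>j. mon v j w}"
    then obtain j where "mon v j w" by blast
    then show "E x n w \<in> X" by (rule monX[OF mon_step[OF _ x \<open>n \<le> 0\<close>]])
  qed
  have stable: "E x n w \<in> X" if "mon v j w" "x \<in> gr p" for x n p w j
    using that
  proof (induction arbitrary: x n p rule: mon.induct)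
    case mon_0
    then show ?case using top[of n x] V.subspace_0[OF Xs] lower[OF mon_0 _ monX[OF mon.mon_0]]
      by (cases "n > 0") auto
  next
    case (mon_step j w y q m)
    have "E y m (E x n w) \<in> X" using lower[OF mon_step(2,3)] mon_step(4)[OF mon_step(5)] .
    moreover have "E (br x y) (n + m) w \<in> X" using mon_step(4) bracket_graded[OF mon_step(5,2)] .
    moreover have "w \<in> X" using monX mon_step(1) .
    ultimately show ?case unfolding E_bracket[OF mon_step(5,2)]
      by (intro V.subspace_add V.subspace_scale Xs)
  qed
  have EX: "E x n w \<in> X" if "w \<in> X" for x n w
  proof (rule E_in[OF Xs])
    fix x p assume x: "x \<in> gr p"
    show "E x n w \<in> X"
      by (rule V.linear_on_span_in[OF linear_E Xs that[unfolded X_def]]) (use stable x in blast)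
  qed
  have ddX: "dd w \<in> X" if "w \<in> X" for w
  proof (rule V.linear_on_span_in[OF linear_dd Xs that[unfolded X_def]])
    fix w assume "w \<in> {w. \<exists>j. mon v j w}"
    then obtain j where "mon v j w" by blast
    then show "dd w \<in> X" using mon_dd[OF _ dv] monX V.subspace_scale[OF Xs] by simp
  qed
  have actX: "act y w \<in> X" if "w \<in> X" for y w
  proof -
    obtain f a b where y: "y = (f, a, b)" by (cases y)
    show ?thesis unfolding y act_decomp
      by (intro V.subspace_add V.subspace_sum V.subspace_scale Xs EX ddX that)
  qed
  have "foldr act xs v \<in> X" for xs
    by (induction xs) (auto intro: actX monX mon_0)
  then have "V.span {foldr act xs v | xs. set xs \<subseteq> UNIV} \<subseteq> X" by (intro V.span_minimal Xs) auto
  then show ?thesis using gen unfolding enveloping_orbit_def X_def by blast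
qed

text \<open>The monomials span the module and have \<open>d\<close>-eigenvalues \<open>a\<close>
  minus a natural number. An eigenvector for any other value would lie in the span of eigenspaces
  for different values.\<close>

lemma degrees:
  obtains v a where "v \<noteq> 0" "\<And>w. w \<in> V.span {w. \<exists>j. mon v j w}" "dd v = scV a v"
    "\<And>w b. w \<noteq> 0 \<Longrightarrow> dd w = scV b w \<Longrightarrow> \<exists>j::nat. b = a - of_nat j"
proof -
  obtain v \<mu> where v: "v \<noteq> 0" "v \<in> weight_space scV act (aff_cartan h) \<mu>"
    "\<And>x. x \<in> aff_n_plus sc br h \<Pi> \<Longrightarrow> act x v = 0" "enveloping_orbit scV act UNIV v = UNIV"
    using highest_weight unfolding highest_weight_module_def by blast
  have "0 \<in> h" using cartan(1) G.subspace_0 by (auto simp: cartan_subalgebra_def lie_subalgebra_def)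
  then have "aff_d \<in> aff_cartan h" unfolding aff_d_def aff_cartan_def
    by (auto intro!: exI[of _ 0])
  then have dv: "dd v = scV (\<mu> aff_d) v" using v(2) by (simp add: weight_space_def dd_def)
  define a where "a = \<mu> aff_d"
  note sp = span_mon[OF E_highest[OF v(3)] dv v(4)]
  let ?W = "\<lambda>b. {w. dd w = scV b w}"
  have "\<exists>j::nat. b = a - of_nat j" if w: "w \<noteq> 0" "dd w = scV b w" for w b
  proof (rule ccontr)
    assume b: "\<nexists>j::nat. b = a - of_nat j"
    have "{w. \<exists>j. mon v j w} \<subseteq> (\<Union>c\<in>UNIV - {b}. ?W c)"
    proof
      fix u assume "u \<in> {w. \<exists>j. mon v j w}"
      then obtain j where j: "mon v j u" by blast
      have "a + of_int j = a - of_nat (nat (- j))" using mon_le[OF j] by simp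
      then have "a + of_int j \<noteq> b" using b by metis
      then show "u \<in> (\<Union>c\<in>UNIV - {b}. ?W c)" using mon_dd[OF j dv] by (auto simp: a_def)
    qed
    then have "w \<in> V.span (\<Union>c\<in>UNIV - {b}. ?W c)" using sp[of w] V.span_mono by blast
    have "w = 0"
    proof (rule V.eigen_independent[where I = UNIV and W = ?W and i = b])
      show "\<exists>P c. Vector_Spaces.linear scV scV P \<and> (\<forall>k\<in>UNIV. \<forall>w\<in>?W k. P w = scV (c k) w) \<and> c i \<noteq> c i'"
        if "i \<noteq> i'" for i i'
        using linear_dd that by (intro exI[of _ dd] exI[of _ "\<lambda>i. i"]) auto
      have "Vector_Spaces.linear scV scV dd" by (rule linear_dd)
      then interpret d: Vector_Spaces.linear scV scV dd .
      show "V.subspace (?W i)" for i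
        by (auto intro!: V.subspaceI simp: d.add d.scale V.scale_right_distrib V.scale_left_commute)
    qed (use w \<open>w \<in> V.span (\<Union>c\<in>UNIV - {b}. ?W c)\<close> in auto)
    then show False using w by simp
  qed
  then show thesis using that[of v a] v(1) sp dv by (auto simp: a_def)
qed

lemma dd_bounded: "\<exists>a0. \<forall>v a. v \<noteq> 0 \<longrightarrow> dd v = scV a v \<longrightarrow> (\<exists>j::nat. a = a0 - of_nat j)"
  using degrees by metis

text \<open>Mode \<open>n\<close> carries a monomial of degree \<open>j\<close> to degree
  \<open>j + n\<close>, which exceeds the top degree 0 once \<open>n > - j\<close>.\<close>

lemma smooth: "\<exists>N::nat. \<forall>x. \<forall>n > int N. E x n w = 0"
proof -
  obtain v a where v: "\<And>w. w \<in> V.span {w. \<exists>j. mon v j w}" "dd v = scV a v"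
    "\<And>w b. w \<noteq> 0 \<Longrightarrow> dd w = scV b w \<Longrightarrow> \<exists>j::nat. b = a - of_nat j"
    using degrees by metis
  show ?thesis using v(1)[of w]
  proof (induction rule: V.span_induct_alt)
    case base
    then show ?case by simp
  next
    case (step c u w)
    then obtain j N where j: "mon v j u" and N: "\<forall>x. \<forall>n > int N. E x n w = 0" by blast
    have u: "E x n u = 0" if "n > int (nat (- j))" for x n
    proof (rule ccontr)
      assume nz: "E x n u \<noteq> 0"
      have "dd (E x n u) = scV (a + of_int j + of_int n) (E x n u)"
        using mon_dd[OF j v(2)] by (simp add: d_E Er.add Er.scale V.scale_left_distrib)
      then obtain i :: nat where "a + of_int j + of_int n = a - of_nat i" using v(3)[OF nz] by blast
      then have "of_int (j + n + int i) = (0 :: complex)" by (simp add: algebra_simps)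
      then have "j + n + int i = 0" by (simp only: of_int_eq_0_iff)
      then show False using that by (simp split: if_splits)
    qed
    show ?case
    proof (intro exI[of _ "max (nat (- j)) N"] allI impI)
      fix x n assume "n > int (max (nat (- j)) N)"
      then have "n > int (nat (- j))" "n > int N" by linarith+
      then have "E x n u = 0" "E x n w = 0" using u N by blast+
      then show "E x n (scV c u + w) = 0" by (simp add: Er.add Er.scale)
    qed
  qed
qed

subsection \<open>The even part\<close>

abbreviation "t \<equiv> h \<inter> G0"

lemma h_subspace: "G.subspace h" and G0_subspace: "G.subspace G0" and t_subspace: "G.subspace t"
  and H_subspace: "G.subspace H"
proof -
  show h: "G.subspace h" and G0: "G.subspace G0"
    using cartan(1) G0_simple by (auto simp: cartan_subalgebra_def lie_subalgebra_def simple_lie_algebra_def)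
  show "G.subspace t" by (rule G.subspace_inter[OF h G0])
  show "G.subspace H" unfolding center lie_center_def using gr_subspace[of 0]
    by (auto intro!: G.subspaceI simp: br_l.add br_l.scale G.subspace_0 G.subspace_add G.subspace_scale)
qed

lemma H_g: "H \<subseteq> gr 0" and H_central: "x \<in> H \<Longrightarrow> y \<in> gr 0 \<Longrightarrow> br x y = 0"
  by (auto simp: center lie_center_def)

lemma G0_g: "G0 \<subseteq> gr 0"
proof
  fix x assume "x \<in> G0"
  then have "x = x + 0" "0 \<in> H" using G.subspace_0[OF H_subspace] by auto
  then show "x \<in> gr 0" unfolding even_part(1) using \<open>x \<in> G0\<close> by blast
qed

lemma H_central': "x \<in> gr 0 \<Longrightarrow> y \<in> H \<Longrightarrow> br x y = 0"
  using br_skew[of x y] H_central[of y x] H_g by auto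

lemma G0_closed: "x \<in> G0 \<Longrightarrow> y \<in> G0 \<Longrightarrow> br x y \<in> G0"
  using G0_simple by (auto simp: simple_lie_algebra_def lie_subalgebra_def)

text \<open>Central elements normalize \<open>h\<close>, which is its own normalizer.\<close>

lemma H_h: "H \<subseteq> h"
proof
  fix x assume x: "x \<in> H"
  have "br x y \<in> h" if "y \<in> h" for y
    using H_central[OF x, of y] that cartan(2) G.subspace_0[OF h_subspace] by auto
  then show "x \<in> h" using cartan(1) by (auto simp: cartan_subalgebra_def)
qed

lemma h_decomp: assumes "y \<in> h" shows "\<exists>a\<in>t. \<exists>b\<in>H. y = a + b"
proof -
  obtain a b where ab: "a \<in> G0" "b \<in> H" "y = a + b" using assms cartan(2) even_part(1) by blast
  then have "a = y - b" by simp
  then have "a \<in> h" using assms ab H_h G.subspace_diff[OF h_subspace] by blast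
  then show ?thesis using ab by blast
qed

lemma G0_perfect: "G0 = G.span {br x y | x y. x \<in> G0 \<and> y \<in> G0}" (is "_ = ?I")
proof -
  have "lie_ideal sc br G0 ?I"
    unfolding lie_ideal_def
  proof (intro conjI ballI)
    show "?I \<subseteq> G0" using G0_closed by (intro G.span_minimal G0_subspace) auto
    then show "br x y \<in> ?I" if "x \<in> G0" "y \<in> ?I" for x y
      using that by (intro G.span_base) blast
  qed simp
  moreover have "?I \<noteq> {0}"
  proof -
    obtain x y where "x \<in> G0" "y \<in> G0" "br x y \<noteq> 0" using G0_simple by (auto simp: simple_lie_algebra_def)
    moreover from this have "br x y \<in> ?I" by (intro G.span_base) blast
    ultimately show ?thesis by blast
  qed
  ultimately show ?thesis using G0_simple unfolding simple_lie_algebra_def by blast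
qed

lemma G0_induct:
  assumes "x \<in> G0" "Vector_Spaces.linear sc s2 f" "\<And>a b. a \<in> G0 \<Longrightarrow> b \<in> G0 \<Longrightarrow> f (br a b) = 0"
  shows "f x = 0"
proof -
  interpret f: Vector_Spaces.linear sc s2 f by (rule assms(2))
  show ?thesis
    using f.eq_0_on_span[of "{br x y | x y. x \<in> G0 \<and> y \<in> G0}" x] assms(1,3) G0_perfect by blast
qed

text \<open>\<open>G0\<close> is spanned by brackets \<open>br a b\<close>, and invariance moves
  \<open>b\<close> onto the central \<open>y\<close>.\<close>

lemma B_G0_H: assumes "x \<in> G0" "y \<in> H" shows "B x y = 0"
proof (rule G0_induct[OF assms(1) lin_B_l])
  fix a b assume "a \<in> G0" "b \<in> G0"
  then show "B (br a b) y = 0" using H_central'[of b y] assms G0_g by (simp add: B_inv subset_iff)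
qed

lemma B_nondeg_even:
  assumes "y \<in> gr 0" "\<And>x. x \<in> gr 0 \<Longrightarrow> B x y = 0" shows "y = 0"
proof (rule form_nondegenerate)
  fix z
  obtain a b where "a \<in> gr 0" "b \<in> gr 1" "z = a + b" using gr_split by blast
  then show "B y z = 0"
    using assms B_sym[of y a] form_even[of y 0 b 1] by (simp add: B_r.add)
qed

lemma B_nondeg_G0:
  assumes "y \<in> G0" "\<And>x. x \<in> G0 \<Longrightarrow> B x y = 0" shows "y = 0"
proof (rule B_nondeg_even)
  show "y \<in> gr 0" using assms G0_g by blast
  fix x assume "x \<in> gr 0"
  then obtain a b where ab: "a \<in> G0" "b \<in> H" "x = a + b" using even_part(1) by blast
  have "B b y = B y b" using ab H_g assms(1) G0_g by (intro B_sym) auto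
  then show "B x y = 0" using assms B_G0_H[OF assms(1) ab(2)] ab by (simp add: B_l.add)
qed

lemma B_nondeg_H:
  assumes "y \<in> H" "\<And>x. x \<in> H \<Longrightarrow> B x y = 0" shows "y = 0"
proof (rule B_nondeg_even)
  show "y \<in> gr 0" using assms H_g by blast
  fix x assume "x \<in> gr 0"
  then obtain a b where ab: "a \<in> G0" "b \<in> H" "x = a + b" using even_part(1) by blast
  then show "B x y = 0" using assms B_G0_H[OF ab(1) assms(1)] by (simp add: B_l.add)
qed

subsection \<open>Weight vectors\<close>

lemma weight_vectors_span:
  "v \<in> V.span (\<Union>\<mu>\<in>dual_space (aff_scale sc) (aff_cartan h). weight_space scV act (aff_cartan h) \<mu>)"
proof -
  let ?D = "dual_space (aff_scale sc) (aff_cartan h)"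
  have "direct_sum_decomp scV ?D (weight_space scV act (aff_cartan h))"
    using integrable by (simp add: integrable_module_def)
  then obtain f where f: "\<forall>i. i \<notin> ?D \<longrightarrow> f i = 0" "\<forall>i\<in>?D. f i \<in> weight_space scV act (aff_cartan h) i"
    "v = (\<Sum>i | f i \<noteq> 0. f i)"
    unfolding direct_sum_decomp_def by blast
  show ?thesis unfolding f(3) using f(1,2) by (intro V.span_sum V.span_base) blast
qed

definition "wv w \<longleftrightarrow> (\<forall>y\<in>h. \<exists>c. E y 0 w = scV c w)"

lemma cartan_loop: "y \<in> h \<Longrightarrow> loop y 0 \<in> aff_cartan h"
  by (auto simp: loop_def aff_cartan_def)

lemma weight_space_wv: "w \<in> weight_space scV act (aff_cartan h) \<mu> \<Longrightarrow> wv w"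
  using cartan_loop by (auto simp: weight_space_def wv_def E_def)

lemma span_wv: "v \<in> V.span {w. wv w}"
  using weight_vectors_span[of v] V.span_mono[of "\<Union>\<mu>\<in>dual_space (aff_scale sc) (aff_cartan h). weight_space scV act (aff_cartan h) \<mu>" "{w. wv w}"]
    weight_space_wv by blast

lemma wv_ext:
  assumes "Vector_Spaces.linear scV scV f" "\<And>w. wv w \<Longrightarrow> f w = 0" shows "f v = 0"
proof -
  interpret f: Vector_Spaces.linear scV scV f by (rule assms(1))
  show ?thesis using f.eq_0_on_span[of "{w. wv w}" v] span_wv assms(2) by blast
qed

section \<open>Faithfulness of \<open>G0\<close> and diagonal action of \<open>t\<close>\<close>

lemma E_even: "x \<in> gr 0 \<Longrightarrow> y \<in> gr 0 \<Longrightarrow> E x n (E y m v) = E y m (E x n v) + E (br x y) (n + m) v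
     + scV (if n + m = 0 then of_int n * B x y * of_nat k else 0) v"
  using E_bracket[of x 0 y 0 n m v] by simp

lemma E0_even: "x \<in> gr 0 \<Longrightarrow> y \<in> gr 0 \<Longrightarrow> E x 0 (E y m v) = E y m (E x 0 v) + E (br x y) m v"
  using E_even[of x y 0 m v] by (cases "m = 0") simp_all

text \<open>The kernel is an ideal. Were it all of \<open>G0\<close>, then every mode of
  \<open>br a b\<close>, being a commutator of a zero mode with a mode, would vanish, and with it
  all modes of \<open>G0\<close>. The commutator of \<open>x(1)\<close> and \<open>y(-1)\<close>
  would then give \<open>B x y\<close> times the nonzero level equal to 0, against
  nondegeneracy.\<close>

lemma faithful: assumes "x \<in> G0" "\<And>v. E x 0 v = 0" shows "x = 0"
proof -
  let ?K = "{x \<in> G0. \<forall>v. E x 0 v = 0}"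
  have "lie_ideal sc br G0 ?K"
    unfolding lie_ideal_def
  proof (intro conjI ballI)
    show "G.subspace ?K" using G0_subspace
      by (auto intro!: G.subspaceI simp: G.subspace_0 G.subspace_add G.subspace_scale El.add El.scale)
    fix x y assume x: "x \<in> G0" and y: "y \<in> ?K"
    have "E (br x y) 0 v = 0" for v
      using E0_even[of x y 0 v] x y G0_g by (auto simp: subset_iff)
    then show "br x y \<in> ?K" using x y G0_closed by blast
  qed auto
  moreover have "?K \<noteq> G0"
  proof
    assume K: "?K = G0"
    have z: "E x n v = 0" if "x \<in> G0" for x n v
    proof (rule G0_induct[OF that linear_E_left])
      fix a b assume ab: "a \<in> G0" "b \<in> G0"
      have "E a 0 w = 0" for w using K ab by blast
      then show "E (br a b) n v = 0" using E0_even[of a b n v] ab G0_g by (simp add: subset_iff)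
    qed
    obtain v :: 'v where v: "v \<noteq> 0" using degrees by metis
    have "B x y = 0" if "x \<in> G0" "y \<in> G0" for x y
      using E_even[of x y 1 "-1" v] z[OF that(1)] z[OF that(2)] z[OF G0_closed[OF that]] that G0_g v level(1)
      by (auto simp: subset_iff)
    then have "y = 0" if "y \<in> G0" for y using B_nondeg_G0 that by blast
    then show False using G0_simple G0_closed by (auto simp: simple_lie_algebra_def)
  qed
  ultimately have "?K = {0}" using G0_simple unfolding simple_lie_algebra_def by blast
  then show ?thesis using assms by blast
qed

text \<open>Both elements act by scalars on a weight vector, so their bracket kills the module, and
  faithfulness applies.\<close>

lemma t_abelian: assumes "x \<in> t" "y \<in> t" shows "br x y = 0"
proof (rule faithful)
  show "br x y \<in> G0" using assms G0_closed by blast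
  fix v show "E (br x y) 0 v = 0"
  proof (rule wv_ext[OF linear_E])
    fix w assume "wv w"
    then obtain c d where "E x 0 w = scV c w" "E y 0 w = scV d w" using assms unfolding wv_def by blast
    then show "E (br x y) 0 w = 0"
      using E0_even[of x y 0 w] assms G0_g by (auto simp: subset_iff Er.scale mult.commute)
  qed
qed

text \<open>Such an \<open>x\<close> commutes with \<open>t\<close> and \<open>H\<close>, hence
  normalizes \<open>h\<close>, which is self-normalizing.\<close>

lemma t_self_centralizing:
  assumes "x \<in> G0" "\<And>y. y \<in> t \<Longrightarrow> br y x = 0" shows "x \<in> t"
proof -
  have xg: "x \<in> gr 0" using assms(1) G0_g by blast
  have "br x y \<in> h" if y: "y \<in> h" for y
  proof -
    obtain a b where ab: "a \<in> t" "b \<in> H" "y = a + b" using h_decomp[OF y] by blast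
    have "br x a = - br a x" using ab xg G0_g by (intro br_skew) auto
    then have "br x y = 0" using assms(2)[OF ab(1)] H_central'[OF xg ab(2)] by (simp add: ab(3) br_r.add)
    then show ?thesis using G.subspace_0[OF h_subspace] by simp
  qed
  then have "x \<in> h" using cartan(1) by (auto simp: cartan_subalgebra_def)
  then show ?thesis using assms by blast
qed

text \<open>A set \<open>M\<close> whose annihilator in \<open>G0\<close> has least dimension works:
  a nonzero element of the annihilator would be detected by one more weight vector.\<close>

lemma finite_faithful_set: "\<exists>M. finite M \<and> M \<subseteq> {w. wv w} \<and> (\<forall>x\<in>G0. (\<forall>v\<in>M. E x 0 v = 0) \<longrightarrow> x = 0)"
proof -
  define K where "K M = {x \<in> G0. \<forall>v\<in>M. E x 0 v = 0}" for M
  have Ks: "G.subspace (K M)" for M unfolding K_def using G0_subspace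
    by (auto intro!: G.subspaceI simp: G.subspace_0 G.subspace_add G.subspace_scale El.add El.scale)
  let ?P = "\<lambda>d. \<exists>M. finite M \<and> M \<subseteq> {w. wv w} \<and> G.dim (K M) = d"
  have "?P (G.dim (K {}))" by (intro exI[of _ "{}"]) simp
  define d0 where "d0 = (LEAST d. ?P d)"
  have "?P d0" unfolding d0_def by (rule LeastI[of ?P, OF \<open>?P (G.dim (K {}))\<close>])
  then obtain M where M: "finite M" "M \<subseteq> {w. wv w}" "G.dim (K M) = d0" by (elim exE conjE) (rule that)
  have "x = 0" if x: "x \<in> K M" for x
  proof (rule ccontr)
    assume nz: "x \<noteq> 0"
    have "\<exists>w. wv w \<and> E x 0 w \<noteq> 0"
    proof (rule ccontr)
      assume "\<not> ?thesis"
      then have "E x 0 w = 0" if "wv w" for w using that by blast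
      then have "E x 0 v = 0" for v by (rule wv_ext[OF linear_E])
      then show False using faithful[of x] x nz by (simp add: K_def)
    qed
    then obtain w where w: "wv w" "E x 0 w \<noteq> 0" by blast
    have "K (insert w M) \<subset> K M" using x w by (auto simp: K_def)
    then have "G.span (K (insert w M)) \<subset> G.span (K M)" using Ks by (metis G.span_eq_iff)
    then have "G.dim (K (insert w M)) < G.dim (K M)" by (rule dim_psubset)
    moreover have "?P (G.dim (K (insert w M)))" using M w by (intro exI[of _ "insert w M"]) auto
    then have "d0 \<le> G.dim (K (insert w M))" unfolding d0_def by (rule Least_le)
    ultimately show False using M(3) by simp
  qed
  then show ?thesis using M by (auto simp: K_def)
qed

text \<open>On a vector \<open>v\<close> of \<open>y\<close>-weight \<open>m\<close>, the element
  \<open>(ad y - a) z\<close> acts as \<open>y - (m + a)\<close> applied to \<open>z v\<close>.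
  Since \<open>x v\<close> is a finite sum of eigenvectors of \<open>y\<close>, finitely many values
  \<open>a\<close> produce an element killing \<open>v\<close>; collecting them over a finite
  faithful set produces 0.\<close>

lemma ad_annihilator:
  assumes y: "y \<in> t" and x: "x \<in> G0"
  shows "\<exists>as. distinct as \<and> fold (\<lambda>a z. br y z - sc a z) as x = 0"
proof -
  from finite_faithful_set obtain M where M: "finite M" "M \<subseteq> {w. wv w}"
    "\<forall>x\<in>G0. (\<forall>v\<in>M. E x 0 v = 0) \<longrightarrow> x = 0"
    by (elim exE conjE) (rule that)
  have yg: "y \<in> gr 0" and yh: "y \<in> h" using y G0_g by auto
  let ?ad = "\<lambda>a z. br y z - sc a z"
  have adG: "?ad a z \<in> G0" if "z \<in> G0" for a z
    using that y G0_closed G.subspace_diff[OF G0_subspace] G.subspace_scale[OF G0_subspace] by blast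
  have foldG: "fold ?ad as z \<in> G0" if "z \<in> G0" for as z
    using that by (induction as arbitrary: z) (use adG in auto)
  have "\<exists>A. finite A \<and> (\<forall>as. A \<subseteq> set as \<longrightarrow> E (fold ?ad as x) 0 v = 0)" if v: "v \<in> M" for v
  proof -
    obtain m where m: "E y 0 v = scV m v" using v M(2) yh unfolding wv_def by blast
    let ?op = "\<lambda>a u. E y 0 u - scV (m + a) u"
    have step: "E (?ad a z) 0 v = ?op a (E z 0 v)" if "z \<in> G0" for a z
      using E0_even[of y z 0 v] yg that G0_g m
      by (auto simp: subset_iff El.diff El.scale Er.scale V.scale_left_distrib)
    have fold: "E (fold ?ad as z) 0 v = fold ?op as (E z 0 v)" if "z \<in> G0" for as z
      using that by (induction as arbitrary: z) (simp_all add: step adG)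
    have lin: "Vector_Spaces.linear scV scV (fold ?op as)" for as
    proof (induction as)
      case Nil
      then show ?case by (simp add: V.linear_id id_def[symmetric] del: id_apply)
    next
      case (Cons a as)
      have "Vector_Spaces.linear scV scV (?op a)"
        by unfold_locales (simp_all add: Er.add Er.scale V.scale_right_distrib V.scale_right_diff_distrib V.scale_left_commute)
      then show ?case using Vector_Spaces.linear_compose[OF _ Cons] by (simp only: fold.simps)
    qed
    let ?W = "\<lambda>b. {u. E y 0 u = scV b u}"
    have "E x 0 v \<in> V.span {w. wv w}" by (rule span_wv)
    moreover have "{w. wv w} \<subseteq> (\<Union>b\<in>UNIV. ?W b)" using yh by (auto simp: wv_def)
    ultimately have "E x 0 v \<in> V.span (\<Union>b\<in>UNIV. ?W b)" using V.span_mono by blast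
    moreover have "V.subspace (?W b)" for b
      by (auto intro!: V.subspaceI simp: Er.add Er.scale V.scale_right_distrib V.scale_left_commute)
    ultimately obtain J f where J: "finite J" "\<forall>b\<in>J. f b \<in> ?W b" "E x 0 v = (\<Sum>b\<in>J. f b)"
      using V.span_UN_subspaces[of UNIV ?W "E x 0 v"] by blast
    have kill: "(b - m \<in> set as \<longrightarrow> fold ?op as u = 0)" if u: "u \<in> ?W b" for as b u
      using u
    proof (induction as arbitrary: u)
      case (Cons a as)
      have u: "?op a u = scV (b - m - a) u" using Cons.prems by (simp add: V.scale_left_distrib V.scale_left_diff_distrib)
      have "?op a u \<in> ?W b" unfolding u using Cons.prems by (simp add: Er.scale V.scale_left_commute mult.commute)
      then have IH: "b - m \<in> set as \<longrightarrow> fold ?op as (?op a u) = 0" by (rule Cons.IH)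
      interpret l: Vector_Spaces.linear scV scV "fold ?op as" by (rule lin)
      show ?case
      proof
        assume "b - m \<in> set (a # as)"
        then consider "b - m = a" | "b - m \<in> set as" by auto
        then show "fold ?op (a # as) u = 0"
        proof cases
          case 1
          then have "?op a u = 0" using u by simp
          then show ?thesis by simp
        qed (use IH in simp)
      qed
    qed simp
    have "E (fold ?ad as x) 0 v = 0" if "(\<lambda>b. b - m) ` J \<subseteq> set as" for as
    proof -
      interpret l: Vector_Spaces.linear scV scV "fold ?op as" by (rule lin)
      have "fold ?op as (f b) = 0" if "b \<in> J" for b
        using kill[of "f b" b as] J(2) that \<open>_ \<subseteq> set as\<close> by blast
      then show ?thesis unfolding fold[OF x] J(3) l.sum by simp
    qed
    then show ?thesis using J(1) by (intro exI[of _ "(\<lambda>b. b - m) ` J"]) blast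
  qed
  then obtain A where A: "\<And>v. v \<in> M \<Longrightarrow> finite (A v)" "\<And>v as. v \<in> M \<Longrightarrow> A v \<subseteq> set as \<Longrightarrow> E (fold ?ad as x) 0 v = 0"
    by metis
  obtain as where as: "set as = (\<Union>v\<in>M. A v)" "distinct as"
    using finite_distinct_list[of "\<Union>v\<in>M. A v"] M(1) A(1) by auto
  have "fold ?ad as x = 0"
    using M(3) foldG[OF x, of as] A(2) as(1) by blast
  then show ?thesis using as(2) by blast
qed

text \<open>The common eigenspaces of \<open>Y\<close> are stable under \<open>ad y\<close>, because
  \<open>t\<close> is abelian, so \<open>eigen_decomposition\<close> refines them.\<close>

lemma simultaneous_diagonal:
  assumes "finite Y" "Y \<subseteq> t" "x \<in> G0"
  shows "x \<in> G.span {z \<in> G0. \<forall>y\<in>Y. \<exists>a. br y z = sc a z}"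
  using assms
proof (induction Y rule: finite_induct)
  case empty
  then show ?case by (auto intro: G.span_base)
next
  case (insert y Y)
  let ?S = "{z \<in> G0. \<forall>y\<in>insert y Y. \<exists>a. br y z = sc a z}"
  have "z \<in> G.span ?S" if z: "z \<in> G0" "\<forall>y\<in>Y. \<exists>a. br y z = sc a z" for z
  proof -
    obtain c where c: "\<And>y. y \<in> Y \<Longrightarrow> br y z = sc (c y) z" using z(2) by metis
    let ?E = "{z \<in> G0. \<forall>y\<in>Y. br y z = sc (c y) z}"
    have y: "y \<in> t" and Y: "Y \<subseteq> t" using insert.prems by auto
    have Es: "G.subspace ?E" using G0_subspace
      by (auto intro!: G.subspaceI simp: G.subspace_0 G.subspace_add G.subspace_scale br_r.add br_r.scale
        G.scale_right_distrib G.scale_left_commute)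
    have stab: "br y ` ?E \<subseteq> ?E"
    proof clarify
      fix z' assume z': "z' \<in> G0" "\<forall>y\<in>Y. br y z' = sc (c y) z'"
      have "br y' (br y z') = sc (c y') (br y z')" if "y' \<in> Y" for y'
        using jacobi[of y' y z'] t_abelian[of y' y] that y Y z' G0_g by (auto simp: subset_iff br_r.scale)
      then show "br y z' \<in> G0 \<and> (\<forall>y'\<in>Y. br y' (br y z') = sc (c y') (br y z'))"
        using z' y G0_closed by blast
    qed
    have zE: "z \<in> ?E" using z c by blast
    obtain as where as: "distinct as" "fold (\<lambda>a z. br y z - sc a z) as z = 0"
      using ad_annihilator[OF y z(1)] by blast
    have "z \<in> G.span {z' \<in> ?E. \<exists>a\<in>set as. br y z' = sc a z'}"
      by (rule G.eigen_decomposition[OF lin_br_r as(1) Es stab zE as(2)])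
    moreover have "{z' \<in> ?E. \<exists>a\<in>set as. br y z' = sc a z'} \<subseteq> ?S" by blast
    ultimately show ?thesis using G.span_mono by blast
  qed
  then have "G.span {z \<in> G0. \<forall>y\<in>Y. \<exists>a. br y z = sc a z} \<subseteq> G.span ?S" by (intro G.span_minimal) auto
  then show ?case using insert by blast
qed

lemma t_diagonal:
  assumes "x \<in> G0" shows "x \<in> G.span (\<Union>\<alpha>\<in>dual_space sc t. root_space sc br t G0 \<alpha>)"
proof -
  obtain Y where Y: "Y \<subseteq> t" "G.independent Y" "t \<subseteq> G.span Y" using G.basis_exists by metis
  have fin: "finite Y" using Y(2) finiteI_independent by blast
  have "z \<in> G.span (\<Union>\<alpha>\<in>dual_space sc t. root_space sc br t G0 \<alpha>)"
    if z: "z \<in> G0" "\<forall>y\<in>Y. \<exists>a. br y z = sc a z" for z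
  proof (cases "z = 0")
    case True
    then show ?thesis by (simp add: G.span_zero)
  next
    case False
    have "G.subspace {y. \<exists>a. br y z = sc a z}"
    proof (rule G.subspaceI)
      show "0 \<in> {y. \<exists>a. br y z = sc a z}" by (auto intro: exI[of _ 0])
      show "y + y' \<in> {y. \<exists>a. br y z = sc a z}" if "y \<in> {y. \<exists>a. br y z = sc a z}" "y' \<in> {y. \<exists>a. br y z = sc a z}" for y y'
        using that by (auto simp: br_l.add simp flip: G.scale_left_distrib)
      show "sc c y \<in> {y. \<exists>a. br y z = sc a z}" if "y \<in> {y. \<exists>a. br y z = sc a z}" for c y
        using that by (auto simp: br_l.scale)
    qed
    then have "G.span Y \<subseteq> {y. \<exists>a. br y z = sc a z}" using z(2) by (intro G.span_minimal) auto
    then have "\<forall>y\<in>t. \<exists>a. br y z = sc a z" using Y(3) by blast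
    then obtain c where c: "\<And>y. y \<in> t \<Longrightarrow> br y z = sc (c y) z" by metis
    define \<alpha> where "\<alpha> y = (if y \<in> t then c y else 0)" for y
    have \<alpha>: "br y z = sc (\<alpha> y) z" if "y \<in> t" for y using c that by (simp add: \<alpha>_def)
    have inj: "a = b" if "sc a z = sc b z" for a b using that False by simp
    have "\<alpha> (x + y) = \<alpha> x + \<alpha> y" if "x \<in> t" "y \<in> t" for x y
      using \<alpha>[OF that(1)] \<alpha>[OF that(2)] \<alpha>[OF G.subspace_add[OF t_subspace that]]
      by (intro inj) (simp add: br_l.add G.scale_left_distrib)
    moreover have "\<alpha> (sc a y) = a * \<alpha> y" if "y \<in> t" for a y
      using \<alpha>[OF that] \<alpha>[OF G.subspace_scale[OF t_subspace that, of a]] by (intro inj) (auto simp: br_l.scale)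
    ultimately have "\<alpha> \<in> dual_space sc t" unfolding dual_space_def by (simp add: \<alpha>_def)
    moreover have "z \<in> root_space sc br t G0 \<alpha>" using z(1) \<alpha> by (simp add: root_space_def)
    ultimately show ?thesis by (intro G.span_base) blast
  qed
  then have "G.span {z \<in> G0. \<forall>y\<in>Y. \<exists>a. br y z = sc a z} \<subseteq> G.span (\<Union>\<alpha>\<in>dual_space sc t. root_space sc br t G0 \<alpha>)"
    by (intro G.span_minimal) auto
  then show ?thesis using simultaneous_diagonal[OF fin Y(1) assms] by blast
qed

section \<open>Weight spaces of the even affine algebra\<close>

abbreviation "Wt \<nu> a \<equiv> {w. (\<forall>y\<in>t \<union> H. E y 0 w = scV (\<nu> y) w) \<and> dd w = scV a w}"

lemma aff_d_cartan: "aff_d \<in> aff_cartan h"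
  unfolding aff_d_def aff_cartan_def using G.subspace_0[OF h_subspace] by (auto intro!: exI[of _ 0])

lemma weight_decomposition:
  "v \<in> V.span (\<Union>(\<nu>, a)\<in>{\<nu>. \<forall>y. y \<notin> t \<union> H \<longrightarrow> \<nu> y = 0} \<times> UNIV. Wt \<nu> a)"
proof -
  have "weight_space scV act (aff_cartan h) \<mu> \<subseteq> (\<Union>(\<nu>, a)\<in>{\<nu>. \<forall>y. y \<notin> t \<union> H \<longrightarrow> \<nu> y = 0} \<times> UNIV. Wt \<nu> a)" for \<mu>
  proof
    fix w assume w: "w \<in> weight_space scV act (aff_cartan h) \<mu>"
    let ?\<nu> = "\<lambda>y. if y \<in> t \<union> H then \<mu> (loop y 0) else 0"
    have "E y 0 w = scV (?\<nu> y) w" if "y \<in> t \<union> H" for y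
    proof -
      have "loop y 0 \<in> aff_cartan h" using that H_h by (intro cartan_loop) auto
      then show ?thesis using w that by (simp add: weight_space_def E_def)
    qed
    moreover have "dd w = scV (\<mu> aff_d) w" using w aff_d_cartan by (simp add: weight_space_def dd_def)
    ultimately show "w \<in> (\<Union>(\<nu>, a)\<in>{\<nu>. \<forall>y. y \<notin> t \<union> H \<longrightarrow> \<nu> y = 0} \<times> UNIV. Wt \<nu> a)"
      by (intro UN_I[of "(?\<nu>, \<mu> aff_d)"]) auto
  qed
  then show ?thesis using weight_vectors_span[of v] V.span_mono[of "\<Union>\<mu>\<in>dual_space (aff_scale sc) (aff_cartan h). weight_space scV act (aff_cartan h) \<mu>"]
    by blast
qed

lemma cartan_act:
  assumes x: "x \<in> aff_cartan h" shows "\<exists>c. \<forall>w\<in>Wt \<nu> a. act x w = scV c w"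
proof -
  obtain y b c where y: "y \<in> h" "x = (Poly_Mapping.single 0 y, b, c)" using x by (auto simp: aff_cartan_def)
  obtain y1 y2 where y12: "y1 \<in> t" "y2 \<in> H" "y = y1 + y2" using h_decomp[OF y(1)] by blast
  have "act x w = scV (\<nu> y1 + \<nu> y2 + b * of_nat k + c * a) w" if w: "w \<in> Wt \<nu> a" for w
  proof -
    have "act x w = E y 0 w + scV (b * of_nat k) w + scV c (dd w)"
    \<comment> \<open>For \<open>y = 0\<close> there are no keys and the sum in
      \<open>act_decomp\<close> is empty.\<close>
    proof (cases "y = 0")
      case False
      then show ?thesis unfolding y(2) act_decomp by simp
    qed (simp add: y(2) act_decomp)
    also have "E y 0 w = scV (\<nu> y1) w + scV (\<nu> y2) w" using w y12 by (simp add: El.add)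
    finally show ?thesis using w by (simp add: V.scale_left_distrib)
  qed
  then show ?thesis by blast
qed

lemma aff_cartan_add:
  assumes "x \<in> aff_cartan h" "y \<in> aff_cartan h" shows "x + y \<in> aff_cartan h"
proof -
  obtain u a b u' a' b' where "u \<in> h" "x = (Poly_Mapping.single 0 u, a, b)"
    "u' \<in> h" "y = (Poly_Mapping.single 0 u', a', b')"
    using assms unfolding aff_cartan_def by blast
  moreover from this have "x + y = (Poly_Mapping.single 0 (u + u'), a + a', b + b')"
    by (simp add: single_add)
  ultimately show ?thesis using G.subspace_add[OF h_subspace] unfolding aff_cartan_def by blast
qed

lemma aff_cartan_scale:
  assumes "x \<in> aff_cartan h" shows "aff_scale sc c x \<in> aff_cartan h"
proof -
  obtain u a b where "u \<in> h" "x = (Poly_Mapping.single 0 u, a, b)"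
    using assms unfolding aff_cartan_def by blast
  moreover from this have "aff_scale sc c x = (Poly_Mapping.single 0 (sc c u), c * a, c * b)"
    by (simp add: aff_scale_def map_single_poly_mapping)
  ultimately show ?thesis using G.subspace_scale[OF h_subspace] unfolding aff_cartan_def by blast
qed

text \<open>On a nonzero vector of \<open>Wt \<nu> a\<close> the affine Cartan subalgebra acts by a
  linear functional, since \<open>h\<close> splits into \<open>t\<close> and \<open>H\<close>,
  \<open>K\<close> acts by \<open>k\<close> and \<open>d\<close> by \<open>a\<close>. So
  \<open>Wt \<nu> a\<close> lies in a weight space of the module.\<close>

lemma weight_finite: "\<exists>T. finite T \<and> Wt \<nu> a \<subseteq> V.span T"
proof -
  define X where "X = Wt \<nu> a"
  have "\<exists>T. finite T \<and> X \<subseteq> V.span T"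
  proof (cases "X \<subseteq> {0}")
  case True
  then show ?thesis by (intro exI[of _ "{}"]) auto
next
  case False
  then obtain w0 where w0: "w0 \<in> X" "w0 \<noteq> 0" by blast
  have "\<forall>x\<in>aff_cartan h. \<exists>c. \<forall>w\<in>X. act x w = scV c w"
    unfolding X_def by (intro ballI cartan_act)
  from bchoice[OF this] obtain c where c: "\<forall>x\<in>aff_cartan h. \<forall>w\<in>X. act x w = scV (c x) w"
    by (elim exE) (rule that)
  define \<mu> where "\<mu> x = (if x \<in> aff_cartan h then c x else 0)" for x
  have \<mu>: "act x w = scV (\<mu> x) w" if "x \<in> aff_cartan h" "w \<in> X" for x w
    using c that by (simp add: \<mu>_def)
  have inj: "p = q" if "scV p w0 = scV q w0" for p q using that w0 by simp
  have "\<mu> (x + y) = \<mu> x + \<mu> y" if "x \<in> aff_cartan h" "y \<in> aff_cartan h" for x y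
    using \<mu>[OF that(1) w0(1)] \<mu>[OF that(2) w0(1)] \<mu>[OF aff_cartan_add[OF that] w0(1)]
    by (intro inj) (simp add: actl.add V.scale_left_distrib)
  moreover have "\<mu> (aff_scale sc p x) = p * \<mu> x" if "x \<in> aff_cartan h" for x p
    using \<mu>[OF that w0(1)] \<mu>[OF aff_cartan_scale[OF that, of p] w0(1)] by (intro inj) (auto simp: actl.scale)
  ultimately have "\<mu> \<in> dual_space (aff_scale sc) (aff_cartan h)"
    unfolding dual_space_def by (simp add: \<mu>_def)
  then have "fin_dim scV (weight_space scV act (aff_cartan h) \<mu>)"
    using weight_spaces by (simp add: finite_dim_weight_spaces_def)
  then obtain T where "finite T" "weight_space scV act (aff_cartan h) \<mu> \<subseteq> V.span T" by (auto simp: fin_dim_def)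
  moreover have "X \<subseteq> weight_space scV act (aff_cartan h) \<mu>"
    using \<mu> unfolding weight_space_def by blast
  ultimately show ?thesis by blast
  qed
  then show ?thesis by (simp only: X_def)
qed

lemma G0_finite: "\<exists>T. finite T \<and> (\<forall>xs. set xs \<subseteq> G0 \<longrightarrow> foldr (\<lambda>x. E x 0) xs v \<in> V.span T)"
proof -
  obtain T where T: "finite T" "enveloping_orbit scV act (range (\<lambda>x. loop x 0)) v \<subseteq> V.span T"
    using integrable unfolding integrable_module_def fin_dim_def by blast
  have "foldr (\<lambda>x. E x 0) xs v \<in> V.span T" for xs
  proof -
    have "foldr (\<lambda>x. E x 0) xs v = foldr act (map (\<lambda>x. loop x 0) xs) v"
      by (simp add: foldr_map E_def comp_def)
    moreover have "foldr act (map (\<lambda>x. loop x 0) xs) v \<in> enveloping_orbit scV act (range (\<lambda>x. loop x 0)) v"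
      unfolding enveloping_orbit_def
      by (rule V.span_base, intro CollectI exI[of _ "map (\<lambda>x. loop x 0) xs"]) auto
    ultimately show ?thesis using T(2) by auto
  qed
  then show ?thesis using T(1) by blast
qed

section \<open>Passage to the even affine algebra\<close>

sublocale split: split_simple sc Bas br B "gr 0" G0 t \<Pi>0 \<theta>
proof unfold_locales
  show "G0 \<subseteq> gr 0" by (rule G0_g)
  show "br x y = 0" if "x \<in> t" "y \<in> t" for x y using that by (rule t_abelian)
  show "x \<in> t" if "x \<in> G0" "\<And>y. y \<in> t \<Longrightarrow> br y x = 0" for x using that by (rule t_self_centralizing)
  show "y = 0" if "y \<in> G0" "\<And>x. x \<in> G0 \<Longrightarrow> B x y = 0" for y using that by (rule B_nondeg_G0)
qed (use G0_simple t_subspace t_diagonal simple_roots_G0 highest form_positive form_normalized in auto)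

sublocale even: even_module sc Bas br B "gr 0" G0 t \<Pi>0 \<theta> scV E k H dd
proof unfold_locales
  show "E x m (E y n v) = E y n (E x m v) + E (br x y) (m + n) v + scV (if m + n = 0 then of_int m * B x y * of_nat k else 0) v"
    if "x \<in> gr 0" "y \<in> gr 0" for x y m n v by (rule E_even[OF that])
  show "\<exists>N::nat. \<forall>x. \<forall>n > int N. E x n v = 0" for v by (rule smooth)
  show "br x y = 0" if "x \<in> H" "y \<in> gr 0" for x y by (rule H_central[OF that])
  show "\<exists>a\<in>G0. \<exists>b\<in>H. x = a + b" if "x \<in> gr 0" for x using that even_part(1) by blast
  show "B x y = 0" if "x \<in> G0" "y \<in> H" for x y by (rule B_G0_H[OF that])
  show "y = 0" if "y \<in> H" "\<And>x. x \<in> H \<Longrightarrow> B x y = 0" for y using that by (rule B_nondeg_H)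
  show "dd (E x n v) = E x n (dd v) + scV (of_int n) (E x n v)" for x n v by (rule d_E)
  show "locally_nilpotent (E f 0)" if "\<beta> \<in> \<Pi>0" "(e, f) \<in> chevalley_pairs sc br t G0 \<beta>" for \<beta> e f
    using integrable that unfolding integrable_module_def affine_chevalley_generators_def E_def by fastforce
  show "locally_nilpotent (E e (- 1))" if "(e, f) \<in> chevalley_pairs sc br t G0 \<theta>" for e f
    using integrable that unfolding integrable_module_def affine_chevalley_generators_def E_def by fastforce
  show "v \<in> V.span (\<Union>(\<nu>, a)\<in>{\<nu>. \<forall>y. y \<notin> t \<union> H \<longrightarrow> \<nu> y = 0} \<times> UNIV. Wt \<nu> a)" for v
    by (rule weight_decomposition)
  show "\<exists>T. finite T \<and> Wt \<nu> a \<subseteq> V.span T" for \<nu> a by (rule weight_finite)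
  show "\<exists>a0. \<forall>v a. v \<noteq> 0 \<longrightarrow> dd v = scV a v \<longrightarrow> (\<exists>j::nat. a = a0 - of_nat j)" by (rule dd_bounded)
  show "\<exists>T. finite T \<and> (\<forall>xs. set xs \<subseteq> G0 \<longrightarrow> foldr (\<lambda>x. E x 0) xs v \<in> V.span T)" for v by (rule G0_finite)
  show "0 < k" by (rule level)
  show "H \<subseteq> gr 0" by (rule H_g)
  show "G0 \<inter> H = {0}" by (rule even_part(2))
qed (use H_subspace linear_dd in \<open>auto simp: Er.add Er.scale El.add El.scale Vector_Spaces.linear_iff\<close>)

text \<open>The central element acts by a scalar, so stability under the even modes and
  \<open>d\<close> is stability under the whole even affine algebra.\<close>

lemma submodule_iff: "submodule scV act (aff_sub (gr 0)) N \<longleftrightarrow> even.sub N"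
proof
  assume N: "submodule scV act (aff_sub (gr 0)) N"
  have "loop x n \<in> aff_sub (gr 0)" if "x \<in> gr 0" for x n
    using that G.subspace_0[OF gr_subspace] by (auto simp: aff_sub_def loop_def lookup_single when_def)
  moreover have "aff_d \<in> aff_sub (gr 0)"
    using G.subspace_0[OF gr_subspace] by (auto simp: aff_sub_def aff_d_def)
  ultimately show "even.sub N" using N unfolding submodule_def even.sub_def by (simp add: E_def dd_def)
next
  assume N: "even.sub N"
  have "act x w \<in> N" if "x \<in> aff_sub (gr 0)" "w \<in> N" for x w
  proof -
    obtain f a b where x: "x = (f, a, b)" by (cases x)
    have Ns: "V.subspace N" and E: "\<And>x n w. x \<in> gr 0 \<Longrightarrow> w \<in> N \<Longrightarrow> E x n w \<in> N" and d: "\<And>w. w \<in> N \<Longrightarrow> dd w \<in> N"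
      using N by (auto simp: even.sub_def)
    have "lookup f n \<in> gr 0" for n using that(1) x by (simp add: aff_sub_def)
    then show ?thesis unfolding x act_decomp using that(2)
      by (intro V.subspace_add V.subspace_sum V.subspace_scale Ns E d)
  qed
  then show "submodule scV act (aff_sub (gr 0)) N" using N by (auto simp: submodule_def even.sub_def)
qed

lemma irreducible_iff: "irreducible_submodule scV act (aff_sub (gr 0)) N \<longleftrightarrow> even.irr N"
  unfolding irreducible_submodule_def even.irr_def submodule_iff ..

theorem completely_reducible_even_part: "completely_reducible scV act (aff_sub (gr 0))"
proof (rule completely_reducibleI[OF module_vector_space act_linear_right])
  show "v \<in> V.span (\<Union>{W. irreducible_submodule scV act (aff_sub (gr 0)) W})" for v
    unfolding irreducible_iff by (rule even.span_irr)
qed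

end

theorem mainTheorem4:
  fixes sc :: "complex \<Rightarrow> 'g::ab_group_add \<Rightarrow> 'g"
    and gr :: "bit \<Rightarrow> 'g set"
    and br :: "'g \<Rightarrow> 'g \<Rightarrow> 'g"
    and B :: "'g \<Rightarrow> 'g \<Rightarrow> complex"
    and G\<^sub>0 H h :: "'g set"
    and \<Pi> \<Pi>\<^sub>0 :: "('g \<Rightarrow> complex) set"
    and \<theta> :: "'g \<Rightarrow> complex"
    and scV :: "complex \<Rightarrow> 'v::ab_group_add \<Rightarrow> 'v"
    and grV :: "bit \<Rightarrow> 'v set"
    and act :: "'g affine \<Rightarrow> 'v \<Rightarrow> 'v"
    and k :: nat
  assumes basic: "basic_lie_superalgebra sc gr br B"
    and center: "H = lie_center br (gr 0)"
    and G0_simple: "simple_lie_algebra sc br G\<^sub>0"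
    and even_part: "gr 0 = {x + y | x y. x \<in> G\<^sub>0 \<and> y \<in> H}" "G\<^sub>0 \<inter> H = {0}"
    and cartan: "cartan_subalgebra sc br h" "h \<subseteq> gr 0"
    and simple_roots: "simple_root_system (roots sc br h UNIV) \<Pi>"
    and simple_roots_G0: "simple_root_system (roots sc br (h \<inter> G\<^sub>0) G\<^sub>0) \<Pi>\<^sub>0"
    and highest: "highest_root (roots sc br (h \<inter> G\<^sub>0) G\<^sub>0) \<Pi>\<^sub>0 \<theta>"
    and form_positive: "positive_definite_on_roots B (h \<inter> G\<^sub>0) (roots sc br (h \<inter> G\<^sub>0) G\<^sub>0)"
    and form_normalized: "dual_form B (h \<inter> G\<^sub>0) \<theta> \<theta> = 2"
    and module: "super_module (aff_scale sc) (aff_grading gr) (aff_bracket sc br B) scV grV act"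
    and irreducible: "irreducible_super_module scV grV act"
    and integrable: "integrable_module sc br h G\<^sub>0 \<Pi>\<^sub>0 \<theta> scV act"
    and highest_weight: "highest_weight_module sc br h \<Pi> scV act"
    and weight_spaces: "finite_dim_weight_spaces sc h scV act"
    and level: "k > 0" "\<And>v. act aff_K v = scV (of_nat k) v"
  shows "completely_reducible scV act (aff_sub (gr 0))"
proof -
  interpret affine_setting sc gr br B scV grV act G\<^sub>0 H h \<Pi> \<Pi>\<^sub>0 \<theta> k
    by (intro affine_setting.intro affine_setting_axioms.intro assms)
  show ?thesis by (rule completely_reducible_even_part)
qed

end
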